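(* If $E\to X$ is a holomorphic fibre bundle on a connected complex manifold $X$ whose fibre $Y$ is Kobayashi hyperbolic with $\dim Y>0$, then the total space $E$ is not an Oka manifold.
   Context: A complex manifold $Y$ is an Oka manifold if maps from every Stein manifold $S$ to $Y$ satisfy the Oka principle with approximation and interpolation: for every compact $\mathcal{O}(S)$-convex set $K\subset S$, closed complex subvariety $S'\subset S$, and continuous map $f_0:S\to Y$ that is holomorphic on a neighbourhood of $K$ and on $S'$, there is a homotopy $f_t:S\to Y$ $(t\in[0,1])$ such that every $f_t$ is holomorphic near $K$, uniformly as close as desired to $f_0$ on $K$, and equal to $f_0$ on $S'$, and $f_1$ is holomorphic on $S$. *)

theory Defs
  imports "HOL-Analysis.Analysis"
begin

section \<open>Holomorphic functions on open subsets of affine space\<close>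

text \<open>Complex affine space of dimension \<open>n\<close> is the set of sequences supported in \<open>{..<n}\<close>, so
  that the dimension may be quantified inside formulas. Its topology is induced by the product
  topology of the type \<^typ>\<open>nat \<Rightarrow> complex\<close>, hence is the usual one.\<close>

definition affine_space :: "nat \<Rightarrow> (nat \<Rightarrow> complex) set" where
  "affine_space n = {z. \<forall>i\<ge>n. z i = 0}"

text \<open>Complex (Frechet) differentiability at every point, for \<open>V\<close> open in \<^term>\<open>affine_space n\<close>;
  \<open>a\<close> is the vector of partial derivatives at \<open>z\<close>.\<close>

definition holomorphic_in :: "nat \<Rightarrow> (nat \<Rightarrow> complex) set \<Rightarrow> ((nat \<Rightarrow> complex) \<Rightarrow> complex) \<Rightarrow> bool" where
  "holomorphic_in n V f \<longleftrightarrow>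
     (\<forall>z\<in>V. \<exists>a :: nat \<Rightarrow> complex.
        ((\<lambda>w. cmod (f w - f z - (\<Sum>i<n. a i * (w i - z i))) / (\<Sum>i<n. cmod (w i - z i)))
           \<longlongrightarrow> 0) (at z within V))"

definition partial_deriv :: "nat \<Rightarrow> ((nat \<Rightarrow> complex) \<Rightarrow> complex) \<Rightarrow> (nat \<Rightarrow> complex) \<Rightarrow> complex" where
  "partial_deriv j f z = deriv (\<lambda>t. f (z(j := t))) (z j)"


section \<open>Complex manifolds\<close>

text \<open>A chart is a pair \<open>(U, \<phi>)\<close> of an open set and a coordinate map; only the values of \<open>\<phi>\<close> on
  \<open>U\<close> matter. Likewise, a map between manifolds is a total function of which only the values on
  the underlying space matter. Atlases need not be maximal.\<close>

record 'a cmanifold =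
  cm_top :: "'a topology"
  cm_dim :: nat
  cm_charts :: "('a set \<times> ('a \<Rightarrow> nat \<Rightarrow> complex)) set"

text \<open>Manifolds are nonempty, Hausdorff, second countable and pure-dimensional, but not
  necessarily connected.\<close>

definition complex_manifold :: "'a cmanifold \<Rightarrow> bool" where
  "complex_manifold M \<longleftrightarrow>
     topspace (cm_top M) \<noteq> {} \<and> Hausdorff_space (cm_top M) \<and> second_countable (cm_top M) \<and>
     (\<forall>p\<in>topspace (cm_top M). \<exists>(U, \<phi>)\<in>cm_charts M. p \<in> U) \<and>
     (\<forall>(U, \<phi>)\<in>cm_charts M. openin (cm_top M) U \<and>
        openin (top_of_set (affine_space (cm_dim M))) (\<phi> ` U) \<and>
        homeomorphic_map (subtopology (cm_top M) U) (top_of_set (\<phi> ` U)) \<phi>) \<and>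
     (\<forall>(U, \<phi>)\<in>cm_charts M. \<forall>(V, \<psi>)\<in>cm_charts M. \<forall>j<cm_dim M.
        holomorphic_in (cm_dim M) (\<phi> ` (U \<inter> V)) (\<lambda>z. \<psi> (inv_into U \<phi> z) j))"

definition holomorphic_map :: "'a cmanifold \<Rightarrow> 'b cmanifold \<Rightarrow> ('a \<Rightarrow> 'b) \<Rightarrow> bool" where
  "holomorphic_map M N f \<longleftrightarrow>
     continuous_map (cm_top M) (cm_top N) f \<and>
     (\<forall>(U, \<phi>)\<in>cm_charts M. \<forall>(V, \<psi>)\<in>cm_charts N. \<forall>j<cm_dim N.
        holomorphic_in (cm_dim M) (\<phi> ` (U \<inter> f -` V)) (\<lambda>z. \<psi> (f (inv_into U \<phi> z)) j))"

definition biholomorphic_map :: "'a cmanifold \<Rightarrow> 'b cmanifold \<Rightarrow> ('a \<Rightarrow> 'b) \<Rightarrow> bool" where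
  "biholomorphic_map M N f \<longleftrightarrow>
     holomorphic_map M N f \<and>
     (\<exists>g. holomorphic_map N M g \<and>
        (\<forall>p\<in>topspace (cm_top M). g (f p) = p) \<and> (\<forall>q\<in>topspace (cm_top N). f (g q) = q))"

definition open_submanifold :: "'a cmanifold \<Rightarrow> 'a set \<Rightarrow> 'a cmanifold" where
  "open_submanifold M W =
     \<lparr>cm_top = subtopology (cm_top M) W, cm_dim = cm_dim M,
      cm_charts = (\<lambda>(U, \<phi>). (U \<inter> W, \<phi>)) ` cm_charts M\<rparr>"

definition product_manifold :: "'a cmanifold \<Rightarrow> 'b cmanifold \<Rightarrow> ('a \<times> 'b) cmanifold" where
  "product_manifold M N =
     \<lparr>cm_top = prod_topology (cm_top M) (cm_top N), cm_dim = cm_dim M + cm_dim N,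
      cm_charts = (\<lambda>((U, \<phi>), (V, \<psi>)).
        (U \<times> V, \<lambda>(p, q) i. if i < cm_dim M then \<phi> p i else \<psi> q (i - cm_dim M)))
          ` (cm_charts M \<times> cm_charts N)\<rparr>"

definition complex_line :: "complex cmanifold" where
  "complex_line =
     \<lparr>cm_top = euclidean, cm_dim = 1, cm_charts = {(UNIV, \<lambda>z i. if i = 0 then z else 0)}\<rparr>"

definition unit_disc :: "complex cmanifold" where
  "unit_disc = open_submanifold complex_line (ball 0 1)"


section \<open>Stein manifolds and subvarieties\<close>

definition holomorphic_hull :: "'a cmanifold \<Rightarrow> 'a set \<Rightarrow> 'a set" where
  "holomorphic_hull M K =
     {p \<in> topspace (cm_top M). \<forall>f. holomorphic_map M complex_line f \<longrightarrow>
        (\<forall>c. (\<forall>q\<in>K. cmod (f q) \<le> c) \<longrightarrow> cmod (f p) \<le> c)}"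

definition compact_holomorphically_convex :: "'a cmanifold \<Rightarrow> 'a set \<Rightarrow> bool" where
  "compact_holomorphically_convex M K \<longleftrightarrow> compactin (cm_top M) K \<and> holomorphic_hull M K = K"

text \<open>The last three conditions: the holomorphic functions separate points; at every point, some
  \<open>dim S\<close> of them have linearly independent differentials; compact sets have compact hulls.\<close>

definition stein_manifold :: "'a cmanifold \<Rightarrow> bool" where
  "stein_manifold S \<longleftrightarrow>
     complex_manifold S \<and>
     (\<forall>p\<in>topspace (cm_top S). \<forall>q\<in>topspace (cm_top S). p \<noteq> q \<longrightarrow>
        (\<exists>f. holomorphic_map S complex_line f \<and> f p \<noteq> f q)) \<and>
     (\<forall>p\<in>topspace (cm_top S). \<exists>F :: nat \<Rightarrow> 'a \<Rightarrow> complex.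
        (\<forall>i<cm_dim S. holomorphic_map S complex_line (F i)) \<and>
        (\<forall>(U, \<phi>)\<in>cm_charts S. p \<in> U \<longrightarrow>
          (\<forall>c :: nat \<Rightarrow> complex.
             (\<forall>j<cm_dim S.
               (\<Sum>i<cm_dim S. c i * partial_deriv j (\<lambda>z. F i (inv_into U \<phi> z)) (\<phi> p)) = 0) \<longrightarrow>
             (\<forall>i<cm_dim S. c i = 0)))) \<and>
     (\<forall>K. compactin (cm_top S) K \<longrightarrow> compactin (cm_top S) (holomorphic_hull S K))"

definition closed_subvariety :: "'a cmanifold \<Rightarrow> 'a set \<Rightarrow> bool" where
  "closed_subvariety M A \<longleftrightarrow>
     closedin (cm_top M) A \<and>
     (\<forall>p\<in>topspace (cm_top M). \<exists>U F. openin (cm_top M) U \<and> p \<in> U \<and> finite F \<and>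
        (\<forall>f\<in>F. holomorphic_map (open_submanifold M U) complex_line f) \<and>
        A \<inter> U = {q \<in> U. \<forall>f\<in>F. f q = 0})"

definition holomorphic_near :: "'a cmanifold \<Rightarrow> 'b cmanifold \<Rightarrow> 'a set \<Rightarrow> ('a \<Rightarrow> 'b) \<Rightarrow> bool" where
  "holomorphic_near M N K f \<longleftrightarrow>
     (\<exists>U. openin (cm_top M) U \<and> K \<subseteq> U \<and> holomorphic_map (open_submanifold M U) N f)"

text \<open>Holomorphy of the restriction of \<open>f\<close> to a subvariety \<open>A\<close>, regarded as a reduced complex
  space: locally \<open>f\<close> agrees on \<open>A\<close> with a holomorphic map on an open set of the ambient
  manifold.\<close>

definition holomorphic_on_subvariety ::
    "'a cmanifold \<Rightarrow> 'b cmanifold \<Rightarrow> 'a set \<Rightarrow> ('a \<Rightarrow> 'b) \<Rightarrow> bool" where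
  "holomorphic_on_subvariety M N A f \<longleftrightarrow>
     (\<forall>p\<in>A. \<exists>U g. openin (cm_top M) U \<and> p \<in> U \<and>
        holomorphic_map (open_submanifold M U) N g \<and> (\<forall>q\<in>A \<inter> U. g q = f q))"


section \<open>Oka manifolds\<close>

text \<open>Closeness on the compact set \<open>K\<close> is measured by an arbitrary metric \<open>d\<close> inducing the
  topology of \<open>Y\<close>; the condition does not depend on the choice of \<open>d\<close>.

  The underlying set of \<open>S\<close> is taken in the type \<^typ>\<open>nat \<Rightarrow> complex\<close>. This is no restriction:
  a second countable manifold has at most the cardinality of the continuum, so each Stein manifold
  is biholomorphic to one of this form.\<close>

definition oka_manifold :: "'a cmanifold \<Rightarrow> bool" where
  "oka_manifold Y \<longleftrightarrow>
     complex_manifold Y \<and>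
     (\<forall>(S :: (nat \<Rightarrow> complex) cmanifold) K S' f0 d (\<epsilon> :: real).
        stein_manifold S \<and> compact_holomorphically_convex S K \<and> closed_subvariety S S' \<and>
        continuous_map (cm_top S) (cm_top Y) f0 \<and>
        holomorphic_near S Y K f0 \<and> holomorphic_on_subvariety S Y S' f0 \<and>
        Metric_space (topspace (cm_top Y)) d \<and>
        Metric_space.mtopology (topspace (cm_top Y)) d = cm_top Y \<and> \<epsilon> > 0 \<longrightarrow>
        (\<exists>f1. homotopic_with
                (\<lambda>f. holomorphic_near S Y K f \<and> (\<forall>p\<in>K. d (f p) (f0 p) < \<epsilon>) \<and> (\<forall>p\<in>S'. f p = f0 p))
                (cm_top S) (cm_top Y) f0 f1 \<and>
              holomorphic_map S Y f1))"


section \<open>Kobayashi hyperbolicity\<close>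

text \<open>The distance function of the Poincare metric \<open>|dz| / (1 - |z|^2)\<close> on the unit disc.\<close>

definition poincare_dist :: "complex \<Rightarrow> complex \<Rightarrow> real" where
  "poincare_dist a b = artanh (cmod ((a - b) / (1 - cnj a * b)))"

text \<open>\<open>disc_chain M p q s\<close>: a chain of holomorphic discs joins \<open>p\<close> to \<open>q\<close> and has total
  Poincare length \<open>s\<close>.\<close>

inductive disc_chain :: "'a cmanifold \<Rightarrow> 'a \<Rightarrow> 'a \<Rightarrow> real \<Rightarrow> bool" for M where
  refl: "p \<in> topspace (cm_top M) \<Longrightarrow> disc_chain M p p 0"
| step: "disc_chain M p (f a) s \<Longrightarrow> holomorphic_map unit_disc M f \<Longrightarrow> a \<in> ball 0 1 \<Longrightarrow>
    b \<in> ball 0 1 \<Longrightarrow> disc_chain M p (f b) (s + poincare_dist a b)"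

text \<open>Points in different connected components are at distance \<open>\<infinity>\<close>, the infimum of the empty
  set.\<close>

definition kobayashi_pseudodist :: "'a cmanifold \<Rightarrow> 'a \<Rightarrow> 'a \<Rightarrow> ereal" where
  "kobayashi_pseudodist M p q = Inf {ereal s |s. disc_chain M p q s}"

definition kobayashi_hyperbolic :: "'a cmanifold \<Rightarrow> bool" where
  "kobayashi_hyperbolic M \<longleftrightarrow>
     (\<forall>p\<in>topspace (cm_top M). \<forall>q\<in>topspace (cm_top M). p \<noteq> q \<longrightarrow> kobayashi_pseudodist M p q > 0)"


section \<open>Holomorphic fibre bundles\<close>

definition holomorphic_fibre_bundle ::
    "'e cmanifold \<Rightarrow> 'x cmanifold \<Rightarrow> 'y cmanifold \<Rightarrow> ('e \<Rightarrow> 'x) \<Rightarrow> bool" where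
  "holomorphic_fibre_bundle E X Y \<pi> \<longleftrightarrow>
     complex_manifold E \<and> complex_manifold X \<and> complex_manifold Y \<and> holomorphic_map E X \<pi> \<and>
     (\<forall>x\<in>topspace (cm_top X). \<exists>U \<theta>. openin (cm_top X) U \<and> x \<in> U \<and>
        biholomorphic_map
          (open_submanifold E {e \<in> topspace (cm_top E). \<pi> e \<in> U})
          (product_manifold (open_submanifold X U) Y) \<theta> \<and>
        (\<forall>e\<in>topspace (cm_top E). \<pi> e \<in> U \<longrightarrow> fst (\<theta> e) = \<pi> e))"

end

theory Submission
  imports Defs "HOL-Complex_Analysis.Cauchy_Integral_Formula"
begin

text \<open>The bundle is flat: a family \<open>h\<^sub>u\<close> of self-maps of the hyperbolic fibre \<open>Y\<close>, holomorphic in the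
  parameter \<open>u\<close> of a disc and with \<open>h\<^sub>0 = id\<close>, has zero derivative at \<open>u = 0\<close>, because the iterates
  \<open>u \<mapsto> h\<^sub>u\<^sup>n(y)\<close> are discs centred at \<open>y\<close> whose derivative at \<open>0\<close> is \<open>n\<close> times that of \<open>u \<mapsto> h\<^sub>u(y)\<close>,
  while by Barth's argument discs centred at \<open>y\<close> are equicontinuous at \<open>0\<close>. Hence transition maps along
  a curve are locally constant, and the pull-back of \<open>E\<close> along an entire curve \<open>\<complex> \<rightarrow> X\<close> is
  trivial over every rectangle. The vertical component of an entire curve in \<open>E\<close> is thus an entire curve
  in \<open>Y\<close>, which is constant. But if \<open>E\<close> were Oka, a small nonconstant disc in a fibre could be
  approximated on the closed unit disc by entire curves.\<close>

section \<open>Affine space\<close>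

text \<open>Since X is arbitrary, E may contain many entire curves, and only their vertical part can
  be controlled. That part has no global meaning a priori; flatness along the curve supplies one,
  and over a rectangle there is no monodromy. Equicontinuity at the centre survives, and with
  Cauchy's inequality on one fixed disc it bounds the derivatives of all iterates at once. All
  objects are tested on holomorphic curves from open plane sets (\<open>hcurve\<close>). The
  dependence of transition maps on the parameter, the automorphisms of Y and the identifications of
  fibres with Y are thus expressed by one-variable functions, in place of tangent bundles and
  pulled-back bundles. The last step works with large discs rather than with an entire curve in Y:
  in a disc of radius R the points 0 and 1 are at Poincare distance artanh (1/R), so identifications
  over a bounded square suffice to contradict hyperbolicity.\<close>

definition adist :: "nat \<Rightarrow> (nat \<Rightarrow> complex) \<Rightarrow> (nat \<Rightarrow> complex) \<Rightarrow> real" where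
  "adist n w z = (\<Sum>i<n. cmod (w i - z i))"

lemma adist_nonneg: "0 \<le> adist n w z"
  by (simp add: adist_def sum_nonneg)

lemma adist_self [simp]: "adist n z z = 0"
  by (simp add: adist_def)

lemma cmod_le_adist: "i < n \<Longrightarrow> cmod (w i - z i) \<le> adist n w z"
  unfolding adist_def by (rule member_le_sum) auto

text \<open>\<open>adist\<close> is the l1 distance in the first \<open>n\<close> coordinates, the
  denominator in \<open>holomorphic_in\<close>. On arbitrary sequences it is only a pseudodistance;
  on the affine space it separates points.\<close>

lemma adist_eq_0:
  assumes "w \<in> affine_space n" "z \<in> affine_space n" "adist n w z = 0"
  shows "w = z"
proof
  fix i
  show "w i = z i"
  proof (cases "i < n")
    case True
    then show ?thesis using cmod_le_adist[OF True, of w z] assms(3) by simp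
  next
    case False
    then show ?thesis using assms(1,2) by (simp add: affine_space_def)
  qed
qed

lemma continuous_coordinate [continuous_intros]:
  "continuous_on S (\<lambda>w. w i :: 'b::topological_space)"
  by (rule continuous_on_subset[OF continuous_on_product_coordinates]) simp

lemma continuous_on_adist: "continuous_on S (\<lambda>w. adist n w z)"
  unfolding adist_def by (intro continuous_intros)

lemma closed_affine_space: "closed (affine_space n)"
proof -
  have "affine_space n = (\<Inter>i\<in>{n..}. {z. z i = 0})" by (auto simp: affine_space_def)
  moreover have "closed {z :: nat \<Rightarrow> complex. z i = 0}" for i
    by (intro closed_Collect_eq continuous_intros)
  ultimately show ?thesis by auto
qed

lemma compact_PiE_UNIV:
  fixes K :: "'i \<Rightarrow> 'b::topological_space set"
  assumes "\<And>i. compact (K i)"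
  shows "compact (Pi\<^sub>E UNIV K)"
proof -
  have "compactin (product_topology (\<lambda>i. euclidean) UNIV) (Pi\<^sub>E UNIV K)"
    using assms by (subst compactin_PiE) auto
  then show ?thesis by (simp add: euclidean_product_topology)
qed

lemma compact_adist_cball: "compact {w \<in> affine_space n. adist n w z \<le> \<rho>}"
proof -
  \<comment> \<open>A product over all indices: a disc for each of the \<open>n\<close> true
    coordinates, a singleton for every other index.\<close>
  define K where "K i = (if i < n then cball (z i) \<rho> else {0})" for i
  have "compact (Pi\<^sub>E UNIV K)"
    by (rule compact_PiE_UNIV) (simp add: K_def)
  moreover have "closed {w \<in> affine_space n. adist n w z \<le> \<rho>}"
    unfolding Collect_conj_eq
    by (intro closed_Int closed_Collect_le continuous_on_adist continuous_intros)
       (simp add: closed_affine_space)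
  moreover have "{w \<in> affine_space n. adist n w z \<le> \<rho>} \<subseteq> Pi\<^sub>E UNIV K"
  proof
    fix w assume w: "w \<in> {w \<in> affine_space n. adist n w z \<le> \<rho>}"
    have "w i \<in> K i" for i
    proof (cases "i < n")
      case True
      then show ?thesis using cmod_le_adist[OF True, of w z] w
        by (simp add: K_def dist_norm norm_minus_commute)
    next
      case False
      then show ?thesis using w by (simp add: K_def affine_space_def)
    qed
    then show "w \<in> Pi\<^sub>E UNIV K" by auto
  qed
  ultimately show ?thesis
    using compact_Int_closed by (metis (no_types, lifting) inf.absorb2)
qed

lemma compact_adist_sphere: "compact {w \<in> affine_space n. adist n w z = \<rho>}"
proof -
  have "{w \<in> affine_space n. adist n w z = \<rho>} =
        {w \<in> affine_space n. adist n w z \<le> \<rho>} \<inter> {w. adist n w z = \<rho>}" by auto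
  moreover have "closed {w. adist n w z = \<rho>}"
    by (intro closed_Collect_eq continuous_on_adist continuous_intros)
  ultimately show ?thesis using compact_Int_closed[OF compact_adist_cball] by simp
qed

lemma adist_cball_subset:
  assumes V: "openin (top_of_set (affine_space n)) V" and z: "z \<in> V"
  obtains \<rho> where "\<rho> > 0" "\<And>w. w \<in> affine_space n \<Longrightarrow> adist n w z \<le> \<rho> \<Longrightarrow> w \<in> V"
proof -
  obtain T where T: "open T" "V = affine_space n \<inter> T"
    using V by (auto simp: openin_open)
  have "openin (product_topology (\<lambda>i. euclidean) UNIV) T"
    using T by (simp add: euclidean_product_topology)
  from product_topology_open_contains_basis[OF this, of z] z T
  obtain X where X: "z \<in> Pi\<^sub>E UNIV X" "\<And>i. open (X i)" "Pi\<^sub>E UNIV X \<subseteq> T"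
    by auto
  have "\<exists>e>0. cball (z i) e \<subseteq> X i" for i
    using X(1) open_contains_cball_eq[OF X(2)] by blast
  then obtain e where e: "\<And>i. e i > 0" "\<And>i. cball (z i) (e i) \<subseteq> X i" by metis
  \<comment> \<open>The 1 covers \<open>n = 0\<close>, where no radius is available. Coordinates
    from \<open>n\<close> on vanish at both points and impose no bound.\<close>
  define \<rho> where "\<rho> = Min (insert 1 (e ` {..<n}))"
  have "\<rho> > 0" unfolding \<rho>_def using e by (subst Min_gr_iff) auto
  moreover have "w \<in> V" if w: "w \<in> affine_space n" "adist n w z \<le> \<rho>" for w
  proof -
    have "w i \<in> X i" for i
    proof (cases "i < n")
      case True
      then have "\<rho> \<le> e i" by (simp add: \<rho>_def)
      then have "w i \<in> cball (z i) (e i)"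
        using cmod_le_adist[OF True, of w z] w by (simp add: dist_norm norm_minus_commute)
      then show ?thesis using e by blast
    next
      case False
      then have "w i = z i" using w z T by (simp add: affine_space_def)
      then show ?thesis using X by auto
    qed
    then show ?thesis using X T w by auto
  qed
  ultimately show thesis by (rule that)
qed

lemma tendsto_coordinatewise:
  fixes f :: "'a \<Rightarrow> 'i \<Rightarrow> 'b::topological_space"
  assumes "\<And>i. ((\<lambda>x. f x i) \<longlongrightarrow> l i) F"
  shows "(f \<longlongrightarrow> l) F"
proof (rule topological_tendstoI)
  fix S assume S: "open S" "l \<in> S"
  have "openin (product_topology (\<lambda>i. euclidean) UNIV) S"
    using S by (simp add: euclidean_product_topology)
  from product_topology_open_contains_basis[OF this S(2)]
  obtain X where X: "l \<in> Pi\<^sub>E UNIV X" "\<And>i. open (X i)" "finite {i. X i \<noteq> UNIV}" "Pi\<^sub>E UNIV X \<subseteq> S"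
    by auto
  have "eventually (\<lambda>x. \<forall>i\<in>{i. X i \<noteq> UNIV}. f x i \<in> X i) F"
    unfolding eventually_ball_finite_distrib[OF X(3)]
    using assms X(1,2) by (auto intro!: topological_tendstoD)
  then show "eventually (\<lambda>x. f x \<in> S) F"
    by eventually_elim (use X(4) in blast)
qed

text \<open>The chain rule along a curve. The vector \<open>a\<close> is obtained before the curve,
  so the derivative is one fixed linear form in the velocity \<open>c'\<close>; the additivity of
  velocities rests on this. As \<open>V\<close> is an arbitrary subset, the curve is required to
  stay in it near \<open>u0\<close>.\<close>

lemma holomorphic_in_chain:
  assumes hol: "holomorphic_in n V f" and z: "z \<in> V" and V: "V \<subseteq> affine_space n"
  obtains a where "\<And>c c' u0. c u0 = z \<Longrightarrow>
      (\<And>i. i < n \<Longrightarrow> ((\<lambda>u. c u i) has_field_derivative c' i) (at u0)) \<Longrightarrow>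
      eventually (\<lambda>u. c u \<in> V) (nhds u0) \<Longrightarrow>
      ((\<lambda>u. f (c u)) has_field_derivative (\<Sum>i<n. a i * c' i)) (at u0)"
proof -
  obtain a where a: "((\<lambda>w. cmod (f w - f z - (\<Sum>i<n. a i * (w i - z i))) / (\<Sum>i<n. cmod (w i - z i)))
           \<longlongrightarrow> 0) (at z within V)"
    using hol z unfolding holomorphic_in_def by blast
  define g where "g w = f w - f z - (\<Sum>i<n. a i * (w i - z i))" for w
  define r where "r w = cmod (g w) / adist n w z" for w
  have r: "(r \<longlongrightarrow> 0) (at z within V)"
    using a unfolding r_def g_def adist_def .
  show thesis
  proof (rule that)
    fix c c' u0
    assume c0: "c u0 = z"
      and c': "\<And>i. i < n \<Longrightarrow> ((\<lambda>u. c u i) has_field_derivative c' i) (at u0)"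
      and cV: "eventually (\<lambda>u. c u \<in> V) (nhds u0)"
    have cV': "eventually (\<lambda>u. c u \<in> V) (at u0)"
      using cV by (simp add: eventually_nhds_conv_at)
    have "((\<lambda>u. c u i) \<longlongrightarrow> z i) (at u0)" for i
    proof (cases "i < n")
      case True
      then show ?thesis using c'[OF True] c0
        by (metis DERIV_isCont isContD)
    next
      case False
      have "eventually (\<lambda>u. z i = c u i) (at u0)"
        using cV'
      proof eventually_elim
        case (elim u)
        then have "c u \<in> affine_space n" "z \<in> affine_space n" using z V by auto
        then show ?case using False by (simp add: affine_space_def)
      qed
      then show ?thesis by (rule Lim_transform_eventually[OF tendsto_const])
    qed
    then have lim: "(c \<longlongrightarrow> z) (at u0)" by (rule tendsto_coordinatewise)
    \<comment> \<open>\<open>r z\<close> is 0 as a quotient by 0, so the limit also holds along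
      unpunctured neighbourhoods of \<open>z\<close>, and the curve may return to \<open>z\<close>
      near \<open>u0\<close>.\<close>
    have r0: "(r \<longlongrightarrow> r z) (at z within V)" using r by (simp add: r_def g_def)
    have "filterlim c (inf (nhds z) (principal V)) (at u0)"
      using lim cV' by (simp add: filterlim_inf filterlim_principal)
    from filterlim_compose[OF r0[unfolded tendsto_at_within_iff_tendsto_nhds] this]
    have rc: "((\<lambda>u. r (c u)) \<longlongrightarrow> 0) (at u0)"
      by (simp add: r_def[of z] g_def)
    have "((\<lambda>u. (c u i - z i) / (u - u0)) \<longlongrightarrow> c' i) (at u0)" if "i < n" for i
      using c'[OF that] c0 by (simp add: has_field_derivative_iff)
    then have lim1: "((\<lambda>u. \<Sum>i<n. a i * ((c u i - z i) / (u - u0))) \<longlongrightarrow> (\<Sum>i<n. a i * c' i)) (at u0)"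
      and lim2: "((\<lambda>u. \<Sum>i<n. cmod ((c u i - z i) / (u - u0))) \<longlongrightarrow> (\<Sum>i<n. cmod (c' i))) (at u0)"
      by (intro tendsto_sum tendsto_mult tendsto_norm tendsto_const; simp)+
    have "((\<lambda>u. r (c u) * (\<Sum>i<n. cmod ((c u i - z i) / (u - u0)))) \<longlongrightarrow> 0) (at u0)"
      using tendsto_mult[OF rc lim2] by simp
    moreover have "eventually (\<lambda>u. r (c u) * (\<Sum>i<n. cmod ((c u i - z i) / (u - u0)))
        = cmod (g (c u) / (u - u0))) (at u0)"
      using cV'
    proof eventually_elim
      case (elim u)
      have "(\<Sum>i<n. cmod ((c u i - z i) / (u - u0))) = adist n (c u) z / cmod (u - u0)"
        by (simp add: adist_def norm_divide sum_divide_distrib)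
      moreover have "g (c u) = 0" if "adist n (c u) z = 0"
        using adist_eq_0[OF _ _ that] elim z V by (force simp: g_def)
      ultimately show ?case by (auto simp: r_def norm_divide)
    qed
    ultimately have "((\<lambda>u. cmod (g (c u) / (u - u0))) \<longlongrightarrow> 0) (at u0)"
      by (rule Lim_transform_eventually)
    then have "((\<lambda>u. g (c u) / (u - u0)) \<longlongrightarrow> 0) (at u0)"
      by (rule tendsto_norm_zero_cancel)
    from tendsto_add[OF this lim1]
    have "((\<lambda>u. g (c u) / (u - u0) + (\<Sum>i<n. a i * ((c u i - z i) / (u - u0)))) \<longlongrightarrow>
        (\<Sum>i<n. a i * c' i)) (at u0)" by simp
    moreover have "g (c u) / (u - u0) + (\<Sum>i<n. a i * ((c u i - z i) / (u - u0))) =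
        (f (c u) - f (c u0)) / (u - u0)" for u
    proof -
      have "(\<Sum>i<n. a i * ((c u i - z i) / (u - u0))) = (\<Sum>i<n. a i * (c u i - z i)) / (u - u0)"
        by (simp add: sum_divide_distrib)
      then show ?thesis by (simp add: g_def c0 diff_divide_distrib)
    qed
    ultimately have "((\<lambda>u. (f (c u) - f (c u0)) / (u - u0)) \<longlongrightarrow> (\<Sum>i<n. a i * c' i)) (at u0)"
      by simp
    then show "((\<lambda>u. f (c u)) has_field_derivative (\<Sum>i<n. a i * c' i)) (at u0)"
      by (simp add: has_field_derivative_iff)
  qed
qed

section \<open>Holomorphic curves in manifolds\<close>

text \<open>The part of the manifold axioms that curves use. Unlike \<open>complex_manifold\<close>
  it passes to all open sets, also empty ones, and to products by a direct check.\<close>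

definition charted :: "'a cmanifold \<Rightarrow> bool" where
  "charted M \<longleftrightarrow>
     (\<forall>p\<in>topspace (cm_top M). \<exists>(U, \<phi>)\<in>cm_charts M. p \<in> U) \<and>
     (\<forall>(U, \<phi>)\<in>cm_charts M. openin (cm_top M) U \<and> inj_on \<phi> U \<and> \<phi> ` U \<subseteq> affine_space (cm_dim M))"

text \<open>Holomorphy is demanded in every chart, one coordinate at a time, so that one-variable
  theory applies directly. Openness of \<open>A\<close> is included because it makes preimages of
  charts open, where derivatives are taken.\<close>

definition hcurve :: "complex set \<Rightarrow> 'a cmanifold \<Rightarrow> (complex \<Rightarrow> 'a) \<Rightarrow> bool" where
  "hcurve A M c \<longleftrightarrow>
     open A \<and> continuous_map (top_of_set A) (cm_top M) c \<and>
     (\<forall>(U, \<phi>)\<in>cm_charts M. \<forall>j<cm_dim M. (\<lambda>z. \<phi> (c z) j) holomorphic_on (A \<inter> c -` U))"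

lemma charted_cover:
  assumes "charted M" "p \<in> topspace (cm_top M)"
  obtains U \<phi> where "(U, \<phi>) \<in> cm_charts M" "p \<in> U"
  using assms unfolding charted_def by blast

lemma charted_chart:
  assumes "charted M" "(U, \<phi>) \<in> cm_charts M"
  shows "openin (cm_top M) U" "inj_on \<phi> U" "\<phi> ` U \<subseteq> affine_space (cm_dim M)"
proof -
  have "case (U, \<phi>) of (U, \<phi>) \<Rightarrow> openin (cm_top M) U \<and> inj_on \<phi> U \<and> \<phi> ` U \<subseteq> affine_space (cm_dim M)"
    using assms unfolding charted_def by blast
  then show "openin (cm_top M) U" "inj_on \<phi> U" "\<phi> ` U \<subseteq> affine_space (cm_dim M)" by simp_all
qed

lemma affine_space_image_zero:
  "\<phi> ` U \<subseteq> affine_space n \<Longrightarrow> p \<in> U \<Longrightarrow> n \<le> i \<Longrightarrow> \<phi> p i = 0"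
  by (auto simp: affine_space_def)

lemma complex_manifold_charted:
  assumes "complex_manifold M"
  shows "charted M"
proof -
  have "openin (cm_top M) U \<and> inj_on \<phi> U \<and> \<phi> ` U \<subseteq> affine_space (cm_dim M)"
    if "(U, \<phi>) \<in> cm_charts M" for U \<phi>
  proof -
    have *: "openin (cm_top M) U" "openin (top_of_set (affine_space (cm_dim M))) (\<phi> ` U)"
        "homeomorphic_map (subtopology (cm_top M) U) (top_of_set (\<phi> ` U)) \<phi>"
      using assms that unfolding complex_manifold_def by auto
    have "inj_on \<phi> U"
      using homeomorphic_imp_injective_map[OF *(3)] openin_subset[OF *(1)]
      by (simp add: Int_absorb1)
    then show ?thesis using * openin_imp_subset by blast
  qed
  then show ?thesis using assms unfolding charted_def complex_manifold_def by blast
qed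

lemma charted_open_submanifold:
  assumes "charted M" "openin (cm_top M) W"
  shows "charted (open_submanifold M W)"
  unfolding charted_def
proof (intro conjI ballI)
  fix p assume p: "p \<in> topspace (cm_top (open_submanifold M W))"
  then have "p \<in> topspace (cm_top M)" "p \<in> W" by (auto simp: open_submanifold_def)
  with charted_cover[OF assms(1)] obtain U \<phi> where "(U, \<phi>) \<in> cm_charts M" "p \<in> U" by metis
  then show "\<exists>(U, \<phi>)\<in>cm_charts (open_submanifold M W). p \<in> U"
    using \<open>p \<in> W\<close> by (force simp: open_submanifold_def)
next
  fix C assume "C \<in> cm_charts (open_submanifold M W)"
  then obtain U \<phi> where C: "C = (U \<inter> W, \<phi>)" "(U, \<phi>) \<in> cm_charts M"
    by (auto simp: open_submanifold_def)
  note ch = charted_chart[OF assms(1) C(2)]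
  have "openin (subtopology (cm_top M) W) (U \<inter> W)"
    using ch by (auto simp: openin_subtopology)
  then show "case C of (U, \<phi>) \<Rightarrow> openin (cm_top (open_submanifold M W)) U \<and> inj_on \<phi> U \<and>
      \<phi> ` U \<subseteq> affine_space (cm_dim (open_submanifold M W))"
    using ch C by (auto simp: open_submanifold_def inj_on_def)
qed

lemma product_chart:
  assumes "(U, \<phi>) \<in> cm_charts M" "(V, \<psi>) \<in> cm_charts N"
  shows "(U \<times> V, \<lambda>(p, q) i. if i < cm_dim M then \<phi> p i else \<psi> q (i - cm_dim M))
      \<in> cm_charts (product_manifold M N)"
  unfolding product_manifold_def using assms
  by (auto intro!: image_eqI[of _ _ "((U, \<phi>), (V, \<psi>))"])

lemma charted_product_manifold:
  assumes "charted M" "charted N"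
  shows "charted (product_manifold M N)"
  unfolding charted_def
proof (intro conjI ballI)
  fix p assume p: "p \<in> topspace (cm_top (product_manifold M N))"
  then have "fst p \<in> topspace (cm_top M)" "snd p \<in> topspace (cm_top N)"
    by (auto simp: product_manifold_def)
  with charted_cover[OF assms(1)] charted_cover[OF assms(2)]
  obtain U \<phi> V \<psi> where "(U, \<phi>) \<in> cm_charts M" "fst p \<in> U" "(V, \<psi>) \<in> cm_charts N" "snd p \<in> V"
    by metis
  then have "(U \<times> V, \<lambda>(p, q) i. if i < cm_dim M then \<phi> p i else \<psi> q (i - cm_dim M))
      \<in> cm_charts (product_manifold M N)" "p \<in> U \<times> V"
    using product_chart by (blast, simp add: mem_Times_iff)
  then show "\<exists>(U, \<phi>)\<in>cm_charts (product_manifold M N). p \<in> U"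
    by (intro bexI[of _ "(U \<times> V, \<lambda>(p, q) i. if i < cm_dim M then \<phi> p i else \<psi> q (i - cm_dim M))"])
       simp_all
next
  fix C assume "C \<in> cm_charts (product_manifold M N)"
  then obtain U \<phi> V \<psi> where C: "(U, \<phi>) \<in> cm_charts M" "(V, \<psi>) \<in> cm_charts N"
    "C = (U \<times> V, \<lambda>(p, q) i. if i < cm_dim M then \<phi> p i else \<psi> q (i - cm_dim M))"
    by (auto simp: product_manifold_def)
  note ch = charted_chart[OF assms(1) C(1)] charted_chart[OF assms(2) C(2)]
  have "inj_on (\<lambda>(p, q) i. if i < cm_dim M then \<phi> p i else \<psi> q (i - cm_dim M)) (U \<times> V)"
  proof (rule inj_onI, clarify)
    fix p q p' q'
    assume pq: "p \<in> U" "q \<in> V" "p' \<in> U" "q' \<in> V"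
      and eq: "(\<lambda>i. if i < cm_dim M then \<phi> p i else \<psi> q (i - cm_dim M)) =
               (\<lambda>i. if i < cm_dim M then \<phi> p' i else \<psi> q' (i - cm_dim M))"
    \<comment> \<open>The product chart discards \<open>\<phi> p i\<close> for \<open>i\<close> from
      \<open>cm_dim M\<close> on; these entries are zero.\<close>
    have "\<phi> p i = \<phi> p' i" for i
    proof (cases "i < cm_dim M")
      case True
      then show ?thesis using fun_cong[OF eq, of i] by simp
    next
      case False
      then show ?thesis using affine_space_image_zero[OF ch(3)] pq by simp
    qed
    then have "\<phi> p = \<phi> p'" by (rule ext)
    then have "p = p'" using inj_onD[OF ch(2)] pq by blast
    moreover have "\<psi> q i = \<psi> q' i" for i
      using fun_cong[OF eq, of "i + cm_dim M"] by simp
    then have "\<psi> q = \<psi> q'" by (rule ext)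
    then have "q = q'" using inj_onD[OF ch(5)] pq by blast
    ultimately show "p = p' \<and> q = q'" by simp
  qed
  moreover have "\<psi> q (i - cm_dim M) = 0" if "q \<in> V" "cm_dim M + cm_dim N \<le> i" for q i
    using affine_space_image_zero[OF ch(6)] that by simp
  ultimately show "case C of (U, \<phi>) \<Rightarrow> openin (cm_top (product_manifold M N)) U \<and> inj_on \<phi> U \<and>
      \<phi> ` U \<subseteq> affine_space (cm_dim (product_manifold M N))"
    using ch(1,4) C by (auto simp: product_manifold_def openin_prod_Times_iff affine_space_def)
qed

lemma continuous_map_open_iff:
  assumes "open A"
  shows "continuous_map (top_of_set A) T c \<longleftrightarrow>
    (\<forall>z\<in>A. c z \<in> topspace T) \<and> (\<forall>U. openin T U \<longrightarrow> open (A \<inter> c -` U))"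
proof -
  have "{x \<in> A. c x \<in> U} = A \<inter> c -` U" for U by auto
  then show ?thesis
    using assms by (auto simp: continuous_map_def openin_open_eq)
qed

lemma hcurve_open: "hcurve A M c \<Longrightarrow> open A"
  by (simp add: hcurve_def)

lemma hcurve_in_topspace: "hcurve A M c \<Longrightarrow> z \<in> A \<Longrightarrow> c z \<in> topspace (cm_top M)"
  by (auto simp: hcurve_def continuous_map_open_iff)

lemma hcurve_open_preimage: "hcurve A M c \<Longrightarrow> openin (cm_top M) U \<Longrightarrow> open (A \<inter> c -` U)"
  by (auto simp: hcurve_def continuous_map_open_iff)

lemma hcurve_chart_holomorphic:
  "hcurve A M c \<Longrightarrow> (U, \<phi>) \<in> cm_charts M \<Longrightarrow> j < cm_dim M \<Longrightarrow>
    (\<lambda>z. \<phi> (c z) j) holomorphic_on (A \<inter> c -` U)"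
  by (auto simp: hcurve_def)

lemma hcurve_has_field_derivative:
  assumes "hcurve A M c" "(U, \<phi>) \<in> cm_charts M" "openin (cm_top M) U" "j < cm_dim M" "u0 \<in> A" "c u0 \<in> U"
  shows "((\<lambda>u. \<phi> (c u) j) has_field_derivative deriv (\<lambda>u. \<phi> (c u) j) u0) (at u0)"
  using assms by (intro holomorphic_derivI[OF hcurve_chart_holomorphic[OF assms(1,2,4)]]
     hcurve_open_preimage[OF assms(1)]) auto

text \<open>Being a holomorphic curve is a local property. This is needed for curves that are only
  described near each parameter, such as the fibre coordinate of a curve in a frame.\<close>

lemma hcurveI_local:
  assumes "\<And>z. z \<in> A \<Longrightarrow> \<exists>B. z \<in> B \<and> B \<subseteq> A \<and> hcurve B M c"
  shows "hcurve A M c"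
proof -
  obtain B where B: "\<And>z. z \<in> A \<Longrightarrow> z \<in> B z" "\<And>z. z \<in> A \<Longrightarrow> B z \<subseteq> A"
    "\<And>z. z \<in> A \<Longrightarrow> hcurve (B z) M c"
    using assms by metis
  have eq: "A = (\<Union>z\<in>A. B z)" using B by blast
  have "open A"
    by (subst eq) (auto intro: hcurve_open B)
  moreover have "open (A \<inter> c -` U)" if "openin (cm_top M) U" for U
  proof -
    have "A \<inter> c -` U = (\<Union>z\<in>A. B z \<inter> c -` U)" using B by blast
    moreover have "open (\<Union>z\<in>A. B z \<inter> c -` U)"
      using hcurve_open_preimage[OF B(3) that] by blast
    ultimately show ?thesis by metis
  qed
  moreover have "(\<lambda>z. \<phi> (c z) j) holomorphic_on (A \<inter> c -` U)"
    if "(U, \<phi>) \<in> cm_charts M" "j < cm_dim M" for U \<phi> j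
  proof (clarsimp simp: holomorphic_on_def)
    fix z assume z: "z \<in> A" "c z \<in> U"
    have "(\<lambda>z. \<phi> (c z) j) field_differentiable at z within (B z \<inter> c -` U)"
      using hcurve_chart_holomorphic[OF B(3)[OF z(1)] that] B(1) z by (auto simp: holomorphic_on_def)
    moreover have "at z within (A \<inter> c -` U) = at z within (B z \<inter> c -` U)"
      using B z hcurve_open[OF B(3)[OF z(1)]]
      by (intro at_within_nhd[of z "B z"]) auto
    ultimately show "(\<lambda>z. \<phi> (c z) j) field_differentiable at z within (A \<inter> c -` U)"
      by simp
  qed
  moreover have "c z \<in> topspace (cm_top M)" if "z \<in> A" for z
    using hcurve_in_topspace[OF B(3)[OF that] B(1)[OF that]] .
  ultimately show ?thesis by (auto simp: hcurve_def continuous_map_open_iff)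
qed

lemma hcurve_subset:
  assumes "hcurve A M c" "B \<subseteq> A" "open B"
  shows "hcurve B M c"
proof -
  have "continuous_map (top_of_set B) (cm_top M) c"
    using assms continuous_map_from_subtopology_mono[of euclidean A] by (auto simp: hcurve_def)
  moreover have "(\<lambda>z. \<phi> (c z) j) holomorphic_on (B \<inter> c -` U)"
    if "(U, \<phi>) \<in> cm_charts M" "j < cm_dim M" for U \<phi> j
    using holomorphic_on_subset[OF hcurve_chart_holomorphic[OF assms(1) that]] assms(2) by blast
  ultimately show ?thesis using assms by (auto simp: hcurve_def)
qed

lemma hcurve_cong:
  assumes "hcurve A M c" "\<And>z. z \<in> A \<Longrightarrow> c z = c' z"
  shows "hcurve A M c'"
proof -
  have eq: "A \<inter> c' -` U = A \<inter> c -` U" for U using assms(2) by auto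
  have "(\<lambda>z. \<phi> (c' z) j) holomorphic_on (A \<inter> c' -` U)"
    if "(U, \<phi>) \<in> cm_charts M" "j < cm_dim M" for U \<phi> j
    unfolding eq using hcurve_chart_holomorphic[OF assms(1) that]
    by (rule holomorphic_transform) (use assms(2) in auto)
  then show ?thesis using assms by (auto simp: hcurve_def continuous_map_open_iff eq)
qed

lemma hcurve_reparam:
  assumes c: "hcurve B M c" and f: "f holomorphic_on A" "open A" "f ` A \<subseteq> B"
  shows "hcurve A M (\<lambda>z. c (f z))"
proof -
  have "continuous_on A f" using f(1) by (rule holomorphic_on_imp_continuous_on)
  then have "continuous_map (top_of_set A) (top_of_set B) f" using f(3) by (simp add: image_subset_iff_funcset)
  then have "continuous_map (top_of_set A) (cm_top M) (c \<circ> f)"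
    by (rule continuous_map_compose) (use c in \<open>simp add: hcurve_def\<close>)
  moreover have "(\<lambda>z. \<phi> (c (f z)) j) holomorphic_on (A \<inter> (\<lambda>z. c (f z)) -` U)"
    if "(U, \<phi>) \<in> cm_charts M" "j < cm_dim M" for U \<phi> j
  proof -
    have "((\<lambda>z. \<phi> (c z) j) \<circ> f) holomorphic_on (A \<inter> (\<lambda>z. c (f z)) -` U)"
      by (rule holomorphic_on_compose_gen[OF holomorphic_on_subset[OF f(1)]
            hcurve_chart_holomorphic[OF c that]]) (use f(3) in auto)
    then show ?thesis by (simp add: o_def)
  qed
  ultimately show ?thesis using f by (auto simp: hcurve_def o_def)
qed

lemma hcurve_const:
  assumes "p \<in> topspace (cm_top M)" "open A"
  shows "hcurve A M (\<lambda>_. p)"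
  using assms by (auto simp: hcurve_def)

lemma holomorphic_map_in_topspace:
  "holomorphic_map M N F \<Longrightarrow> p \<in> topspace (cm_top M) \<Longrightarrow> F p \<in> topspace (cm_top N)"
  by (auto simp: holomorphic_map_def continuous_map_def)

text \<open>In charts, \<open>a\<close> is the \<open>j\<close>-th row of the differential of
  \<open>F\<close> at \<open>p\<close>. It is fixed before the curve, so one choice serves all
  curves through \<open>p\<close>.\<close>

lemma holomorphic_map_curve_derivative:
  assumes M: "charted M" and F: "holomorphic_map M N F"
    and U: "(U, \<phi>) \<in> cm_charts M" "p \<in> U"
    and V: "(V, \<psi>) \<in> cm_charts N" "F p \<in> V" "openin (cm_top N) V" and j: "j < cm_dim N"
  obtains a where "\<And>A c u0. hcurve A M c \<Longrightarrow> u0 \<in> A \<Longrightarrow> c u0 = p \<Longrightarrow>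
    ((\<lambda>u. \<psi> (F (c u)) j) has_field_derivative
       (\<Sum>i<cm_dim M. a i * deriv (\<lambda>u. \<phi> (c u) i) u0)) (at u0)"
proof -
  note ch = charted_chart[OF M U(1)]
  have hol: "holomorphic_in (cm_dim M) (\<phi> ` (U \<inter> F -` V)) (\<lambda>z. \<psi> (F (inv_into U \<phi> z)) j)"
    using F U V j unfolding holomorphic_map_def by blast
  have sub: "\<phi> ` (U \<inter> F -` V) \<subseteq> affine_space (cm_dim M)" using ch by blast
  have "\<phi> p \<in> \<phi> ` (U \<inter> F -` V)" using U V by auto
  from holomorphic_in_chain[OF hol this sub]
  obtain a where a: "\<And>c c' u0. c u0 = \<phi> p \<Longrightarrow>
      (\<And>i. i < cm_dim M \<Longrightarrow> ((\<lambda>u. c u i) has_field_derivative c' i) (at u0)) \<Longrightarrow>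
      eventually (\<lambda>u. c u \<in> \<phi> ` (U \<inter> F -` V)) (nhds u0) \<Longrightarrow>
      ((\<lambda>u. \<psi> (F (inv_into U \<phi> (c u))) j) has_field_derivative (\<Sum>i<cm_dim M. a i * c' i)) (at u0)"
    by blast
  show thesis
  proof (rule that[of a])
    fix A c u0 assume c: "hcurve A M c" and u0: "u0 \<in> A" "c u0 = p"
    have "openin (cm_top M) {q \<in> topspace (cm_top M). F q \<in> V}"
      using F V(3) unfolding holomorphic_map_def by (auto intro: openin_continuous_map_preimage)
    then have "open (A \<inter> c -` (U \<inter> {q \<in> topspace (cm_top M). F q \<in> V}))"
      by (intro hcurve_open_preimage[OF c] openin_Int ch(1))
    moreover have "u0 \<in> A \<inter> c -` (U \<inter> {q \<in> topspace (cm_top M). F q \<in> V})"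
      using u0 U V openin_subset[OF ch(1)] by auto
    ultimately have ev: "eventually (\<lambda>u. c u \<in> U \<and> F (c u) \<in> V) (nhds u0)"
      unfolding eventually_nhds by blast
    then have "eventually (\<lambda>u. \<phi> (c u) \<in> \<phi> ` (U \<inter> F -` V)) (nhds u0)"
      by eventually_elim auto
    then have "((\<lambda>u. \<psi> (F (inv_into U \<phi> (\<phi> (c u)))) j) has_field_derivative
        (\<Sum>i<cm_dim M. a i * deriv (\<lambda>u. \<phi> (c u) i) u0)) (at u0)"
      by (intro a[where c = "\<lambda>u. \<phi> (c u)"])
         (use u0 U in \<open>auto intro: hcurve_has_field_derivative[OF c U(1) ch(1)]\<close>)
    moreover have "eventually (\<lambda>u. \<psi> (F (inv_into U \<phi> (\<phi> (c u)))) j = \<psi> (F (c u)) j) (nhds u0)"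
      using ev by eventually_elim (simp add: inv_into_f_f ch(2))
    ultimately show "((\<lambda>u. \<psi> (F (c u)) j) has_field_derivative
       (\<Sum>i<cm_dim M. a i * deriv (\<lambda>u. \<phi> (c u) i) u0)) (at u0)"
      by (simp cong: DERIV_cong_ev)
  qed
qed

lemma hcurve_compose:
  assumes M: "charted M" and N: "charted N" and F: "holomorphic_map M N F" and c: "hcurve A M c"
  shows "hcurve A N (\<lambda>u. F (c u))"
proof -
  have "continuous_map (top_of_set A) (cm_top N) (F \<circ> c)"
    by (rule continuous_map_compose) (use F c in \<open>auto simp: hcurve_def holomorphic_map_def\<close>)
  moreover have "(\<lambda>z. \<psi> (F (c z)) j) holomorphic_on (A \<inter> (\<lambda>u. F (c u)) -` V)"
    if V: "(V, \<psi>) \<in> cm_charts N" and j: "j < cm_dim N" for V \<psi> j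
  proof (clarsimp simp: holomorphic_on_def)
    fix z assume z: "z \<in> A" "F (c z) \<in> V"
    obtain U \<phi> where U: "(U, \<phi>) \<in> cm_charts M" "c z \<in> U"
      using charted_cover[OF M] hcurve_in_topspace[OF c z(1)] by metis
    obtain a where "\<And>A d u0. hcurve A M d \<Longrightarrow> u0 \<in> A \<Longrightarrow> d u0 = c z \<Longrightarrow>
      ((\<lambda>u. \<psi> (F (d u)) j) has_field_derivative
        (\<Sum>i<cm_dim M. a i * deriv (\<lambda>u. \<phi> (d u) i) u0)) (at u0)"
      by (rule holomorphic_map_curve_derivative[OF M F U V z(2) charted_chart(1)[OF N V] j]) blast
    from this[OF c z(1) HOL.refl] show "(\<lambda>u. \<psi> (F (c u)) j) field_differentiable at z within A \<inter> (\<lambda>u. F (c u)) -` V"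
      unfolding field_differentiable_def by (meson has_field_derivative_at_within)
  qed
  ultimately show ?thesis using c by (auto simp: hcurve_def o_def)
qed

lemma hcurve_Pair:
  assumes "hcurve A M c" "hcurve A N d"
  shows "hcurve A (product_manifold M N) (\<lambda>u. (c u, d u))"
proof -
  have "(\<lambda>z. (if i < cm_dim M then \<phi> (c z) i else \<psi> (d z) (i - cm_dim M)))
      holomorphic_on (A \<inter> (\<lambda>u. (c u, d u)) -` (U \<times> V))"
    if "(U, \<phi>) \<in> cm_charts M" "(V, \<psi>) \<in> cm_charts N" "i < cm_dim M + cm_dim N" for U \<phi> V \<psi> i
  proof (cases "i < cm_dim M")
    case True
    from hcurve_chart_holomorphic[OF assms(1) that(1) this] show ?thesis
      using True by (auto elim: holomorphic_on_subset)
  next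
    case False
    then have "i - cm_dim M < cm_dim N" using that by auto
    from hcurve_chart_holomorphic[OF assms(2) that(2) this] show ?thesis
      using False by (auto elim: holomorphic_on_subset)
  qed
  moreover have "continuous_map (top_of_set A) (prod_topology (cm_top M) (cm_top N)) (\<lambda>u. (c u, d u))"
    using assms by (intro continuous_map_pairedI) (auto simp: hcurve_def)
  ultimately show ?thesis
    using assms(1) by (auto simp: hcurve_def product_manifold_def)
qed

text \<open>The coordinates of the second factor appear in a product chart shifted by
  \<open>cm_dim M\<close>. A chart of the first factor around \<open>fst (c z)\<close> is chosen in
  order to form such a product chart.\<close>

lemma hcurve_snd:
  assumes M: "charted M" and c: "hcurve A (product_manifold M N) c"
  shows "hcurve A N (\<lambda>u. snd (c u))"
proof -
  have cont: "continuous_map (top_of_set A) (prod_topology (cm_top M) (cm_top N)) c"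
    using c by (simp add: hcurve_def product_manifold_def)
  then have "continuous_map (top_of_set A) (cm_top N) (snd \<circ> c)"
    by (rule continuous_map_compose) (rule continuous_map_snd)
  moreover have "(\<lambda>z. \<psi> (snd (c z)) j) holomorphic_on (A \<inter> (\<lambda>u. snd (c u)) -` V)"
    if V: "(V, \<psi>) \<in> cm_charts N" and j: "j < cm_dim N" for V \<psi> j
  proof (clarsimp simp: holomorphic_on_def)
    fix z assume z: "z \<in> A" "snd (c z) \<in> V"
    have "fst (c z) \<in> topspace (cm_top M)"
      using hcurve_in_topspace[OF c z(1)] by (auto simp: product_manifold_def)
    then obtain U \<phi> where U: "(U, \<phi>) \<in> cm_charts M" "fst (c z) \<in> U"
      using charted_cover[OF M] by metis
    have "openin (cm_top M) U" using charted_chart[OF M U(1)] by simp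
    then have "openin (prod_topology (cm_top M) (cm_top N)) (U \<times> topspace (cm_top N))"
      by (simp add: openin_prod_Times_iff)
    then have op: "open (A \<inter> c -` (U \<times> topspace (cm_top N)))"
      using hcurve_open_preimage[OF c] by (simp add: product_manifold_def)
    let ?\<xi> = "\<lambda>(p, q) i. if i < cm_dim M then \<phi> p i else \<psi> q (i - cm_dim M)"
    have "(U \<times> V, ?\<xi>) \<in> cm_charts (product_manifold M N)"
      by (rule product_chart[OF U(1) V])
    from hcurve_chart_holomorphic[OF c this, of "cm_dim M + j"] j
    have "(\<lambda>z. ?\<xi> (c z) (cm_dim M + j)) holomorphic_on (A \<inter> c -` (U \<times> V))"
      by (simp add: product_manifold_def)
    moreover have "?\<xi> (c z) (cm_dim M + j) = \<psi> (snd (c z)) j" for z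
      by (cases "c z") simp
    ultimately have "(\<lambda>z. \<psi> (snd (c z)) j) holomorphic_on (A \<inter> c -` (U \<times> V))" by simp
    then have "(\<lambda>z. \<psi> (snd (c z)) j) field_differentiable at z within (A \<inter> c -` (U \<times> V))"
      using z U by (auto simp: holomorphic_on_def mem_Times_iff)
    moreover have "at z within (A \<inter> (\<lambda>u. snd (c u)) -` V) = at z within (A \<inter> c -` (U \<times> V))"
      using op z U hcurve_in_topspace[OF c]
      by (intro at_within_nhd[of z "A \<inter> c -` (U \<times> topspace (cm_top N))"])
         (auto simp: product_manifold_def mem_Times_iff)
    ultimately show "(\<lambda>u. \<psi> (snd (c u)) j) field_differentiable at z within A \<inter> (\<lambda>u. snd (c u)) -` V"
      by simp
  qed
  ultimately show ?thesis using c by (auto simp: hcurve_def o_def)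
qed

lemma hcurve_open_submanifold_iff:
  "hcurve A (open_submanifold M W) c \<longleftrightarrow> hcurve A M c \<and> c ` A \<subseteq> W"
proof -
  have eq: "A \<inter> c -` (U \<inter> W) = A \<inter> c -` U" if "c ` A \<subseteq> W" for U using that by auto
  have "continuous_map (top_of_set A) (subtopology (cm_top M) W) c \<longleftrightarrow>
     continuous_map (top_of_set A) (cm_top M) c \<and> c ` A \<subseteq> W"
    by (auto simp: continuous_map_in_subtopology)
  then show ?thesis
    using eq by (auto simp: hcurve_def open_submanifold_def split: prod.splits)
qed

definition line_embed :: "complex \<Rightarrow> nat \<Rightarrow> complex" where
  "line_embed z = (\<lambda>i. if i = 0 then z else 0)"

lemma line_embed_0 [simp]: "line_embed z 0 = z"
  by (simp add: line_embed_def)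

lemma line_embed_in_affine [simp]: "line_embed z \<in> affine_space (Suc 0)"
  by (auto simp: line_embed_def affine_space_def)

lemma line_embed_of_affine [simp]: "w \<in> affine_space (Suc 0) \<Longrightarrow> line_embed (w 0) = w"
  by (fastforce simp: line_embed_def affine_space_def)

text \<open>The way back from one-variable holomorphy to \<open>holomorphic_in\<close>: it connects
  curves with maps on \<open>unit_disc\<close> and on the line as a Stein manifold, which are stated
  through \<open>holomorphic_map\<close>.\<close>

lemma holomorphic_in_line:
  assumes g: "g holomorphic_on B" "open B" and f: "\<And>z. z \<in> B \<Longrightarrow> f (line_embed z) = g z"
  shows "holomorphic_in 1 (line_embed ` B) f"
  unfolding holomorphic_in_def
proof
  fix z assume "z \<in> line_embed ` B"
  then obtain t where t: "t \<in> B" "z = line_embed t" by auto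
  have "(g has_field_derivative deriv g t) (at t)"
    using holomorphic_derivI[OF g t(1)] .
  then have "((\<lambda>s. (g s - g t - deriv g t * (s - t)) / (s - t)) \<longlongrightarrow> 0) (at t)"
    unfolding has_field_derivative_iff LIM_zero_iff[of _ "deriv g t", symmetric]
    by (rule Lim_transform_eventually) (auto simp: eventually_at_filter diff_divide_distrib)
  then have lim: "((\<lambda>s. cmod (g s - g t - deriv g t * (s - t)) / cmod (s - t)) \<longlongrightarrow> 0) (at t)"
    by (simp add: tendsto_norm_zero_iff norm_divide[symmetric])
  have "((\<lambda>w. w 0) \<longlongrightarrow> z 0) (at z within line_embed ` B)"
    using continuous_coordinate[of "line_embed ` B" 0] \<open>z \<in> line_embed ` B\<close>
    unfolding continuous_on_def by blast
  moreover have "eventually (\<lambda>w. w 0 \<noteq> t) (at z within line_embed ` B)"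
    unfolding eventually_at_filter by (rule always_eventually) (use t in auto)
  ultimately have "filterlim (\<lambda>w. w 0) (at t) (at z within line_embed ` B)"
    using t by (simp add: filterlim_at)
  from filterlim_compose[OF lim this]
  have "((\<lambda>w. cmod (g (w 0) - g t - deriv g t * (w 0 - t)) / cmod (w 0 - t)) \<longlongrightarrow> 0)
     (at z within line_embed ` B)" .
  moreover have "eventually (\<lambda>w. cmod (g (w 0) - g t - deriv g t * (w 0 - t)) / cmod (w 0 - t)
     = cmod (f w - f z - (\<Sum>i<1. deriv g t * (w i - z i))) / (\<Sum>i<1. cmod (w i - z i)))
     (at z within line_embed ` B)"
    unfolding eventually_at_filter by (rule always_eventually) (use t f in auto)
  ultimately show "\<exists>a. ((\<lambda>w. cmod (f w - f z - (\<Sum>i<1. a i * (w i - z i))) / (\<Sum>i<1. cmod (w i - z i)))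
       \<longlongrightarrow> 0) (at z within line_embed ` B)"
    by (intro exI[of _ "\<lambda>_. deriv g t"]) (rule Lim_transform_eventually)
qed

section \<open>Charts as homeomorphisms onto open subsets of affine space\<close>

lemma chart_homeomorphic:
  assumes "complex_manifold M" "(V, \<psi>) \<in> cm_charts M"
  shows "openin (top_of_set (affine_space (cm_dim M))) (\<psi> ` V)"
    "homeomorphic_map (subtopology (cm_top M) V) (top_of_set (\<psi> ` V)) \<psi>"
  using assms unfolding complex_manifold_def by auto

lemma chart_continuous:
  assumes "complex_manifold M" "(V, \<psi>) \<in> cm_charts M"
  shows "continuous_map (subtopology (cm_top M) V) euclidean \<psi>"
  using homeomorphic_imp_continuous_map[OF chart_homeomorphic(2)[OF assms]]
  by (simp add: continuous_map_in_subtopology)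

lemma chart_inverse_continuous:
  assumes M: "complex_manifold M" and V: "(V, \<psi>) \<in> cm_charts M"
  shows "continuous_map (top_of_set (\<psi> ` V)) (cm_top M) (inv_into V \<psi>)"
proof -
  note ch = charted_chart[OF complex_manifold_charted[OF M] V]
  obtain g where g: "homeomorphic_maps (subtopology (cm_top M) V) (top_of_set (\<psi> ` V)) \<psi> g"
    using chart_homeomorphic(2)[OF M V] homeomorphic_map_maps by blast
  have "continuous_map (top_of_set (\<psi> ` V)) (cm_top M) g"
    using g by (auto simp: homeomorphic_maps_def continuous_map_in_subtopology)
  moreover have "g w = inv_into V \<psi> w" if "w \<in> \<psi> ` V" for w
    using that g ch(2) openin_subset[OF ch(1)] by (auto simp: homeomorphic_maps_def inv_into_f_f)
  ultimately show ?thesis by (auto intro: continuous_map_eq)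
qed

lemma chart_inverse_compactin:
  assumes M: "complex_manifold M" and V: "(V, \<psi>) \<in> cm_charts M" and K: "compact K" "K \<subseteq> \<psi> ` V"
  shows "compactin (cm_top M) (inv_into V \<psi> ` K)"
proof -
  have "compactin (top_of_set (\<psi> ` V)) K" using K by (simp add: compactin_subtopology)
  then show ?thesis using image_compactin chart_inverse_continuous[OF M V] by blast
qed

lemma openin_chart_ball:
  assumes M: "complex_manifold M" and V: "(V, \<psi>) \<in> cm_charts M"
  shows "openin (cm_top M) {p \<in> V. adist n (\<psi> p) w < \<rho>}"
proof -
  have Vop: "openin (cm_top M) V" using charted_chart(1)[OF complex_manifold_charted[OF M] V] .
  have "continuous_map euclidean euclidean (\<lambda>v. adist n v w)"
    using continuous_on_adist[of UNIV] by simp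
  from continuous_map_compose[OF chart_continuous[OF M V] this]
  have "continuous_map (subtopology (cm_top M) V) euclidean (\<lambda>p. adist n (\<psi> p) w)" by (simp add: o_def)
  then have "openin (subtopology (cm_top M) V)
      {p \<in> topspace (subtopology (cm_top M) V). adist n (\<psi> p) w \<in> {..<\<rho>}}"
    by (rule openin_continuous_map_preimage) simp
  then show ?thesis using openin_subset[OF Vop] Vop openin_trans_full by (auto simp: Int_absorb1)
qed

lemma chart_transition_holomorphic:
  assumes "complex_manifold M" "(U, \<phi>) \<in> cm_charts M" "(V, \<psi>) \<in> cm_charts M" "j < cm_dim M"
  shows "holomorphic_in (cm_dim M) (\<phi> ` (U \<inter> V)) (\<lambda>z. \<psi> (inv_into U \<phi> z) j)"
proof -
  have "\<forall>(U, \<phi>)\<in>cm_charts M. \<forall>(V, \<psi>)\<in>cm_charts M. \<forall>j<cm_dim M.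
        holomorphic_in (cm_dim M) (\<phi> ` (U \<inter> V)) (\<lambda>z. \<psi> (inv_into U \<phi> z) j)"
    using assms(1) unfolding complex_manifold_def by blast
  from bspec[OF this assms(2)] have "\<forall>(V, \<psi>)\<in>cm_charts M. \<forall>j<cm_dim M.
        holomorphic_in (cm_dim M) (\<phi> ` (U \<inter> V)) (\<lambda>z. \<psi> (inv_into U \<phi> z) j)" by simp
  from bspec[OF this assms(3)] assms(4) show ?thesis by simp
qed

text \<open>A curve written down in one chart has to be holomorphic in all others; this is where the
  holomorphy of the coordinate changes enters.\<close>

lemma hcurve_chart_inverse:
  assumes M: "complex_manifold M" and V: "(V, \<psi>) \<in> cm_charts M" and A: "open A"
    and g: "\<And>i. i < cm_dim M \<Longrightarrow> (\<lambda>z. g z i) holomorphic_on A" "g ` A \<subseteq> \<psi> ` V"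
  shows "hcurve A M (\<lambda>z. inv_into V \<psi> (g z))"
proof -
  note ch = charted_chart[OF complex_manifold_charted[OF M] V]
  have "continuous_on A (\<lambda>z. g z i)" for i
  proof (cases "i < cm_dim M")
    case True
    then show ?thesis using g(1) holomorphic_on_imp_continuous_on by blast
  next
    case False
    then have "g z i = 0" if "z \<in> A" for z
      using g(2) ch(3) that by (force simp: affine_space_def)
    then show ?thesis by (simp cong: continuous_on_cong)
  qed
  then have cg: "continuous_on A g" by (rule continuous_on_coordinatewise_then_product)
  then have "continuous_map (top_of_set A) (top_of_set (\<psi> ` V)) g"
    using g(2) by (simp add: image_subset_iff_funcset)
  from continuous_map_compose[OF this chart_inverse_continuous[OF M V]]
  have cont: "continuous_map (top_of_set A) (cm_top M) (\<lambda>z. inv_into V \<psi> (g z))"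
    by (simp add: o_def)
  have inV: "inv_into V \<psi> (g z) \<in> V" "\<psi> (inv_into V \<psi> (g z)) = g z" if "z \<in> A" for z
    using g(2) that by (auto intro!: inv_into_into f_inv_into_f)
  have "(\<lambda>z. \<phi> (inv_into V \<psi> (g z)) j) holomorphic_on (A \<inter> (\<lambda>z. inv_into V \<psi> (g z)) -` U)"
    if U: "(U, \<phi>) \<in> cm_charts M" and j: "j < cm_dim M" for U \<phi> j
  proof (clarsimp simp: holomorphic_on_def)
    fix z assume z: "z \<in> A" "inv_into V \<psi> (g z) \<in> U"
    have "openin (cm_top M) U" using charted_chart[OF complex_manifold_charted[OF M] U] by simp
    then have "open (A \<inter> (\<lambda>z. inv_into V \<psi> (g z)) -` U)"
      using cont continuous_map_open_iff[OF A] by blast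
    then have "eventually (\<lambda>u. u \<in> A \<inter> (\<lambda>z. inv_into V \<psi> (g z)) -` U) (nhds z)"
      using z by (intro eventually_nhds_in_open) auto
    then have ev: "eventually (\<lambda>u. g u \<in> \<psi> ` (V \<inter> U)) (nhds z)"
    proof eventually_elim
      case (elim u)
      then show ?case using inV[of u] by (metis IntD1 IntD2 IntI imageI vimageD)
    qed
    then have gz: "g z \<in> \<psi> ` (V \<inter> U)" by (rule eventually_nhds_x_imp_x)
    have sub: "\<psi> ` (V \<inter> U) \<subseteq> affine_space (cm_dim M)" using ch by blast
    obtain a where a: "\<And>c c' u0. c u0 = g z \<Longrightarrow>
      (\<And>i. i < cm_dim M \<Longrightarrow> ((\<lambda>u. c u i) has_field_derivative c' i) (at u0)) \<Longrightarrow>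
      eventually (\<lambda>u. c u \<in> \<psi> ` (V \<inter> U)) (nhds u0) \<Longrightarrow>
      ((\<lambda>u. \<phi> (inv_into V \<psi> (c u)) j) has_field_derivative (\<Sum>i<cm_dim M. a i * c' i)) (at u0)"
      by (rule holomorphic_in_chain[OF chart_transition_holomorphic[OF M V U j] gz sub]) blast
    have "((\<lambda>u. \<phi> (inv_into V \<psi> (g u)) j) has_field_derivative
        (\<Sum>i<cm_dim M. a i * deriv (\<lambda>u. g u i) z)) (at z)"
      by (rule a[OF HOL.refl _ ev]) (rule holomorphic_derivI[OF g(1) A z(1)])
    then show "(\<lambda>z. \<phi> (inv_into V \<psi> (g z)) j) field_differentiable at z within
         A \<inter> (\<lambda>z. inv_into V \<psi> (g z)) -` U"
      unfolding field_differentiable_def by (meson has_field_derivative_at_within)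
  qed
  then show ?thesis using cont A by (auto simp: hcurve_def)
qed

section \<open>Discs, chains of discs and the Kobayashi distance\<close>

lemma hcurve_imp_holomorphic_map_unit_disc:
  assumes c: "hcurve (ball 0 1) M c"  and M: "charted M"
  shows "holomorphic_map unit_disc M c"
proof -
  have *: "holomorphic_in 1 (line_embed ` (ball 0 1 \<inter> c -` V))
       (\<lambda>z. \<psi> (c (inv_into (ball 0 1) line_embed z)) j)"
    if "(V, \<psi>) \<in> cm_charts M" "j < cm_dim M" for V \<psi> j
  proof (rule holomorphic_in_line[OF hcurve_chart_holomorphic[OF c that]])
    show "open (ball 0 1 \<inter> c -` V)"
      using charted_chart[OF M that(1)] hcurve_open_preimage[OF c] by blast
    have "inj_on line_embed (ball 0 1)" by (rule inj_onI) (metis line_embed_0)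
    then show "\<psi> (c (inv_into (ball 0 1) line_embed (line_embed z))) j = \<psi> (c z) j"
      if "z \<in> ball 0 1 \<inter> c -` V" for z
      using that by (simp add: inv_into_f_f)
  qed
  show ?thesis
    using c * unfolding holomorphic_map_def unit_disc_def open_submanifold_def complex_line_def
    by (auto simp: hcurve_def line_embed_def[abs_def])
qed

text \<open>The affine map of the unit disc onto \<open>ball u0 R\<close> turns the curve into an
  admissible disc. For fixed \<open>a\<close> and \<open>b\<close> the added length tends to 0 as
  \<open>R\<close> grows.\<close>

lemma disc_chain_hcurve:
  assumes M: "charted M" and c: "hcurve (ball u0 R) M c" and R: "R > 0"
    and ab: "a \<in> ball u0 R" "b \<in> ball u0 R" and ch: "disc_chain M p (c a) s"
  shows "disc_chain M p (c b) (s + poincare_dist ((a - u0) / R) ((b - u0) / R))"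
proof -
  define f where "f w = c (u0 + of_real R * w)" for w
  have "(\<lambda>w. u0 + of_real R * w) ` ball 0 1 \<subseteq> ball u0 R"
    using R by (auto simp: dist_norm norm_mult)
  then have "hcurve (ball 0 1) M f"
    unfolding f_def by (intro hcurve_reparam[OF c]) (auto intro!: holomorphic_intros)
  then have "holomorphic_map unit_disc M f" by (rule hcurve_imp_holomorphic_map_unit_disc[OF _ M])
  moreover have "f ((a - u0) / R) = c a" "f ((b - u0) / R) = c b"
    using R by (auto simp: f_def)
  moreover have "(a - u0) / R \<in> ball 0 1" "(b - u0) / R \<in> ball 0 1"
    using R ab by (auto simp: norm_divide dist_norm norm_minus_commute)
  ultimately show ?thesis using disc_chain.step[of M p f "(a - u0) / R" s "(b - u0) / R"] ch by simp
qed

lemma artanh_real_mono: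
  assumes "0 \<le> x" "x \<le> y" "y < (1::real)"
  shows "artanh x \<le> artanh y"
  using assms by (auto simp: artanh_def intro!: frac_le divide_right_mono)

lemma artanh_real_small:
  assumes "\<epsilon> > (0::real)"
  obtains \<delta> where "0 < \<delta>" "\<delta> < 1" "\<And>x. 0 \<le> x \<Longrightarrow> x \<le> \<delta> \<Longrightarrow> artanh x < \<epsilon>"
\<comment> \<open>\<open>artanh\<close> inverts \<open>tanh\<close>; half of
  \<open>\<epsilon>\<close> makes the inequality strict.\<close>
proof (rule that[of "tanh (\<epsilon> / 2)"])
  show "0 < tanh (\<epsilon> / 2)" "tanh (\<epsilon> / 2) < 1" using assms by (auto simp: tanh_real_lt_1)
  then show "artanh x < \<epsilon>" if "0 \<le> x" "x \<le> tanh (\<epsilon> / 2)" for x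
    using artanh_real_mono[OF that] assms by (simp add: artanh_tanh_real)
qed

text \<open>Positive distance becomes a real lower bound for all chain lengths. If no chain exists,
  the distance is \<infinity> and any positive real serves.\<close>

lemma kobayashi_hyperbolic_chain:
  assumes "kobayashi_hyperbolic M" "p \<in> topspace (cm_top M)" "q \<in> topspace (cm_top M)" "p \<noteq> q"
  obtains \<epsilon> where "\<epsilon> > 0" "\<And>s. disc_chain M p q s \<Longrightarrow> \<epsilon> \<le> s"
proof -
  have "0 < kobayashi_pseudodist M p q" using assms unfolding kobayashi_hyperbolic_def by blast
  then obtain \<epsilon> where \<epsilon>: "0 < ereal \<epsilon>" "ereal \<epsilon> < kobayashi_pseudodist M p q"
    using ereal_dense2 by blast
  have "\<epsilon> \<le> s" if "disc_chain M p q s" for s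
  proof -
    have "kobayashi_pseudodist M p q \<le> ereal s"
      unfolding kobayashi_pseudodist_def using that by (auto intro: Inf_lower)
    then have "ereal \<epsilon> < ereal s" using \<epsilon>(2) by (rule less_le_trans[rotated])
    then show ?thesis by simp
  qed
  then show thesis using \<epsilon> that by simp
qed

text \<open>A quantitative Liouville theorem: in a disc of radius \<open>R\<close> the points 0 and
  1 are at Poincare distance artanh (1/R), which for large \<open>R\<close> is below the Kobayashi
  distance of \<open>p\<close> and \<open>q\<close>.\<close>

lemma hyperbolic_large_discs:
  assumes M: "charted M" "kobayashi_hyperbolic M"
    and pq: "p \<in> topspace (cm_top M)" "q \<in> topspace (cm_top M)" "p \<noteq> q"
  obtains R where "R > 1" "\<And>h. hcurve (ball 0 R) M h \<Longrightarrow> h 0 = p \<Longrightarrow> h 1 \<noteq> q"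
proof -
  obtain \<epsilon> where \<epsilon>: "\<epsilon> > 0" "\<And>s. disc_chain M p q s \<Longrightarrow> \<epsilon> \<le> s"
    using kobayashi_hyperbolic_chain[OF M(2) pq] by blast
  obtain \<delta> where \<delta>: "0 < \<delta>" "\<delta> < 1" "\<And>x. 0 \<le> x \<Longrightarrow> x \<le> \<delta> \<Longrightarrow> artanh x < \<epsilon>"
    using artanh_real_small[OF \<epsilon>(1)] by blast
  show thesis
  proof (rule that[of "1 / \<delta>"])
    show R: "1 / \<delta> > 1" using \<delta> by simp
    fix h assume h: "hcurve (ball 0 (1 / \<delta>)) M h" "h 0 = p"
    have "disc_chain M p (h 0) 0" using h pq by (simp add: disc_chain.refl)
    from disc_chain_hcurve[OF M(1) h(1) _ _ _ this, of 1] R \<delta>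
    have "disc_chain M p (h 1) (poincare_dist 0 \<delta>)" by simp
    then show "h 1 \<noteq> q" using \<epsilon>(2)[of "poincare_dist 0 \<delta>"] \<delta>(1,2) \<delta>(3)[of \<delta>]
      by (auto simp: poincare_dist_def)
  qed
qed

section \<open>Discs in hyperbolic manifolds\<close>

text \<open>Otherwise discs centred at \<open>y\<close> would meet a fixed coordinate sphere around \<open>y\<close> at parameters
  tending to the centre, and a limit point \<open>q\<close> of these meeting points would be joined to \<open>y\<close> by
  chains of two arbitrarily short discs, the second one linear in the chart.\<close>

lemma hyperbolic_equicontinuous:
  assumes M: "complex_manifold M" "kobayashi_hyperbolic M"
    and V: "(V, \<psi>) \<in> cm_charts M" "y \<in> V" and R: "R > 0"
  obtains r \<rho> where "0 < r" "r \<le> R"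
    "\<And>\<phi> u. hcurve (ball u0 R) M \<phi> \<Longrightarrow> \<phi> u0 = y \<Longrightarrow> u \<in> ball u0 r \<Longrightarrow>
       \<phi> u \<in> V \<and> adist (cm_dim M) (\<psi> (\<phi> u)) (\<psi> y) \<le> \<rho>"
proof -
  define n where "n = cm_dim M"
  define D where "D p = adist n (\<psi> p) (\<psi> y)" for p
  note Mc = complex_manifold_charted[OF M(1)]
  note ch = charted_chart[OF Mc V(1), folded n_def]
  have Vtop: "V \<subseteq> topspace (cm_top M)" using openin_subset[OF ch(1)] .
  obtain \<rho>0 where \<rho>0: "\<rho>0 > 0" "\<And>w. w \<in> affine_space n \<Longrightarrow> adist n w (\<psi> y) \<le> \<rho>0 \<Longrightarrow> w \<in> \<psi> ` V"
    using adist_cball_subset[OF chart_homeomorphic(1)[OF M(1) V(1), folded n_def], of "\<psi> y"] V by blast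
  \<comment> \<open>Half the radius leaves room in the chart for the linear disc \<open>g\<close>,
    which moves by at most \<open>\<rho>\<close> from a point of the sphere.\<close>
  define \<rho> where "\<rho> = \<rho>0 / 2"
  have \<rho>: "\<rho> > 0" "\<rho> < \<rho>0" using \<rho>0 by (auto simp: \<rho>_def)
  define inner where "inner = {p \<in> V. D p < \<rho>}"
  define outer where "outer = topspace (cm_top M) - {p \<in> V. D p \<le> \<rho>}"
  have inner: "openin (cm_top M) inner"
    unfolding inner_def D_def by (rule openin_chart_ball[OF M(1) V(1)])
  \<comment> \<open>Hausdorffness is used here: the closed coordinate ball is compact, hence closed
    in \<open>M\<close> and not merely in the chart.\<close>
  have outer: "openin (cm_top M) outer"
  proof -
    let ?B = "{w \<in> affine_space n. adist n w (\<psi> y) \<le> \<rho>}"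
    have "?B \<subseteq> \<psi> ` V" using \<rho>0 \<rho> by auto
    then have "compactin (cm_top M) (inv_into V \<psi> ` ?B)"
      by (rule chart_inverse_compactin[OF M(1) V(1) compact_adist_cball])
    moreover have "Hausdorff_space (cm_top M)" using M by (simp add: complex_manifold_def)
    ultimately have "closedin (cm_top M) (inv_into V \<psi> ` ?B)"
      by (rule compactin_imp_closedin[rotated])
    moreover have "inv_into V \<psi> ` ?B = {p \<in> V. D p \<le> \<rho>}"
    proof (intro equalityI subsetI)
      fix p assume "p \<in> inv_into V \<psi> ` ?B"
      then obtain w where w: "w \<in> ?B" "p = inv_into V \<psi> w" by blast
      then have "w \<in> \<psi> ` V" using \<open>?B \<subseteq> \<psi> ` V\<close> by blast
      then have "p \<in> V" "\<psi> p = w" using w by (auto intro: inv_into_into f_inv_into_f)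
      then show "p \<in> {p \<in> V. D p \<le> \<rho>}" using w by (auto simp: D_def)
    next
      fix p assume p: "p \<in> {p \<in> V. D p \<le> \<rho>}"
      then have "\<psi> p \<in> ?B" using ch(3) by (auto simp: D_def)
      moreover have "p = inv_into V \<psi> (\<psi> p)" using p ch(2) by (simp add: inv_into_f_f)
      ultimately show "p \<in> inv_into V \<psi> ` ?B" by blast
    qed
    ultimately show ?thesis by (auto simp: outer_def closedin_def)
  qed
  show thesis
  proof (rule ccontr)
    assume neg: "\<not> thesis"
    have far: "\<exists>\<phi> u. hcurve (ball u0 R) M \<phi> \<and> \<phi> u0 = y \<and> u \<in> ball u0 r \<and>
        \<not> (\<phi> u \<in> V \<and> adist (cm_dim M) (\<psi> (\<phi> u)) (\<psi> y) \<le> \<rho>)" if "0 < r" "r \<le> R" for r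
      using neg \<open>\<And>\<rho> r. \<lbrakk>0 < r; r \<le> R;
        \<And>\<phi> u. \<lbrakk>hcurve (ball u0 R) M \<phi>; \<phi> u0 = y; u \<in> ball u0 r\<rbrakk> \<Longrightarrow>
          \<phi> u \<in> V \<and> adist (cm_dim M) (\<psi> (\<phi> u)) (\<psi> y) \<le> \<rho>\<rbrakk> \<Longrightarrow> thesis\<close> that by blast
    have ex: "\<exists>p u \<phi>. hcurve (ball u0 R) M \<phi> \<and> \<phi> u0 = y \<and> u \<in> ball u0 r \<and> \<phi> u = p \<and> p \<in> V \<and> D p = \<rho>"
      if r: "0 < r" "r \<le> R" for r
    proof -
      obtain \<phi> u where \<phi>: "hcurve (ball u0 R) M \<phi>" "\<phi> u0 = y" "u \<in> ball u0 r"
        "\<not> (\<phi> u \<in> V \<and> adist (cm_dim M) (\<psi> (\<phi> u)) (\<psi> y) \<le> \<rho>)"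
        using far[OF r] by blast
      \<comment> \<open>The segment joins the centre, in \<open>inner\<close>, to a point of
        \<open>outer\<close>; being connected, it meets the sphere.\<close>
      define A where "A = closed_segment u0 u"
      have A: "A \<subseteq> ball u0 r" unfolding A_def using \<phi>(3) r
        by (intro closed_segment_subset) auto
      then have AR: "A \<subseteq> ball u0 R" using r by auto
      have "\<exists>v\<in>A. \<phi> v \<in> V \<and> D (\<phi> v) = \<rho>"
      proof (rule ccontr)
        assume no: "\<not> (\<exists>v\<in>A. \<phi> v \<in> V \<and> D (\<phi> v) = \<rho>)"
        have "connected A" by (simp add: A_def)
        moreover have "open (ball u0 R \<inter> \<phi> -` inner)" "open (ball u0 R \<inter> \<phi> -` outer)"
          using hcurve_open_preimage[OF \<phi>(1)] inner outer by auto
        moreover have "A \<subseteq> (ball u0 R \<inter> \<phi> -` inner) \<union> (ball u0 R \<inter> \<phi> -` outer)"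
        proof
          fix v assume v: "v \<in> A"
          then have "\<phi> v \<in> topspace (cm_top M)" using AR hcurve_in_topspace[OF \<phi>(1)] by blast
          then show "v \<in> (ball u0 R \<inter> \<phi> -` inner) \<union> (ball u0 R \<inter> \<phi> -` outer)"
            using v no AR by (force simp: inner_def outer_def)
        qed
        moreover have "(ball u0 R \<inter> \<phi> -` inner) \<inter> (ball u0 R \<inter> \<phi> -` outer) \<inter> A = {}"
          by (auto simp: inner_def outer_def)
        moreover have "u0 \<in> (ball u0 R \<inter> \<phi> -` inner) \<inter> A"
          using R \<phi> V \<rho> by (simp add: A_def inner_def D_def)
        moreover have "u \<in> (ball u0 R \<inter> \<phi> -` outer) \<inter> A"
          using \<phi> r hcurve_in_topspace[OF \<phi>(1), of u]
          by (auto simp: A_def outer_def D_def n_def)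
        ultimately show False unfolding connected_def by blast
      qed
      then show ?thesis using \<phi> A by blast
    qed
    \<comment> \<open>The shift by 2 gives positive radii below \<open>R\<close> for every
      \<open>k\<close>, and they tend to 0.\<close>
    have "\<forall>k::nat. \<exists>z. hcurve (ball u0 R) M (fst z) \<and> fst z u0 = y \<and>
        snd z \<in> ball u0 (R / (of_nat k + 2)) \<and> fst z (snd z) \<in> V \<and> D (fst z (snd z)) = \<rho>"
    proof
      fix k :: nat
      have "0 < R / (of_nat k + 2)" "R / (of_nat k + 2) \<le> R"
        using R by (auto simp: field_simps)
      from ex[OF this] obtain \<phi> u where "hcurve (ball u0 R) M \<phi>" "\<phi> u0 = y"
        "u \<in> ball u0 (R / (of_nat k + 2))" "\<phi> u \<in> V" "D (\<phi> u) = \<rho>" by blast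
      then show "\<exists>z. hcurve (ball u0 R) M (fst z) \<and> fst z u0 = y \<and>
        snd z \<in> ball u0 (R / (of_nat k + 2)) \<and> fst z (snd z) \<in> V \<and> D (fst z (snd z)) = \<rho>"
        by (intro exI[of _ "(\<phi>, u)"]) simp
    qed
    from choice[OF this] obtain z where z: "\<And>k::nat. hcurve (ball u0 R) M (fst (z k)) \<and> fst (z k) u0 = y \<and>
        snd (z k) \<in> ball u0 (R / (of_nat k + 2)) \<and> fst (z k) (snd (z k)) \<in> V \<and>
        D (fst (z k) (snd (z k))) = \<rho>"
      by blast
    define \<phi> u p where "\<phi> k = fst (z k)" and "u k = snd (z k)" and "p k = fst (z k) (snd (z k))" for k
    have pu: "\<And>k. hcurve (ball u0 R) M (\<phi> k)" "\<And>k. \<phi> k u0 = y"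
      "\<And>k. u k \<in> ball u0 (R / (of_nat k + 2))" "\<And>k. \<phi> k (u k) = p k" "\<And>k. p k \<in> V" "\<And>k. D (p k) = \<rho>"
      using z by (auto simp: \<phi>_def u_def p_def)
    have S: "\<forall>k. \<psi> (p k) \<in> {w \<in> affine_space n. adist n w (\<psi> y) = \<rho>}"
      using pu(5,6) ch(3) by (auto simp: D_def)
    obtain l s where "l \<in> {w \<in> affine_space n. adist n w (\<psi> y) = \<rho>}" "strict_mono (s :: nat \<Rightarrow> nat)"
      "((\<lambda>k. \<psi> (p k)) \<circ> s) \<longlonglongrightarrow> l"
      by (rule seq_compactE[OF compact_imp_seq_compact[OF compact_adist_sphere] S])
    then have l: "l \<in> affine_space n" "adist n l (\<psi> y) = \<rho>" "strict_mono s"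
      "((\<lambda>k. \<psi> (p k)) \<circ> s) \<longlonglongrightarrow> l"
      by simp_all
    have "l \<in> \<psi> ` V" using \<rho>0(2)[OF l(1)] l(2) \<rho> by simp
    then obtain q where q: "q \<in> V" "\<psi> q = l" by blast
    then have "y \<noteq> q" using l(2) \<rho> by auto
    then obtain \<epsilon> where \<epsilon>: "\<epsilon> > 0" "\<And>s. disc_chain M y q s \<Longrightarrow> \<epsilon> \<le> s"
      using kobayashi_hyperbolic_chain[OF M(2)] V(2) q(1) Vtop by blast
    \<comment> \<open>The chain will consist of two discs, each allowed half of
      \<open>\<epsilon>\<close>.\<close>
    obtain \<delta> where \<delta>: "0 < \<delta>" "\<delta> < 1" "\<And>x. 0 \<le> x \<Longrightarrow> x \<le> \<delta> \<Longrightarrow> artanh x < \<epsilon> / 2"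
      using artanh_real_small[of "\<epsilon> / 2"] \<epsilon> by auto
    have "((\<lambda>k. adist n (((\<lambda>k. \<psi> (p k)) \<circ> s) k) l) \<longlonglongrightarrow> adist n l l)"
      by (rule continuous_on_tendsto_compose[OF continuous_on_adist[of UNIV] l(4)]) auto
    then have ev1: "eventually (\<lambda>k. adist n (\<psi> (p (s k))) l < \<rho> * \<delta>) sequentially"
      using \<rho> \<delta> by (intro order_tendstoD) auto
    have "(\<lambda>k. 1 / (real (s k) + 2)) \<longlonglongrightarrow> 0"
    proof -
      have "(\<lambda>k. 1 / (real k + 2)) \<longlonglongrightarrow> 0" by real_asymp
      from LIMSEQ_subseq_LIMSEQ[OF this l(3)] show ?thesis by (simp add: o_def)
    qed
    then have ev2: "eventually (\<lambda>k. 1 / (real (s k) + 2) < \<delta>) sequentially"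
      using \<delta> by (intro order_tendstoD) auto
    obtain k where k: "adist n (\<psi> (p (s k))) l < \<rho> * \<delta>" "1 / (real (s k) + 2) < \<delta>"
      using eventually_happens'[OF _ eventually_conj[OF ev1 ev2]] by auto
    define v where "v = u (s k)"
    define f where "f = \<phi> (s k)"
    define w where "w = \<psi> (p (s k))"
    have f: "hcurve (ball u0 R) M f" "f u0 = y" "f v = p (s k)"
      using pu by (auto simp: f_def v_def)
    have vR: "cmod (v - u0) < R / (real (s k) + 2)"
      using pu(3)[of "s k"] by (simp add: v_def dist_norm norm_minus_commute)
    have "R / (real (s k) + 2) \<le> R * \<delta>"
      using mult_left_mono[of "1 / (real (s k) + 2)" \<delta> R] k(2) R by simp
    then have vd: "cmod (v - u0) \<le> R * \<delta>" using vR by linarith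
    moreover have "R * \<delta> < R" using R \<delta> by simp
    ultimately have vball: "v \<in> ball u0 R" by (simp add: dist_norm norm_minus_commute)
    have "disc_chain M y (f u0) 0" using f V(2) Vtop by (auto intro: disc_chain.refl)
    from disc_chain_hcurve[OF Mc f(1) R _ vball this] R
    have c1: "disc_chain M y (p (s k)) (artanh (cmod (v - u0) / R))"
      by (simp add: f poincare_dist_def norm_divide)
    \<comment> \<open>The complex line through \<open>l\<close> and \<open>w\<close> with
      \<open>g 0 = l\<close> and \<open>g \<delta> = w\<close>. Since \<open>adist n w l\<close> is
      below \<open>\<rho> * \<delta>\<close>, it stays in the chart for all parameters in the unit
      disc, while 0 and \<open>\<delta>\<close> are close in the Poincare metric.\<close>
    define g where "g t i = l i + t * ((w i - l i) / of_real \<delta>)" for t i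
    have wV: "w \<in> affine_space n" using pu(5) ch(3) by (auto simp: w_def)
    have g_aff: "g t \<in> affine_space n" for t
      using wV l(1) by (simp add: g_def affine_space_def)
    have "adist n (g t) (\<psi> y) \<le> \<rho>0" if t: "t \<in> ball 0 1" for t
    proof -
      have "adist n (g t) (\<psi> y) \<le> (\<Sum>i<n. cmod (l i - \<psi> y i) + cmod t * cmod (w i - l i) / \<delta>)"
        unfolding adist_def
      proof (rule sum_mono)
        fix i
        have "cmod (g t i - \<psi> y i) = cmod ((l i - \<psi> y i) + t * ((w i - l i) / of_real \<delta>))"
          by (simp add: g_def algebra_simps)
        also have "\<dots> \<le> cmod (l i - \<psi> y i) + cmod (t * ((w i - l i) / of_real \<delta>))"
          by (rule norm_triangle_ineq)
        finally show "cmod (g t i - \<psi> y i) \<le> cmod (l i - \<psi> y i) + cmod t * cmod (w i - l i) / \<delta>"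
          using \<delta> by (simp add: norm_mult norm_divide)
      qed
      also have "\<dots> = adist n l (\<psi> y) + cmod t * adist n w l / \<delta>"
        by (simp add: sum.distrib adist_def sum_distrib_left sum_divide_distrib)
      also have "cmod t * adist n w l / \<delta> \<le> 1 * (\<rho> * \<delta>) / \<delta>"
        using t k(1) \<delta> by (intro divide_right_mono mult_mono) (auto simp: w_def adist_nonneg)
      finally show ?thesis using \<delta> l(2) by (simp add: \<rho>_def)
    qed
    then have "g ` ball 0 1 \<subseteq> \<psi> ` V" using \<rho>0(2)[OF g_aff] by blast
    then have G: "hcurve (ball 0 1) M (\<lambda>t. inv_into V \<psi> (g t))"
      by (intro hcurve_chart_inverse[OF M(1) V(1)]) (auto simp: g_def intro!: holomorphic_intros)
    have g_eq: "g (of_real \<delta>) = \<psi> (p (s k))" "g 0 = \<psi> q" using \<delta> q by (auto simp: g_def w_def)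
    have "inv_into V \<psi> (g (of_real \<delta>)) = p (s k)" "inv_into V \<psi> (g 0) = q"
      unfolding g_eq using inv_into_f_f[OF ch(2)] pu(5) q(1) by auto
    with disc_chain_hcurve[OF Mc G, of "of_real \<delta>" 0 y] c1 \<delta>
    have "disc_chain M y q (artanh (cmod (v - u0) / R) + artanh \<delta>)"
      by (simp add: poincare_dist_def)
    from \<epsilon>(2)[OF this] have "\<epsilon> \<le> artanh (cmod (v - u0) / R) + artanh \<delta>" .
    moreover have "artanh (cmod (v - u0) / R) < \<epsilon> / 2"
      using vd R by (intro \<delta>(3)) (auto simp: field_simps)
    moreover have "artanh \<delta> < \<epsilon> / 2" using \<delta> by simp
    ultimately show False by linarith
  qed
qed

text \<open>The velocity of \<open>c\<close> is the sum of those of \<open>c1\<close> and \<open>c2\<close>. This replaces the linearity of the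
  differential of a holomorphic map, so that no tangent spaces are needed.\<close>

definition tangent_sum ::
  "'a cmanifold \<Rightarrow> complex \<Rightarrow> (complex \<Rightarrow> 'a) \<Rightarrow> (complex \<Rightarrow> 'a) \<Rightarrow> (complex \<Rightarrow> 'a) \<Rightarrow> bool" where
  "tangent_sum M u0 c c1 c2 \<longleftrightarrow> c1 u0 = c u0 \<and> c2 u0 = c u0 \<and>
     (\<forall>U \<phi> j. (U, \<phi>) \<in> cm_charts M \<longrightarrow> c u0 \<in> U \<longrightarrow> j < cm_dim M \<longrightarrow>
        deriv (\<lambda>u. \<phi> (c u) j) u0 = deriv (\<lambda>u. \<phi> (c1 u) j) u0 + deriv (\<lambda>u. \<phi> (c2 u) j) u0)"

lemma tangent_sumD:
  assumes "tangent_sum M u0 c c1 c2" "(U, \<phi>) \<in> cm_charts M" "c u0 \<in> U" "j < cm_dim M"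
  shows "deriv (\<lambda>u. \<phi> (c u) j) u0 = deriv (\<lambda>u. \<phi> (c1 u) j) u0 + deriv (\<lambda>u. \<phi> (c2 u) j) u0"
  using assms unfolding tangent_sum_def by blast

lemma tangent_sum_cong:
  assumes "tangent_sum M u0 c c1 c2" "open A" "u0 \<in> A"
    and "\<And>u. u \<in> A \<Longrightarrow> c u = d u" "\<And>u. u \<in> A \<Longrightarrow> c1 u = d1 u" "\<And>u. u \<in> A \<Longrightarrow> c2 u = d2 u"
  shows "tangent_sum M u0 d d1 d2"
proof -
  have *: "deriv (\<lambda>u. \<phi> (e u) j) u0 = deriv (\<lambda>u. \<phi> (e' u) j) u0"
    if "\<forall>u\<in>A. e u = e' u" for e e' and \<phi> :: "'a \<Rightarrow> nat \<Rightarrow> complex" and j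
    by (rule deriv_cong_ev)
       (use that assms(2,3) in \<open>auto simp: eventually_nhds intro!: exI[of _ A]\<close>)
  have eq: "\<forall>u\<in>A. d u = c u" "\<forall>u\<in>A. d1 u = c1 u" "\<forall>u\<in>A. d2 u = c2 u" using assms(4-6) by auto
  show ?thesis
    using assms(1,3) eq unfolding tangent_sum_def
    by (simp add: *[OF eq(1)] *[OF eq(2)] *[OF eq(3)])
qed

text \<open>The three curves pass through one point, so the same row \<open>a\<close> of the
  differential of \<open>F\<close> computes all three velocities, and the claim is
  distributivity.\<close>

lemma tangent_sum_compose:
  assumes M: "charted M" and N: "charted N" and F: "holomorphic_map M N F"
    and c: "hcurve A M c" "hcurve A M c1" "hcurve A M c2" and u0: "u0 \<in> A"
    and sum: "tangent_sum M u0 c c1 c2"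
  shows "tangent_sum N u0 (\<lambda>u. F (c u)) (\<lambda>u. F (c1 u)) (\<lambda>u. F (c2 u))"
  unfolding tangent_sum_def
proof (intro conjI allI impI)
  have eq: "c1 u0 = c u0" "c2 u0 = c u0" using sum by (auto simp: tangent_sum_def)
  then show "F (c1 u0) = F (c u0)" "F (c2 u0) = F (c u0)" by simp_all
  fix V \<psi> j assume V: "(V, \<psi>) \<in> cm_charts N" "F (c u0) \<in> V" and j: "j < cm_dim N"
  obtain U \<phi> where U: "(U, \<phi>) \<in> cm_charts M" "c u0 \<in> U"
    using charted_cover[OF M] hcurve_in_topspace[OF c(1) u0] by metis
  obtain a where a: "\<And>A d u0'. hcurve A M d \<Longrightarrow> u0' \<in> A \<Longrightarrow> d u0' = c u0 \<Longrightarrow>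
      ((\<lambda>u. \<psi> (F (d u)) j) has_field_derivative
        (\<Sum>i<cm_dim M. a i * deriv (\<lambda>u. \<phi> (d u) i) u0')) (at u0')"
    by (rule holomorphic_map_curve_derivative[OF M F U V charted_chart(1)[OF N V(1)] j]) blast
  have "(\<Sum>i<cm_dim M. a i * deriv (\<lambda>u. \<phi> (c u) i) u0) =
    (\<Sum>i<cm_dim M. a i * deriv (\<lambda>u. \<phi> (c1 u) i) u0) + (\<Sum>i<cm_dim M. a i * deriv (\<lambda>u. \<phi> (c2 u) i) u0)"
    unfolding sum.distrib[symmetric]
    by (rule sum.cong) (use tangent_sumD[OF sum U] in \<open>auto simp: distrib_left\<close>)
  then show "deriv (\<lambda>u. \<psi> (F (c u)) j) u0 =
      deriv (\<lambda>u. \<psi> (F (c1 u)) j) u0 + deriv (\<lambda>u. \<psi> (F (c2 u)) j) u0"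
    using DERIV_imp_deriv[OF a[OF c(1) u0 HOL.refl]] DERIV_imp_deriv[OF a[OF c(2) u0 eq(1)]]
      DERIV_imp_deriv[OF a[OF c(3) u0 eq(2)]] by simp
qed

text \<open>Every coordinate of a product chart depends on one factor only, so one of the two
  summands is the derivative of a constant.\<close>

lemma tangent_sum_Pair:
  "tangent_sum (product_manifold M N) u0 (\<lambda>u. (b u, c u)) (\<lambda>u. (b u, c u0)) (\<lambda>u. (b u0, c u))"
  unfolding tangent_sum_def
proof (intro conjI allI impI)
  fix W \<xi> j assume "(W, \<xi>) \<in> cm_charts (product_manifold M N)"
  then obtain U \<phi> V \<psi> where
    "\<xi> = (\<lambda>(p, q) i. if i < cm_dim M then \<phi> p i else \<psi> q (i - cm_dim M))"
    by (auto simp: product_manifold_def)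
  then show "deriv (\<lambda>u. \<xi> (b u, c u) j) u0 =
      deriv (\<lambda>u. \<xi> (b u, c u0) j) u0 + deriv (\<lambda>u. \<xi> (b u0, c u) j) u0"
    by (cases "j < cm_dim M") simp_all
qed simp_all

lemma tangent_sum_snd:
  assumes M: "charted M" and sum: "tangent_sum (product_manifold M N) u0 c c1 c2"
    and c: "fst (c u0) \<in> topspace (cm_top M)"
  shows "tangent_sum N u0 (\<lambda>u. snd (c u)) (\<lambda>u. snd (c1 u)) (\<lambda>u. snd (c2 u))"
  unfolding tangent_sum_def
proof (intro conjI allI impI)
  show "snd (c1 u0) = snd (c u0)" "snd (c2 u0) = snd (c u0)" using sum by (auto simp: tangent_sum_def)
  fix V \<psi> j assume V: "(V, \<psi>) \<in> cm_charts N" "snd (c u0) \<in> V" and j: "j < cm_dim N"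
  obtain U \<phi> where U: "(U, \<phi>) \<in> cm_charts M" "fst (c u0) \<in> U"
    using charted_cover[OF M c] by metis
  have "cm_dim M + j < cm_dim (product_manifold M N)" "c u0 \<in> U \<times> V"
    using j U V by (auto simp: product_manifold_def mem_Times_iff)
  from tangent_sumD[OF sum product_chart[OF U(1) V(1)] this(2,1)]
  show "deriv (\<lambda>u. \<psi> (snd (c u)) j) u0 =
      deriv (\<lambda>u. \<psi> (snd (c1 u)) j) u0 + deriv (\<lambda>u. \<psi> (snd (c2 u)) j) u0"
    by (simp add: case_prod_unfold)
qed

lemma tangent_sum_open_submanifold:
  assumes "tangent_sum M u0 c c1 c2"
  shows "tangent_sum (open_submanifold M W) u0 c c1 c2"
  using assms unfolding tangent_sum_def open_submanifold_def by auto

lemma tangent_sum_of_open_submanifold: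
  assumes "tangent_sum (open_submanifold M W) u0 c c1 c2" "c u0 \<in> W"
  shows "tangent_sum M u0 c c1 c2"
  unfolding tangent_sum_def
proof (intro conjI allI impI)
  show "c1 u0 = c u0" "c2 u0 = c u0" using assms by (auto simp: tangent_sum_def)
  fix U \<phi> j assume U: "(U, \<phi>) \<in> cm_charts M" "c u0 \<in> U" "j < cm_dim M"
  then have "(U \<inter> W, \<phi>) \<in> cm_charts (open_submanifold M W)"
    by (auto simp: open_submanifold_def intro!: image_eqI[of _ _ "(U, \<phi>)"])
  from tangent_sumD[OF assms(1) this] U assms(2)
  show "deriv (\<lambda>u. \<phi> (c u) j) u0 = deriv (\<lambda>u. \<phi> (c1 u) j) u0 + deriv (\<lambda>u. \<phi> (c2 u) j) u0"
    by (simp add: open_submanifold_def)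
qed

text \<open>The family \<open>G\<close> is given through its action on curves. Hypothesis
  \<open>sum\<close> is the chain rule in the parameter and the point at \<open>u0\<close>; as
  \<open>G u0\<close> is the identity, its second summand is \<open>c\<close> itself. Each iteration
  therefore adds the same velocity.\<close>

lemma hyperbolic_stationary:
  assumes M: "complex_manifold M" "kobayashi_hyperbolic M" and R: "R > 0"
    and G: "\<And>c. hcurve (ball u0 R) M c \<Longrightarrow> hcurve (ball u0 R) M (\<lambda>u. G u (c u))"
    and id: "\<And>y. y \<in> topspace (cm_top M) \<Longrightarrow> G u0 y = y"
    and sum: "\<And>c. hcurve (ball u0 R) M c \<Longrightarrow>
      tangent_sum M u0 (\<lambda>u. G u (c u)) (\<lambda>u. G u (c u0)) c"
    and V: "(V, \<psi>) \<in> cm_charts M" "y \<in> V" and j: "j < cm_dim M"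
  shows "deriv (\<lambda>u. \<psi> (G u y) j) u0 = 0"
proof -
  note Mc = complex_manifold_charted[OF M(1)]
  have Vop: "openin (cm_top M) V" using charted_chart[OF Mc V(1)] by simp
  have y: "y \<in> topspace (cm_top M)" using openin_subset[OF Vop] V by blast
  define F where "F n u = ((G u) ^^ n) y" for n u
  have F_Suc: "F (Suc n) = (\<lambda>u. G u (F n u))" for n by (simp add: F_def fun_eq_iff)
  have F: "hcurve (ball u0 R) M (F n) \<and> F n u0 = y" for n
  proof (induction n)
    case 0
    then show ?case using hcurve_const[OF y, of "ball u0 R"] by (simp add: F_def)
  next
    case (Suc n)
    then show ?case using G[of "F n"] id[OF y] by (simp add: F_Suc)
  qed
  let ?v = "deriv (\<lambda>u. \<psi> (G u y) j) u0"
  have dF: "deriv (\<lambda>u. \<psi> (F n u) j) u0 = of_nat n * ?v" for n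
  proof (induction n)
    case 0
    then show ?case by (simp add: F_def)
  next
    case (Suc n)
    have "G u0 (F n u0) \<in> V" using F[of n] id[OF y] V by simp
    from tangent_sumD[OF sum[of "F n"] V(1) this j] F[of n]
    have "deriv (\<lambda>u. \<psi> (G u (F n u)) j) u0 = ?v + deriv (\<lambda>u. \<psi> (F n u) j) u0" by simp
    then show ?case using Suc by (simp add: F_Suc algebra_simps)
  qed
  \<comment> \<open>Radius and bound are chosen once and hold for all iterates, since all of them
    are discs on \<open>ball u0 R\<close> centred at \<open>y\<close>.\<close>
  obtain r \<rho> where r: "0 < r" "r \<le> R"
    "\<And>\<phi> u. hcurve (ball u0 R) M \<phi> \<Longrightarrow> \<phi> u0 = y \<Longrightarrow> u \<in> ball u0 r \<Longrightarrow>
       \<phi> u \<in> V \<and> adist (cm_dim M) (\<psi> (\<phi> u)) (\<psi> y) \<le> \<rho>"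
    using hyperbolic_equicontinuous[OF M V R, of u0] by blast
  have bound: "of_nat n * cmod ?v \<le> \<rho> / (r / 2)" for n
  proof -
    have "ball u0 r \<subseteq> ball u0 R \<inter> F n -` V" using r F[of n] by fastforce
    then have hol: "(\<lambda>u. \<psi> (F n u) j) holomorphic_on ball u0 r"
      using holomorphic_on_subset[OF hcurve_chart_holomorphic[OF _ V(1) j]] F[of n] by blast
    define f where "f u = \<psi> (F n u) j - \<psi> y j" for u
    have holf: "f holomorphic_on ball u0 r" unfolding f_def by (intro holomorphic_intros hol)
    \<comment> \<open>Cauchy's inequality with radius \<open>r / 2\<close>, so that the closed disc
      stays inside \<open>ball u0 r\<close>; the resulting bound is the same for all
      \<open>n\<close>.\<close>
    have "norm ((deriv ^^ 1) f u0) \<le> fact 1 * \<rho> / (r / 2) ^ 1"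
    proof (rule Cauchy_inequality)
      show "f holomorphic_on ball u0 (r / 2)" using r by (intro holomorphic_on_subset[OF holf]) auto
      have "cball u0 (r / 2) \<subseteq> ball u0 r" using r by auto
      then show "continuous_on (cball u0 (r / 2)) f"
        using holomorphic_on_imp_continuous_on[OF holf] continuous_on_subset by blast
      fix x assume "norm (u0 - x) = r / 2"
      then have "x \<in> ball u0 r" using r by (simp add: dist_norm)
      from r(3)[OF _ _ this, of "F n"] F[of n]
      have "adist (cm_dim M) (\<psi> (F n x)) (\<psi> y) \<le> \<rho>" by blast
      then show "norm (f x) \<le> \<rho>" using cmod_le_adist[OF j, of "\<psi> (F n x)" "\<psi> y"] by (simp add: f_def)
    qed (use r in auto)
    moreover have "deriv f u0 = deriv (\<lambda>u. \<psi> (F n u) j) u0"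
    proof -
      have "(\<lambda>u. \<psi> (F n u) j) field_differentiable at u0"
        using hol r by (intro holomorphic_on_imp_differentiable_at[of _ "ball u0 r"]) auto
      then show ?thesis unfolding f_def by (subst deriv_diff) auto
    qed
    ultimately show ?thesis using dF[of n] by (simp add: norm_mult)
  qed
  show ?thesis
  proof (rule ccontr)
    assume "?v \<noteq> 0"
    then have "0 < cmod ?v" by simp
    then obtain n where "\<rho> / (r / 2) < of_nat n * cmod ?v" using reals_Archimedean3 by blast
    then show False using bound[of n] by simp
  qed
qed

lemma hcurve_locally_constant:
  assumes M: "complex_manifold M" and c: "hcurve A M c" and A: "connected A"
    and d: "\<And>u0 V \<psi> j. u0 \<in> A \<Longrightarrow> (V, \<psi>) \<in> cm_charts M \<Longrightarrow> c u0 \<in> V \<Longrightarrow> j < cm_dim M \<Longrightarrow>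
      deriv (\<lambda>u. \<psi> (c u) j) u0 = 0"
    and ab: "a \<in> A" "b \<in> A"
  shows "c a = c b"
proof (rule connected_local_const[OF A ab], intro ballI)
  fix a assume a: "a \<in> A"
  note Mc = complex_manifold_charted[OF M]
  obtain V \<psi> where V: "(V, \<psi>) \<in> cm_charts M" "c a \<in> V"
    using charted_cover[OF Mc hcurve_in_topspace[OF c a]] by metis
  note ch = charted_chart[OF Mc V(1)]
  obtain e where e: "e > 0" "ball a e \<subseteq> A \<inter> c -` V"
    using hcurve_open_preimage[OF c ch(1)] a V(2) open_contains_ball by blast
  have const: "c b = c a" if b: "b \<in> ball a e" for b
  proof -
    have "\<psi> (c b) i = \<psi> (c a) i" for i
    proof (cases "i < cm_dim M")
      case True
      have "((\<lambda>u. \<psi> (c u) i) has_field_derivative 0) (at u within ball a e)" if "u \<in> ball a e" for u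
      proof -
        have u: "u \<in> A" "c u \<in> V" using e(2) that by auto
        show ?thesis
          using hcurve_has_field_derivative[OF c V(1) ch(1) True u] d[OF u(1) V(1) u(2) True]
          by (simp add: has_field_derivative_at_within)
      qed
      from has_field_derivative_zero_constant[OF convex_ball this] b e
      show ?thesis by fastforce
    next
      case False
      then show ?thesis using affine_space_image_zero[OF ch(3)] e b V(2) by (auto simp: subset_iff)
    qed
    then have "\<psi> (c b) = \<psi> (c a)" by (rule ext)
    moreover have "c b \<in> V" using e(2) b by blast
    ultimately show ?thesis using inj_onD[OF ch(2)] V(2) by metis
  qed
  have "eventually (\<lambda>b. b \<in> ball a e) (at a within A)"
    using e(1) by (auto simp: eventually_at dist_commute)
  then show "eventually (\<lambda>b. c a = c b) (at a within A)"
    by eventually_elim (rule const[symmetric])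
qed

section \<open>Bundles with hyperbolic fibre are flat\<close>

locale hyperbolic_bundle =
  fixes E :: "'e cmanifold" and X :: "'x cmanifold" and Y :: "'y cmanifold" and \<pi> :: "'e \<Rightarrow> 'x"
  assumes fibre_bundle: "holomorphic_fibre_bundle E X Y \<pi>"
    and hyperbolic: "kobayashi_hyperbolic Y"
begin

lemma manifolds: "complex_manifold E" "complex_manifold X" "complex_manifold Y"
  and projection: "holomorphic_map E X \<pi>"
  using fibre_bundle by (auto simp: holomorphic_fibre_bundle_def)

lemmas E_charted = complex_manifold_charted[OF manifolds(1)]
lemmas X_charted = complex_manifold_charted[OF manifolds(2)]
lemmas Y_charted = complex_manifold_charted[OF manifolds(3)]

definition tube :: "'x set \<Rightarrow> 'e set" where
  "tube U = {e \<in> topspace (cm_top E). \<pi> e \<in> U}"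

definition fibre :: "'x \<Rightarrow> 'e set" where
  "fibre x = {e \<in> topspace (cm_top E). \<pi> e = x}"

text \<open>The inverse is an explicit argument because both directions are applied to curves. That
  \<open>\<theta>i\<close> respects fibres follows from the condition on
  \<open>fst (\<theta> e)\<close> and is recorded for later use.\<close>

definition trivialization :: "'x set \<Rightarrow> ('e \<Rightarrow> 'x \<times> 'y) \<Rightarrow> ('x \<times> 'y \<Rightarrow> 'e) \<Rightarrow> bool" where
  "trivialization U \<theta> \<theta>i \<longleftrightarrow> openin (cm_top X) U \<and>
     holomorphic_map (open_submanifold E (tube U)) (product_manifold (open_submanifold X U) Y) \<theta> \<and>
     holomorphic_map (product_manifold (open_submanifold X U) Y) (open_submanifold E (tube U)) \<theta>i \<and>
     (\<forall>e\<in>tube U. \<theta>i (\<theta> e) = e \<and> fst (\<theta> e) = \<pi> e \<and> snd (\<theta> e) \<in> topspace (cm_top Y)) \<and>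
     (\<forall>x\<in>U. \<forall>y\<in>topspace (cm_top Y). \<theta>i (x, y) \<in> fibre x \<and> \<theta> (\<theta>i (x, y)) = (x, y))"

lemma trivialization_exists:
  assumes "x \<in> topspace (cm_top X)"
  obtains U \<theta> \<theta>i where "x \<in> U" "trivialization U \<theta> \<theta>i"
proof -
  obtain U \<theta> where U: "openin (cm_top X) U" "x \<in> U"
    and bi: "biholomorphic_map (open_submanifold E (tube U)) (product_manifold (open_submanifold X U) Y) \<theta>"
    and fst: "\<And>e. e \<in> tube U \<Longrightarrow> fst (\<theta> e) = \<pi> e"
    using fibre_bundle assms unfolding holomorphic_fibre_bundle_def tube_def by blast
  obtain \<theta>i where \<theta>: "holomorphic_map (open_submanifold E (tube U)) (product_manifold (open_submanifold X U) Y) \<theta>"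
    and \<theta>i: "holomorphic_map (product_manifold (open_submanifold X U) Y) (open_submanifold E (tube U)) \<theta>i"
    and inv: "\<And>p. p \<in> topspace (cm_top (open_submanifold E (tube U))) \<Longrightarrow> \<theta>i (\<theta> p) = p"
      "\<And>q. q \<in> topspace (cm_top (product_manifold (open_submanifold X U) Y)) \<Longrightarrow> \<theta> (\<theta>i q) = q"
    using bi unfolding biholomorphic_map_def by blast
  have U': "U \<subseteq> topspace (cm_top X)" using openin_subset[OF U(1)] .
  have tE: "topspace (cm_top (open_submanifold E (tube U))) = tube U"
    by (auto simp: open_submanifold_def tube_def)
  have tP: "topspace (cm_top (product_manifold (open_submanifold X U) Y)) = U \<times> topspace (cm_top Y)"
    using U' by (auto simp: open_submanifold_def product_manifold_def)
  have "\<theta> e \<in> U \<times> topspace (cm_top Y)" if "e \<in> tube U" for e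
    using holomorphic_map_in_topspace[OF \<theta>] that tE tP by metis
  moreover have "\<theta>i (x, y) \<in> fibre x" if xy: "x \<in> U" "y \<in> topspace (cm_top Y)" for x y
  proof -
    have "\<theta>i (x, y) \<in> tube U" using holomorphic_map_in_topspace[OF \<theta>i] xy tE tP by (metis SigmaI)
    moreover have "\<theta> (\<theta>i (x, y)) = (x, y)" using inv(2) xy tP by blast
    ultimately show ?thesis using fst[of "\<theta>i (x, y)"] by (auto simp: fibre_def tube_def)
  qed
  ultimately have "trivialization U \<theta> \<theta>i"
    unfolding trivialization_def using U \<theta> \<theta>i inv tE tP fst by (auto simp: mem_Times_iff)
  then show thesis using that U by blast
qed

lemma trivialization_open: "trivialization U \<theta> \<theta>i \<Longrightarrow> openin (cm_top X) U"
  by (simp add: trivialization_def)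

lemma trivialization_fibre_snd:
  "trivialization U \<theta> \<theta>i \<Longrightarrow> x \<in> U \<Longrightarrow> e \<in> fibre x \<Longrightarrow> snd (\<theta> e) \<in> topspace (cm_top Y)"
  by (auto simp: trivialization_def fibre_def tube_def)

lemma trivialization_inverse:
  "trivialization U \<theta> \<theta>i \<Longrightarrow> x \<in> U \<Longrightarrow> e \<in> fibre x \<Longrightarrow> \<theta>i (x, snd (\<theta> e)) = e"
  unfolding trivialization_def fibre_def tube_def by (metis (mono_tags, lifting) mem_Collect_eq prod.collapse)

lemma trivialization_fibre:
  "trivialization U \<theta> \<theta>i \<Longrightarrow> x \<in> U \<Longrightarrow> y \<in> topspace (cm_top Y) \<Longrightarrow> \<theta>i (x, y) \<in> fibre x"
  by (simp add: trivialization_def)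

lemma trivialization_snd_inverse:
  "trivialization U \<theta> \<theta>i \<Longrightarrow> x \<in> U \<Longrightarrow> y \<in> topspace (cm_top Y) \<Longrightarrow> snd (\<theta> (\<theta>i (x, y))) = y"
  by (simp add: trivialization_def)

lemma openin_tube: "openin (cm_top X) U \<Longrightarrow> openin (cm_top E) (tube U)"
  unfolding tube_def using projection
  by (auto simp: holomorphic_map_def intro: openin_continuous_map_preimage)

lemma trivialization_charted:
  assumes "trivialization U \<theta> \<theta>i"
  shows "charted (open_submanifold X U)" "charted (open_submanifold E (tube U))"
    "charted (product_manifold (open_submanifold X U) Y)"
  using trivialization_open[OF assms] openin_tube
  by (auto intro!: charted_open_submanifold charted_product_manifold X_charted E_charted Y_charted)

lemma hcurve_trivialization:
  assumes U: "trivialization U \<theta> \<theta>i" and c: "hcurve A E c" "\<And>z. z \<in> A \<Longrightarrow> \<pi> (c z) \<in> U"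
  shows "hcurve A Y (\<lambda>z. snd (\<theta> (c z)))"
proof -
  note ch = trivialization_charted[OF U]
  have "hcurve A (open_submanifold E (tube U)) c"
    using c hcurve_in_topspace[OF c(1)] by (auto simp: hcurve_open_submanifold_iff tube_def)
  then have "hcurve A (product_manifold (open_submanifold X U) Y) (\<lambda>z. \<theta> (c z))"
    using U by (intro hcurve_compose[OF ch(2,3)]) (auto simp: trivialization_def)
  then show ?thesis by (rule hcurve_snd[OF ch(1)])
qed

lemma hcurve_trivialization_inverse':
  assumes U: "trivialization U \<theta> \<theta>i" and b: "hcurve A X b" "\<And>z. z \<in> A \<Longrightarrow> b z \<in> U"
    and y: "hcurve A Y y"
  shows "hcurve A (open_submanifold E (tube U)) (\<lambda>z. \<theta>i (b z, y z))"
proof -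
  note ch = trivialization_charted[OF U]
  have "hcurve A (open_submanifold X U) b" using b by (auto simp: hcurve_open_submanifold_iff)
  then have "hcurve A (product_manifold (open_submanifold X U) Y) (\<lambda>z. (b z, y z))"
    using y by (rule hcurve_Pair)
  then show ?thesis
    using U by (intro hcurve_compose[OF ch(3,2)]) (auto simp: trivialization_def)
qed

lemma hcurve_trivialization_inverse:
  assumes U: "trivialization U \<theta> \<theta>i" and b: "hcurve A X b" "\<And>z. z \<in> A \<Longrightarrow> b z \<in> U"
    and y: "hcurve A Y y"
  shows "hcurve A E (\<lambda>z. \<theta>i (b z, y z))"
  using hcurve_trivialization_inverse'[OF assms] by (simp add: hcurve_open_submanifold_iff)

text \<open>The product rule for the transition map in base parameter and fibre point:
  \<open>tangent_sum_Pair\<close> is pushed through \<open>\<theta>i\<close>, \<open>\<eta>\<close>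
  and the second projection. Velocities are passed through \<open>E\<close> because
  \<open>\<theta>i\<close> ends in the tube of \<open>U\<close> while \<open>\<eta>\<close> starts
  from the tube of \<open>V\<close>.\<close>

lemma tangent_sum_transition:
  assumes U: "trivialization U \<theta> \<theta>i" and V: "trivialization V \<eta> \<eta>i"
    and b: "hcurve A X b" "\<And>z. z \<in> A \<Longrightarrow> b z \<in> U \<inter> V" and y: "hcurve A Y y" and u0: "u0 \<in> A"
  shows "tangent_sum Y u0 (\<lambda>u. snd (\<eta> (\<theta>i (b u, y u)))) (\<lambda>u. snd (\<eta> (\<theta>i (b u, y u0))))
     (\<lambda>u. snd (\<eta> (\<theta>i (b u0, y u))))"
proof -
  note chU = trivialization_charted[OF U]
  note chV = trivialization_charted[OF V]
  have A: "open A" using hcurve_open[OF b(1)] .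
  have bU: "b z \<in> U" and bV: "b z \<in> V" if "z \<in> A" for z using b(2) that by auto
  have const: "hcurve A X (\<lambda>_. b u0)" "hcurve A Y (\<lambda>_. y u0)"
    using hcurve_const[OF hcurve_in_topspace[OF b(1) u0] A] hcurve_const[OF hcurve_in_topspace[OF y u0] A]
    by auto
  have bU': "hcurve A (open_submanifold X U) b" "hcurve A (open_submanifold X U) (\<lambda>_. b u0)"
    using b bU const u0 by (auto simp: hcurve_open_submanifold_iff)
  have 1: "tangent_sum E u0 (\<lambda>u. \<theta>i (b u, y u)) (\<lambda>u. \<theta>i (b u, y u0)) (\<lambda>u. \<theta>i (b u0, y u))"
  proof -
    have *: "tangent_sum (open_submanifold E (tube U)) u0 (\<lambda>u. \<theta>i (b u, y u)) (\<lambda>u. \<theta>i (b u, y u0))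
       (\<lambda>u. \<theta>i (b u0, y u))"
      by (rule tangent_sum_compose[OF chU(3,2) _ _ _ _ u0 tangent_sum_Pair])
         (use U bU' y const in \<open>auto simp: trivialization_def intro!: hcurve_Pair\<close>)
    have "\<theta>i (b u0, y u0) \<in> tube U"
      using trivialization_fibre[OF U bU[OF u0] hcurve_in_topspace[OF y u0]] bU[OF u0]
      by (auto simp: fibre_def tube_def)
    then show ?thesis
      using tangent_sum_of_open_submanifold[OF *] by simp
  qed
  have in_tube: "\<theta>i (b z, y') \<in> tube V" if "z \<in> A" "y' \<in> topspace (cm_top Y)" for z y'
    using trivialization_fibre[OF U bU[OF that(1)] that(2)] bV[OF that(1)] by (auto simp: fibre_def tube_def)
  have yA: "y z \<in> topspace (cm_top Y)" if "z \<in> A" for z using hcurve_in_topspace[OF y that] .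
  have c: "hcurve A (open_submanifold E (tube V)) (\<lambda>u. \<theta>i (b u, y u))"
      "hcurve A (open_submanifold E (tube V)) (\<lambda>u. \<theta>i (b u, y u0))"
      "hcurve A (open_submanifold E (tube V)) (\<lambda>u. \<theta>i (b u0, y u))"
    using in_tube yA u0 bU
    by (auto simp: hcurve_open_submanifold_iff
        intro!: hcurve_trivialization_inverse[OF U] b(1) const y)
  have "tangent_sum (product_manifold (open_submanifold X V) Y) u0 (\<lambda>u. \<eta> (\<theta>i (b u, y u)))
     (\<lambda>u. \<eta> (\<theta>i (b u, y u0))) (\<lambda>u. \<eta> (\<theta>i (b u0, y u)))"
    by (rule tangent_sum_compose[OF chV(2,3) _ c u0 tangent_sum_open_submanifold[OF 1]])
       (use V in \<open>auto simp: trivialization_def\<close>)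
  then show ?thesis
  proof (rule tangent_sum_snd[OF chV(1)])
    have "fst (\<eta> (\<theta>i (b u0, y u0))) = b u0"
      using V in_tube[OF u0 yA[OF u0]] trivialization_fibre[OF U bU[OF u0] yA[OF u0]]
      by (auto simp: trivialization_def fibre_def)
    then show "fst (\<eta> (\<theta>i (b u0, y u0))) \<in> topspace (cm_top (open_submanifold X V))"
      using bV[OF u0] hcurve_in_topspace[OF b(1) u0] by (simp add: open_submanifold_def)
  qed
qed

text \<open>Flatness of the bundle, tested along curves in the base. At each parameter
  \<open>u0\<close> the transition maps are normalised to start at the identity, so that
  \<open>hyperbolic_stationary\<close> applies.\<close>

lemma transition_constant:
  assumes U: "trivialization U \<theta> \<theta>i" and V: "trivialization V \<eta> \<eta>i"
    and b: "hcurve A X b" "\<And>z. z \<in> A \<Longrightarrow> b z \<in> U \<inter> V" and A: "connected A"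
    and y: "y \<in> topspace (cm_top Y)" and uv: "u \<in> A" "v \<in> A"
  shows "snd (\<eta> (\<theta>i (b u, y))) = snd (\<eta> (\<theta>i (b v, y)))"
proof -
  have bU: "b z \<in> U" and bV: "b z \<in> V" if "z \<in> A" for z using b(2) that by auto
  have UV: "x \<in> V \<Longrightarrow> e \<in> fibre x \<Longrightarrow> \<pi> e \<in> V" "x \<in> U \<Longrightarrow> e \<in> fibre x \<Longrightarrow> \<pi> e \<in> U" for x e
    by (auto simp: fibre_def)
  have trans: "hcurve B Y (\<lambda>u. snd (\<eta> (\<theta>i (b' u, c u))))"
    if "hcurve B Y c" "hcurve B X b'" "\<And>z. z \<in> B \<Longrightarrow> b' z \<in> U \<inter> V" for B c b'
  proof (rule hcurve_trivialization[OF V hcurve_trivialization_inverse[OF U that(2) _ that(1)]])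
    fix z assume z: "z \<in> B"
    then show "b' z \<in> U" using that(3) by blast
    then have "\<theta>i (b' z, c z) \<in> fibre (b' z)"
      using trivialization_fibre[OF U] hcurve_in_topspace[OF that(1) z] by blast
    then show "\<pi> (\<theta>i (b' z, c z)) \<in> V" using UV(1) that(3)[OF z] by blast
  qed
  have "hcurve A Y (\<lambda>u. snd (\<eta> (\<theta>i (b u, y))))"
    using trans[OF hcurve_const[OF y hcurve_open[OF b(1)]] b] .
  then show ?thesis
  proof (rule hcurve_locally_constant[OF manifolds(3) _ A _ uv])
    fix u0 W \<psi> j
    assume u0: "u0 \<in> A" and W: "(W, \<psi>) \<in> cm_charts Y" "snd (\<eta> (\<theta>i (b u0, y))) \<in> W"
      and j: "j < cm_dim Y"
    obtain R where R: "R > 0" "ball u0 R \<subseteq> A"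
      using hcurve_open[OF b(1)] u0 open_contains_ball by blast
    \<comment> \<open>\<open>\<kappa>\<close> inverts the transition map over \<open>b u0\<close>,
      so the family \<open>G\<close> below is the identity of \<open>Y\<close> at
      \<open>u0\<close>.\<close>
    define \<kappa> where "\<kappa> y' = snd (\<theta> (\<eta>i (b u0, y')))" for y'
    define G where "G u y' = snd (\<eta> (\<theta>i (b u, \<kappa> y')))" for u y'
    have bR: "hcurve (ball u0 R) X b" using hcurve_subset[OF b(1) R(2)] by simp
    have \<kappa>_in: "\<kappa> y' \<in> topspace (cm_top Y)" if "y' \<in> topspace (cm_top Y)" for y'
      unfolding \<kappa>_def
      using trivialization_fibre_snd[OF U bU[OF u0]] trivialization_fibre[OF V bV[OF u0] that] by blast
    have \<kappa>: "hcurve (ball u0 R) Y (\<lambda>u. \<kappa> (c u))" if c: "hcurve (ball u0 R) Y c" for c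
    proof -
      have "hcurve (ball u0 R) X (\<lambda>_. b u0)"
        using hcurve_const[OF hcurve_in_topspace[OF b(1) u0]] by simp
      then have "hcurve (ball u0 R) E (\<lambda>u. \<eta>i (b u0, c u))"
        by (rule hcurve_trivialization_inverse[OF V _ _ c]) (use bV[OF u0] in simp)
      then show ?thesis unfolding \<kappa>_def
        by (rule hcurve_trivialization[OF U])
           (use UV(2)[OF bU[OF u0]] trivialization_fibre[OF V bV[OF u0]] hcurve_in_topspace[OF c] in blast)
    qed
    have id: "snd (\<eta> (\<theta>i (b u0, \<kappa> y'))) = y'" if "y' \<in> topspace (cm_top Y)" for y'
    proof -
      have "\<theta>i (b u0, \<kappa> y') = \<eta>i (b u0, y')"
        unfolding \<kappa>_def
        using trivialization_inverse[OF U bU[OF u0]] trivialization_fibre[OF V bV[OF u0] that] by blast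
      then show ?thesis using trivialization_snd_inverse[OF V bV[OF u0] that] by simp
    qed
    \<comment> \<open>The point with \<open>\<kappa> y' = y\<close>: at it \<open>G\<close>
      reproduces the curve whose derivative is sought.\<close>
    define y' where "y' = snd (\<eta> (\<theta>i (b u0, y)))"
    have fy: "\<theta>i (b u0, y) \<in> fibre (b u0)" using trivialization_fibre[OF U bU[OF u0] y] .
    then have y': "y' \<in> topspace (cm_top Y)"
      unfolding y'_def using trivialization_fibre_snd[OF V bV[OF u0]] by blast
    have "\<eta>i (b u0, y') = \<theta>i (b u0, y)"
      unfolding y'_def using trivialization_inverse[OF V bV[OF u0] fy] .
    then have \<kappa>y': "\<kappa> y' = y" unfolding \<kappa>_def using trivialization_snd_inverse[OF U bU[OF u0] y] by simp
    have "deriv (\<lambda>u. \<psi> (G u y') j) u0 = 0"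
    proof (rule hyperbolic_stationary[OF manifolds(3) hyperbolic R(1) _ _ _ W(1) _ j])
      show "hcurve (ball u0 R) Y (\<lambda>u. G u (c u))" if "hcurve (ball u0 R) Y c" for c
        unfolding G_def using trans[OF \<kappa>[OF that] bR] b(2) R(2) by blast
      show "G u0 y = y" if "y \<in> topspace (cm_top Y)" for y
        unfolding G_def using id[OF that] .
      show "y' \<in> W" using W(2) by (simp add: y'_def)
      show "tangent_sum Y u0 (\<lambda>u. G u (c u)) (\<lambda>u. G u (c u0)) c" if c: "hcurve (ball u0 R) Y c" for c
      proof (rule tangent_sum_cong[of Y u0 _ _ _ "ball u0 R"])
        show "tangent_sum Y u0 (\<lambda>u. snd (\<eta> (\<theta>i (b u, \<kappa> (c u))))) (\<lambda>u. snd (\<eta> (\<theta>i (b u, \<kappa> (c u0)))))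
          (\<lambda>u. snd (\<eta> (\<theta>i (b u0, \<kappa> (c u)))))"
          by (rule tangent_sum_transition[OF U V bR _ \<kappa>[OF c]]) (use b(2) R in auto)
        show "snd (\<eta> (\<theta>i (b u0, \<kappa> (c u)))) = c u" if "u \<in> ball u0 R" for u
          using id[OF hcurve_in_topspace[OF c that]] .
      qed (use R in \<open>auto simp: G_def\<close>)
    qed
    then show "deriv (\<lambda>u. \<psi> (snd (\<eta> (\<theta>i (b u, y)))) j) u0 = 0" by (simp add: G_def \<kappa>y')
  qed
qed

end

section \<open>Flat frames over plane domains\<close>

definition rect :: "real \<Rightarrow> real \<Rightarrow> real \<Rightarrow> real \<Rightarrow> complex set" where
  "rect a b c d = {z. a \<le> Re z \<and> Re z \<le> b \<and> c \<le> Im z \<and> Im z \<le> d}"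

lemma closed_rect: "closed (rect a b c d)"
  unfolding rect_def Collect_conj_eq
  by (intro closed_Int closed_halfspace_Re_le closed_halfspace_Re_ge closed_halfspace_Im_le
      closed_halfspace_Im_ge)

lemma convex_rect: "convex (rect a b c d)"
  unfolding rect_def Collect_conj_eq
  by (intro convex_Int convex_halfspace_Re_le convex_halfspace_Re_ge convex_halfspace_Im_le
      convex_halfspace_Im_ge)

lemma rect_split_Re: "a \<le> b \<Longrightarrow> b \<le> c \<Longrightarrow> rect a c s t = rect a b s t \<union> rect b c s t"
  "a \<le> b \<Longrightarrow> b \<le> c \<Longrightarrow> rect a b s t \<inter> rect b c s t = rect b b s t"
  by (auto simp: rect_def)

lemma rect_split_Im: "a \<le> b \<Longrightarrow> b \<le> c \<Longrightarrow> rect s t a c = rect s t a b \<union> rect s t b c"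
  "a \<le> b \<Longrightarrow> b \<le> c \<Longrightarrow> rect s t a b \<inter> rect s t b c = rect s t b b"
  by (auto simp: rect_def)

text \<open>Bisection in both directions. The outer induction concerns the real parts; its local
  step asserts the property for all sufficiently thin rectangles of a given height, and this
  assertion is proved by induction on the imaginary parts. Adjacent rectangles meet in a common
  edge, which is connected and nonempty.\<close>

lemma rectangle_induct:
  assumes Un: "\<And>A B. P A \<Longrightarrow> P B \<Longrightarrow> closed A \<Longrightarrow> closed B \<Longrightarrow> connected (A \<inter> B) \<Longrightarrow> A \<inter> B \<noteq> {} \<Longrightarrow> P (A \<union> B)"
    and local: "\<And>z. \<exists>e>0. \<forall>A. A \<subseteq> ball z e \<longrightarrow> P A"
    and le: "a \<le> b" "c \<le> d"
  shows "P (rect a b c d)"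
  using le(1)
proof (induction a b rule: Bolzano)
  case (trans a1 a2 a3)
  have "Complex a2 c \<in> rect a2 a2 c d" using le by (simp add: rect_def)
  then show ?case
    using trans Un[of "rect a1 a2 c d" "rect a2 a3 c d"] closed_rect
      convex_connected[OF convex_rect[of a2 a2 c d]]
    by (auto simp: rect_split_Re[of a1 a2 a3])
next
  case (local x)
  show ?case
    using le(2)
  proof (induction c d rule: Bolzano)
    case (trans c1 c2 c3)
    then obtain e1 e2 where e: "e1 > 0" "\<And>a b. a \<le> x \<Longrightarrow> x \<le> b \<Longrightarrow> b - a < e1 \<Longrightarrow> P (rect a b c1 c2)"
      "e2 > 0" "\<And>a b. a \<le> x \<Longrightarrow> x \<le> b \<Longrightarrow> b - a < e2 \<Longrightarrow> P (rect a b c2 c3)"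
      by metis
    have "P (rect a b c1 c3)" if "a \<le> x" "x \<le> b" "b - a < min e1 e2" for a b
    proof -
      have "Complex x c2 \<in> rect a b c2 c2" using that by (simp add: rect_def)
      then show ?thesis
        using e(2,4)[of a b] that trans(3,4) Un[of "rect a b c1 c2" "rect a b c2 c3"] closed_rect
          convex_connected[OF convex_rect[of a b c2 c2]]
        by (auto simp: rect_split_Im[of c1 c2 c3])
    qed
    then show ?case using e(1,3) by (intro exI[of _ "min e1 e2"]) auto
  next
    case (local y)
    obtain e where e: "e > 0" "\<And>A. A \<subseteq> ball (Complex x y) e \<Longrightarrow> P A"
      using assms(2)[of "Complex x y"] by blast
    \<comment> \<open>Both sides are kept below \<open>e / 2\<close> because the modulus is at most
      the sum of the absolute values of real and imaginary part.\<close>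
    have sub: "rect a b c d \<subseteq> ball (Complex x y) e"
      if "a \<le> x" "x \<le> b" "b - a < e / 2" "c \<le> y" "y \<le> d" "d - c < e / 2" for a b c d
    proof
      fix z assume "z \<in> rect a b c d"
      then have "\<bar>Re (z - Complex x y)\<bar> < e / 2" "\<bar>Im (z - Complex x y)\<bar> < e / 2"
        using that by (auto simp: rect_def abs_real_def)
      then have "cmod (z - Complex x y) < e" using cmod_le[of "z - Complex x y"] by linarith
      then show "z \<in> ball (Complex x y) e" by (simp add: dist_norm norm_minus_commute)
    qed
    have *: "P (rect a b c d)"
      if "a \<le> x" "x \<le> b" "b - a < e / 2" "c \<le> y" "y \<le> d" "d - c < e / 2" for a b c d
      by (rule e(2)[OF sub[OF that]])
    have "\<exists>\<delta>>0. \<forall>a b. a \<le> x \<and> x \<le> b \<and> b - a < \<delta> \<longrightarrow> P (rect a b c d)"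
      if "c \<le> y" "y \<le> d" "d - c < e / 2" for c d
      using e(1) * that by (intro exI[of _ "e / 2"]) simp
    then show ?case using e(1) by (intro exI[of _ "e / 2"]) simp
  qed
qed

section \<open>Flat frames along an entire curve in the base\<close>

context hyperbolic_bundle
begin

text \<open>\<open>T z\<close> identifies the fibre over \<open>b z\<close> with \<open>Y\<close>; that it is biholomorphic is expressed by its
  action on curves. The last clause says that \<open>T\<close> is constant along the horizontal sections
  \<open>w \<mapsto> \<theta>i (b w, y)\<close>.\<close>

definition flat_frame :: "(complex \<Rightarrow> 'x) \<Rightarrow> complex set \<Rightarrow> (complex \<Rightarrow> 'e \<Rightarrow> 'y) \<Rightarrow> bool" where
  "flat_frame b A T \<longleftrightarrow>
     (\<forall>z\<in>A. bij_betw (T z) (fibre (b z)) (topspace (cm_top Y)) \<and>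
        (\<forall>D c. hcurve D E c \<longrightarrow> c ` D \<subseteq> fibre (b z) \<longrightarrow> hcurve D Y (\<lambda>u. T z (c u))) \<and>
        (\<forall>D c. hcurve D Y c \<longrightarrow> hcurve D E (\<lambda>u. inv_into (fibre (b z)) (T z) (c u))) \<and>
        (\<forall>U \<theta> \<theta>i. trivialization U \<theta> \<theta>i \<longrightarrow> b z \<in> U \<longrightarrow>
           (\<exists>N. open N \<and> z \<in> N \<and> b ` N \<subseteq> U \<and>
              (\<forall>w\<in>N \<inter> A. \<forall>y\<in>topspace (cm_top Y). T w (\<theta>i (b w, y)) = T z (\<theta>i (b z, y))))))"

lemma flat_frame_bij: "flat_frame b A T \<Longrightarrow> z \<in> A \<Longrightarrow> bij_betw (T z) (fibre (b z)) (topspace (cm_top Y))"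
  by (simp add: flat_frame_def)

lemma flat_frame_curve:
  "flat_frame b A T \<Longrightarrow> z \<in> A \<Longrightarrow> hcurve D E c \<Longrightarrow> c ` D \<subseteq> fibre (b z) \<Longrightarrow> hcurve D Y (\<lambda>u. T z (c u))"
  by (simp add: flat_frame_def)

lemma flat_frame_inverse_curve:
  "flat_frame b A T \<Longrightarrow> z \<in> A \<Longrightarrow> hcurve D Y c \<Longrightarrow> hcurve D E (\<lambda>u. inv_into (fibre (b z)) (T z) (c u))"
  by (simp add: flat_frame_def)

lemma flat_frame_local:
  assumes "flat_frame b A T" "z \<in> A" "trivialization U \<theta> \<theta>i" "b z \<in> U"
  obtains N where "open N" "z \<in> N" "b ` N \<subseteq> U"
    "\<And>w y. w \<in> N \<Longrightarrow> w \<in> A \<Longrightarrow> y \<in> topspace (cm_top Y) \<Longrightarrow> T w (\<theta>i (b w, y)) = T z (\<theta>i (b z, y))"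
proof -
  have "\<forall>U \<theta> \<theta>i. trivialization U \<theta> \<theta>i \<longrightarrow> b z \<in> U \<longrightarrow>
      (\<exists>N. open N \<and> z \<in> N \<and> b ` N \<subseteq> U \<and>
        (\<forall>w\<in>N \<inter> A. \<forall>y\<in>topspace (cm_top Y). T w (\<theta>i (b w, y)) = T z (\<theta>i (b z, y))))"
    using assms(1,2) by (simp add: flat_frame_def)
  then obtain N where "open N \<and> z \<in> N \<and> b ` N \<subseteq> U \<and>
        (\<forall>w\<in>N \<inter> A. \<forall>y\<in>topspace (cm_top Y). T w (\<theta>i (b w, y)) = T z (\<theta>i (b z, y)))"
    using assms(3,4) by meson
  then show thesis using that[of N] by simp
qed

lemma flat_frame_subset:
  assumes "flat_frame b A T" "B \<subseteq> A"
  shows "flat_frame b B T"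
  unfolding flat_frame_def
proof (intro ballI conjI allI impI)
  fix z assume z: "z \<in> B"
  then have zA: "z \<in> A" using assms(2) by blast
  show "bij_betw (T z) (fibre (b z)) (topspace (cm_top Y))" using flat_frame_bij[OF assms(1) zA] .
  show "hcurve D Y (\<lambda>u. T z (c u))" if "hcurve D E c" "c ` D \<subseteq> fibre (b z)" for D c
    using flat_frame_curve[OF assms(1) zA that] .
  show "hcurve D E (\<lambda>u. inv_into (fibre (b z)) (T z) (c u))" if "hcurve D Y c" for D c
    using flat_frame_inverse_curve[OF assms(1) zA that] .
  show "\<exists>N. open N \<and> z \<in> N \<and> b ` N \<subseteq> U \<and>
      (\<forall>w\<in>N \<inter> B. \<forall>y\<in>topspace (cm_top Y). T w (\<theta>i (b w, y)) = T z (\<theta>i (b z, y)))"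
    if U: "trivialization U \<theta> \<theta>i" "b z \<in> U" for U \<theta> \<theta>i
  proof -
    obtain N where N: "open N" "z \<in> N" "b ` N \<subseteq> U"
      "\<And>w y. w \<in> N \<Longrightarrow> w \<in> A \<Longrightarrow> y \<in> topspace (cm_top Y) \<Longrightarrow> T w (\<theta>i (b w, y)) = T z (\<theta>i (b z, y))"
      using flat_frame_local[OF assms(1) zA U] by blast
    then show ?thesis using assms(2) by (intro exI[of _ N]) auto
  qed
qed

text \<open>Local constancy need only be checked in one trivialization around each point: by
  \<open>transition_constant\<close>, a section horizontal for one trivialization is, over a small
  disc, horizontal for every other.\<close>

lemma flat_frameI:
  assumes b: "hcurve UNIV X b"
    and bij: "\<And>z. z \<in> A \<Longrightarrow> bij_betw (T z) (fibre (b z)) (topspace (cm_top Y))"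
    and c1: "\<And>z D c. z \<in> A \<Longrightarrow> hcurve D E c \<Longrightarrow> c ` D \<subseteq> fibre (b z) \<Longrightarrow> hcurve D Y (\<lambda>u. T z (c u))"
    and c2: "\<And>z D c. z \<in> A \<Longrightarrow> hcurve D Y c \<Longrightarrow> hcurve D E (\<lambda>u. inv_into (fibre (b z)) (T z) (c u))"
    and loc: "\<And>z. z \<in> A \<Longrightarrow> \<exists>U \<theta> \<theta>i N. trivialization U \<theta> \<theta>i \<and> open N \<and> z \<in> N \<and> b ` N \<subseteq> U \<and>
      (\<forall>w\<in>N \<inter> A. \<forall>y\<in>topspace (cm_top Y). T w (\<theta>i (b w, y)) = T z (\<theta>i (b z, y)))"
  shows "flat_frame b A T"
  unfolding flat_frame_def
proof (intro ballI conjI allI impI)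
  fix z V \<eta> \<eta>i assume z: "z \<in> A" and V: "trivialization V \<eta> \<eta>i" "b z \<in> V"
  from loc[OF z] obtain U \<theta> \<theta>i N where *: "trivialization U \<theta> \<theta>i \<and> open N \<and> z \<in> N \<and> b ` N \<subseteq> U \<and>
      (\<forall>w\<in>N \<inter> A. \<forall>y\<in>topspace (cm_top Y). T w (\<theta>i (b w, y)) = T z (\<theta>i (b z, y)))"
    by (elim exE) (rule that)
  then have U: "trivialization U \<theta> \<theta>i" and N: "open N" "z \<in> N" "b ` N \<subseteq> U"
    and T: "\<And>w y. w \<in> N \<Longrightarrow> w \<in> A \<Longrightarrow> y \<in> topspace (cm_top Y) \<Longrightarrow> T w (\<theta>i (b w, y)) = T z (\<theta>i (b z, y))"
    by simp_all
  have "open (b -` V)" using hcurve_open_preimage[OF b trivialization_open[OF V(1)]] by simp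
  then have "open (N \<inter> b -` V)" "z \<in> N \<inter> b -` V" using N V by auto
  then obtain e where e: "e > 0" "ball z e \<subseteq> N \<inter> b -` V"
    using open_contains_ball by blast
  have be: "b w \<in> V \<inter> U" if "w \<in> ball z e" for w using e(2) N(3) that by blast
  have "T w (\<eta>i (b w, y)) = T z (\<eta>i (b z, y))"
    if w: "w \<in> ball z e" "w \<in> A" and y: "y \<in> topspace (cm_top Y)" for w y
  proof -
    have zz: "z \<in> ball z e" using e by simp
    \<comment> \<open>The \<open>\<theta>\<close>-coordinate of the \<open>\<eta>\<close>-horizontal
      section with value \<open>y\<close>; as transition maps are constant, it is the same over the
      whole ball.\<close>
    define y1 where "y1 = snd (\<theta> (\<eta>i (b z, y)))"
    have *: "\<eta>i (b v, y) = \<theta>i (b v, y1)" if v: "v \<in> ball z e" for v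
    proof -
      have bv: "b v \<in> V" "b v \<in> U" using be[OF v] by auto
      have "snd (\<theta> (\<eta>i (b v, y))) = y1"
        unfolding y1_def
        by (rule transition_constant[OF V(1) U hcurve_subset[OF b, of "ball z e"] be _ y v zz]) auto
      then show ?thesis
        using trivialization_inverse[OF U bv(2) trivialization_fibre[OF V(1) bv(1) y]] by simp
    qed
    have "y1 \<in> topspace (cm_top Y)"
      unfolding y1_def
      using trivialization_fibre_snd[OF U _ trivialization_fibre[OF V(1,2) y]] be[OF zz] by blast
    then show ?thesis using T[of w y1] e(2) w *[OF w(1)] *[OF zz] by auto
  qed
  then show "\<exists>N. open N \<and> z \<in> N \<and> b ` N \<subseteq> V \<and>
      (\<forall>w\<in>N \<inter> A. \<forall>y\<in>topspace (cm_top Y). T w (\<eta>i (b w, y)) = T z (\<eta>i (b z, y)))"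
    using e(1) be by (intro exI[of _ "ball z e"]) auto
qed (use bij c1 c2 in auto)

lemma flat_frame_trivialization:
  assumes b: "hcurve UNIV X b" and U: "trivialization U \<theta> \<theta>i" and A: "b ` A \<subseteq> U"
  shows "flat_frame b A (\<lambda>z e. snd (\<theta> e))"
proof (rule flat_frameI[OF b])
  fix z assume z: "z \<in> A"
  then have bz: "b z \<in> U" using A by blast
  show bij: "bij_betw (\<lambda>e. snd (\<theta> e)) (fibre (b z)) (topspace (cm_top Y))"
    by (rule bij_betw_byWitness[where f' = "\<lambda>y. \<theta>i (b z, y)"])
       (use trivialization_inverse[OF U bz] trivialization_snd_inverse[OF U bz]
         trivialization_fibre_snd[OF U bz] trivialization_fibre[OF U bz] in auto)
  show "hcurve D Y (\<lambda>u. snd (\<theta> (c u)))" if "hcurve D E c" "c ` D \<subseteq> fibre (b z)" for D c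
    by (rule hcurve_trivialization[OF U that(1)]) (use that(2) bz in \<open>auto simp: fibre_def\<close>)
  show "hcurve D E (\<lambda>u. inv_into (fibre (b z)) (\<lambda>e. snd (\<theta> e)) (c u))" if c: "hcurve D Y c" for D c
  proof -
    have "hcurve D X (\<lambda>_. b z)"
      using hcurve_const[OF hcurve_in_topspace[OF b] hcurve_open[OF c]] by simp
    then have "hcurve D E (\<lambda>u. \<theta>i (b z, c u))"
      by (rule hcurve_trivialization_inverse[OF U _ _ c]) (use bz in simp)
    then show ?thesis
    proof (rule hcurve_cong)
      fix u assume "u \<in> D"
      then have y: "c u \<in> topspace (cm_top Y)" using hcurve_in_topspace[OF c] by blast
      have "inv_into (fibre (b z)) (\<lambda>e. snd (\<theta> e)) (snd (\<theta> (\<theta>i (b z, c u)))) = \<theta>i (b z, c u)"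
        by (rule inv_into_f_f[OF bij_betw_imp_inj_on[OF bij] trivialization_fibre[OF U bz y]])
      then show "\<theta>i (b z, c u) = inv_into (fibre (b z)) (\<lambda>e. snd (\<theta> e)) (c u)"
        by (simp add: trivialization_snd_inverse[OF U bz y])
    qed
  qed
  have "open (b -` U)" using hcurve_open_preimage[OF b trivialization_open[OF U]] by simp
  then show "\<exists>U \<eta> \<theta>i N. trivialization U \<eta> \<theta>i \<and> open N \<and> z \<in> N \<and> b ` N \<subseteq> U \<and>
      (\<forall>w\<in>N \<inter> A. \<forall>y\<in>topspace (cm_top Y). snd (\<theta> (\<theta>i (b w, y))) = snd (\<theta> (\<theta>i (b z, y))))"
    using U bz A trivialization_snd_inverse[OF U]
    by (intro exI[of _ U] exI[of _ \<theta>] exI[of _ \<theta>i] exI[of _ "b -` U"]) auto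
qed

text \<open>Composition with the automorphism \<open>\<gamma>\<close> of \<open>Y\<close> that
  compares the two frames over \<open>z0\<close>. As \<open>\<gamma>\<close> does not depend on
  \<open>z\<close>, the frame remains constant along horizontal sections. \<open>S\<close> acts as
  an initial value, hence is a frame over one point.\<close>

lemma flat_frame_change:
  assumes b: "hcurve UNIV X b" and T: "flat_frame b A T" and z0: "z0 \<in> A"
    and S: "flat_frame b {z0} S"
  obtains T' where "flat_frame b A T'" "\<And>e. e \<in> fibre (b z0) \<Longrightarrow> T' z0 e = S z0 e"
proof -
  let ?Y = "topspace (cm_top Y)" and ?F = "fibre (b z0)"
  define \<gamma> where "\<gamma> y = S z0 (inv_into ?F (T z0) y)" for y
  define \<delta> where "\<delta> y = T z0 (inv_into ?F (S z0) y)" for y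
  note bT = flat_frame_bij[OF T z0]
  have bS: "bij_betw (S z0) ?F ?Y" using flat_frame_bij[OF S] by simp
  have inF: "inv_into ?F (T z0) y \<in> ?F" "inv_into ?F (S z0) y \<in> ?F" if "y \<in> ?Y" for y
    using that bij_betwE[OF bij_betw_inv_into[OF bT]] bij_betwE[OF bij_betw_inv_into[OF bS]] by auto
  have \<gamma>\<delta>: "\<gamma> (\<delta> y) = y" "\<delta> (\<gamma> y) = y" "\<gamma> y \<in> ?Y" "\<delta> y \<in> ?Y" if "y \<in> ?Y" for y
    using that inF[OF that] bT bS
    by (auto simp: \<gamma>_def \<delta>_def bij_betw_inv_into_left bij_betw_inv_into_right bij_betw_apply)
  have \<gamma>bij: "bij_betw \<gamma> ?Y ?Y"
    by (rule bij_betw_byWitness[where f' = \<delta>]) (use \<gamma>\<delta> in auto)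
  have \<gamma>curve: "hcurve D Y (\<lambda>u. \<gamma> (c u))" if c: "hcurve D Y c" for D c
    unfolding \<gamma>_def
    by (rule flat_frame_curve[OF S _ flat_frame_inverse_curve[OF T z0 c]])
       (use inF hcurve_in_topspace[OF c] in auto)
  have \<delta>curve: "hcurve D Y (\<lambda>u. \<delta> (c u))" if c: "hcurve D Y c" for D c
    unfolding \<delta>_def
    by (rule flat_frame_curve[OF T z0 flat_frame_inverse_curve[OF S _ c]])
       (use inF hcurve_in_topspace[OF c] in auto)
  define T' where "T' z e = \<gamma> (T z e)" for z e
  have "flat_frame b A T'"
  proof (rule flat_frameI[OF b])
    fix z assume z: "z \<in> A"
    note bz = flat_frame_bij[OF T z]
    have "bij_betw (\<gamma> \<circ> T z) (fibre (b z)) ?Y" by (rule bij_betw_trans[OF bz \<gamma>bij])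
    then show bz': "bij_betw (T' z) (fibre (b z)) ?Y" by (simp add: T'_def[abs_def] o_def)
    show "hcurve D Y (\<lambda>u. T' z (c u))" if "hcurve D E c" "c ` D \<subseteq> fibre (b z)" for D c
      unfolding T'_def by (rule \<gamma>curve[OF flat_frame_curve[OF T z that]])
    show "hcurve D E (\<lambda>u. inv_into (fibre (b z)) (T' z) (c u))" if c: "hcurve D Y c" for D c
      using flat_frame_inverse_curve[OF T z \<delta>curve[OF c]]
    proof (rule hcurve_cong)
      fix u assume "u \<in> D"
      then have y: "c u \<in> ?Y" using hcurve_in_topspace[OF c] by blast
      define e where "e = inv_into (fibre (b z)) (T z) (\<delta> (c u))"
      have e: "e \<in> fibre (b z)" "T z e = \<delta> (c u)"
        unfolding e_def using bij_betwE[OF bij_betw_inv_into[OF bz]] bij_betw_inv_into_right[OF bz] \<gamma>\<delta>(4)[OF y]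
        by auto
      then have "T' z e = c u" using \<gamma>\<delta>(1)[OF y] by (simp add: T'_def)
      then show "inv_into (fibre (b z)) (T z) (\<delta> (c u)) = inv_into (fibre (b z)) (T' z) (c u)"
        using bij_betw_inv_into_left[OF bz' e(1)] by (simp add: e_def)
    qed
    have "b z \<in> topspace (cm_top X)" using hcurve_in_topspace[OF b] by simp
    then obtain U \<theta> \<theta>i where U: "b z \<in> U" "trivialization U \<theta> \<theta>i"
      using trivialization_exists by metis
    obtain N where "open N" "z \<in> N" "b ` N \<subseteq> U"
      "\<And>w y. w \<in> N \<Longrightarrow> w \<in> A \<Longrightarrow> y \<in> ?Y \<Longrightarrow> T w (\<theta>i (b w, y)) = T z (\<theta>i (b z, y))"
      using flat_frame_local[OF T z U(2,1)] by blast
    then show "\<exists>U \<theta> \<theta>i N. trivialization U \<theta> \<theta>i \<and> open N \<and> z \<in> N \<and> b ` N \<subseteq> U \<and>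
      (\<forall>w\<in>N \<inter> A. \<forall>y\<in>?Y. T' w (\<theta>i (b w, y)) = T' z (\<theta>i (b z, y)))"
      using U(2) by (intro exI[of _ U] exI[of _ \<theta>] exI[of _ \<theta>i] exI[of _ N]) (auto simp: T'_def)
  qed
  moreover have "T' z0 e = S z0 e" if "e \<in> ?F" for e
    using bij_betw_inv_into_left[OF bT that] by (simp add: T'_def \<gamma>_def)
  ultimately show thesis by (rule that)
qed

text \<open>In a trivialization both frames are locally constant, so agreement over one fibre is
  equivalent to agreement over nearby fibres, and connectedness propagates it. \<open>A\<close> may
  be a disc, a closed rectangle or a mere edge, so neighbourhoods are taken within
  \<open>A\<close>.\<close>

lemma flat_frame_unique:
  assumes b: "hcurve UNIV X b" and T: "flat_frame b A T" and S: "flat_frame b A S" and A: "connected A"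
    and z0: "z0 \<in> A" "\<And>e. e \<in> fibre (b z0) \<Longrightarrow> T z0 e = S z0 e"
    and z: "z \<in> A" "e \<in> fibre (b z)"
  shows "T z e = S z e"
proof -
  let ?P = "\<lambda>z. \<forall>e\<in>fibre (b z). T z e = S z e"
  have "?P z0 = ?P z"
  proof (rule connected_local_const[OF A z0(1) z(1)], intro ballI)
    fix v assume v: "v \<in> A"
    have "b v \<in> topspace (cm_top X)" using hcurve_in_topspace[OF b] by simp
    then obtain U \<theta> \<theta>i where U: "b v \<in> U" "trivialization U \<theta> \<theta>i"
      using trivialization_exists by metis
    obtain N where N: "open N" "v \<in> N" "b ` N \<subseteq> U"
      "\<And>w y. w \<in> N \<Longrightarrow> w \<in> A \<Longrightarrow> y \<in> topspace (cm_top Y) \<Longrightarrow> T w (\<theta>i (b w, y)) = T v (\<theta>i (b v, y))"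
      using flat_frame_local[OF T v U(2,1)] by blast
    obtain N' where N': "open N'" "v \<in> N'" "b ` N' \<subseteq> U"
      "\<And>w y. w \<in> N' \<Longrightarrow> w \<in> A \<Longrightarrow> y \<in> topspace (cm_top Y) \<Longrightarrow> S w (\<theta>i (b w, y)) = S v (\<theta>i (b v, y))"
      using flat_frame_local[OF S v U(2,1)] by blast
    have P: "?P w \<longleftrightarrow> (\<forall>y\<in>topspace (cm_top Y). T w (\<theta>i (b w, y)) = S w (\<theta>i (b w, y)))"
      if bw: "b w \<in> U" for w
    proof (intro iffI ballI)
      fix e assume eq: "\<forall>y\<in>topspace (cm_top Y). T w (\<theta>i (b w, y)) = S w (\<theta>i (b w, y))"
        and e: "e \<in> fibre (b w)"
      from bspec[OF eq trivialization_fibre_snd[OF U(2) bw e]]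
      show "T w e = S w e" by (simp only: trivialization_inverse[OF U(2) bw e])
    qed (use trivialization_fibre[OF U(2) bw] in blast)
    have PP: "?P v = ?P w" if w: "w \<in> N \<inter> N'" "w \<in> A" for w
    proof -
      have "b w \<in> U" using N(3) w(1) by blast
      then show ?thesis using P[of w] P[OF U(1)] N(4) N'(4) w by simp
    qed
    have "eventually (\<lambda>w. w \<in> N \<inter> N') (at v within A)"
      unfolding eventually_at_topological using N(1,2) N'(1,2) by (intro exI[of _ "N \<inter> N'"]) auto
    moreover have "eventually (\<lambda>w. w \<in> A) (at v within A)" by (simp add: eventually_at_filter)
    ultimately show "eventually (\<lambda>w. ?P v = ?P w) (at v within A)"
      by eventually_elim (rule PP)
  qed
  then show ?thesis using z0(2) z(2) by blast
qed

text \<open>\<open>S\<close> is adjusted to agree with \<open>T\<close> over one common point;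
  uniqueness on the connected intersection then makes them agree over all of it. A disconnected
  intersection could produce monodromy.\<close>

lemma flat_frame_Un:
  assumes b: "hcurve UNIV X b" and T: "flat_frame b A T" and S: "flat_frame b B S"
    and AB: "closed A" "closed B" "connected (A \<inter> B)" "A \<inter> B \<noteq> {}"
  shows "\<exists>R. flat_frame b (A \<union> B) R"
proof -
  obtain z0 where z0: "z0 \<in> A" "z0 \<in> B" using AB by blast
  obtain S' where S': "flat_frame b B S'" and S'z0: "\<And>e. e \<in> fibre (b z0) \<Longrightarrow> S' z0 e = T z0 e"
    by (rule flat_frame_change[OF b S z0(2) flat_frame_subset[OF T, of "{z0}"]]) (use z0 in auto)
  have eq: "S' z e = T z e" if z: "z \<in> A" "z \<in> B" "e \<in> fibre (b z)" for z e
    by (rule flat_frame_unique[OF b flat_frame_subset[OF S'] flat_frame_subset[OF T] AB(3) _ S'z0 _ z(3)])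
       (use z0 z in simp_all)
  define R where "R z = (if z \<in> A then T z else S' z)" for z
  have "flat_frame b (A \<union> B) R"
  proof (rule flat_frameI[OF b])
    fix z assume z: "z \<in> A \<union> B"
    show "bij_betw (R z) (fibre (b z)) (topspace (cm_top Y))"
      using z flat_frame_bij[OF T] flat_frame_bij[OF S'] by (auto simp: R_def)
    show "hcurve D Y (\<lambda>u. R z (c u))" if "hcurve D E c" "c ` D \<subseteq> fibre (b z)" for D c
      using z flat_frame_curve[OF T _ that] flat_frame_curve[OF S' _ that] by (auto simp: R_def)
    show "hcurve D E (\<lambda>u. inv_into (fibre (b z)) (R z) (c u))" if "hcurve D Y c" for D c
      using z flat_frame_inverse_curve[OF T _ that] flat_frame_inverse_curve[OF S' _ that]
      by (auto simp: R_def)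
    have "b z \<in> topspace (cm_top X)" using hcurve_in_topspace[OF b] by simp
    then obtain U \<theta> \<theta>i where U: "b z \<in> U" "trivialization U \<theta> \<theta>i"
      using trivialization_exists by metis
    \<comment> \<open>Closedness settles the points outside \<open>C\<close>: a neighbourhood
      avoiding \<open>C\<close> makes the condition void. The neighbourhoods obtained for
      \<open>A\<close> and for \<open>B\<close> are then intersected.\<close>
    have nbhd: "\<exists>N. open N \<and> z \<in> N \<and> b ` N \<subseteq> U \<and>
        (\<forall>w\<in>N \<inter> C. \<forall>y\<in>topspace (cm_top Y). R w (\<theta>i (b w, y)) = R z (\<theta>i (b z, y)))"
      if F: "flat_frame b C F" "closed C" and FR: "\<And>w e. w \<in> C \<Longrightarrow> e \<in> fibre (b w) \<Longrightarrow> F w e = R w e" for F C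
    proof (cases "z \<in> C")
      case True
      obtain N where N: "open N" "z \<in> N" "b ` N \<subseteq> U"
        "\<And>w y. w \<in> N \<Longrightarrow> w \<in> C \<Longrightarrow> y \<in> topspace (cm_top Y) \<Longrightarrow> F w (\<theta>i (b w, y)) = F z (\<theta>i (b z, y))"
        using flat_frame_local[OF F(1) True U(2,1)] by blast
      have "R w (\<theta>i (b w, y)) = R z (\<theta>i (b z, y))"
        if w: "w \<in> N" "w \<in> C" "y \<in> topspace (cm_top Y)" for w y
      proof -
        have "b w \<in> U" using N(3) w by blast
        then show ?thesis
          using N(4)[OF w] FR[OF w(2)] FR[OF True] trivialization_fibre[OF U(2) _ w(3)] U(1) by metis
      qed
      then show ?thesis using N by (intro exI[of _ N]) auto
    next
      case False
      have "open (b -` U)" using hcurve_open_preimage[OF b trivialization_open[OF U(2)]] by simp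
      then show ?thesis using False F(2) U(1) by (intro exI[of _ "b -` U - C"]) auto
    qed
    obtain N1 where N1: "open N1" "z \<in> N1" "b ` N1 \<subseteq> U"
        "\<And>w y. w \<in> N1 \<Longrightarrow> w \<in> A \<Longrightarrow> y \<in> topspace (cm_top Y) \<Longrightarrow> R w (\<theta>i (b w, y)) = R z (\<theta>i (b z, y))"
      using nbhd[OF T AB(1)] by (auto simp: R_def)
    obtain N2 where N2: "open N2" "z \<in> N2" "b ` N2 \<subseteq> U"
        "\<And>w y. w \<in> N2 \<Longrightarrow> w \<in> B \<Longrightarrow> y \<in> topspace (cm_top Y) \<Longrightarrow> R w (\<theta>i (b w, y)) = R z (\<theta>i (b z, y))"
    proof -
      have "S' w e = R w e" if "w \<in> B" "e \<in> fibre (b w)" for w e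
        using eq[of w e] that by (simp add: R_def)
      from nbhd[OF S' AB(2) this] that show thesis by blast
    qed
    show "\<exists>U \<theta> \<theta>i N. trivialization U \<theta> \<theta>i \<and> open N \<and> z \<in> N \<and> b ` N \<subseteq> U \<and>
      (\<forall>w\<in>N \<inter> (A \<union> B). \<forall>y\<in>topspace (cm_top Y). R w (\<theta>i (b w, y)) = R z (\<theta>i (b z, y)))"
      using U(2) N1 N2
      by (intro exI[of _ U] exI[of _ \<theta>] exI[of _ \<theta>i] exI[of _ "N1 \<inter> N2"]) auto
  qed
  then show ?thesis by blast
qed

lemma flat_frame_rect:
  assumes b: "hcurve UNIV X b" and "s \<le> t" "s' \<le> t'"
  shows "\<exists>T. flat_frame b (rect s t s' t') T"
  using _ _ assms(2,3)
proof (rule rectangle_induct[where P = "\<lambda>A. \<exists>T. flat_frame b A T"])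
  show "\<exists>T. flat_frame b (A \<union> B) T"
    if "\<exists>T. flat_frame b A T" "\<exists>T. flat_frame b B T" "closed A" "closed B" "connected (A \<inter> B)" "A \<inter> B \<noteq> {}"
    for A B
    using that flat_frame_Un[OF b] by blast
  fix z
  have "b z \<in> topspace (cm_top X)" using hcurve_in_topspace[OF b] by simp
  then obtain U \<theta> \<theta>i where U: "b z \<in> U" "trivialization U \<theta> \<theta>i"
    using trivialization_exists by metis
  have "open (b -` U)" using hcurve_open_preimage[OF b trivialization_open[OF U(2)]] by simp
  then obtain e where "e > 0" "ball z e \<subseteq> b -` U" using U(1) open_contains_ball by blast
  then show "\<exists>e>0. \<forall>A. A \<subseteq> ball z e \<longrightarrow> (\<exists>T. flat_frame b A T)"
    using flat_frame_trivialization[OF b U(2)] by (intro exI[of _ e]) blast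
qed

text \<open>Near \<open>z\<close> the value \<open>T w (f w)\<close> is \<open>T z\<close> applied
  to the parallel transport of \<open>f w\<close> into the fibre over \<open>b z\<close>. The
  transported points form a holomorphic curve in one fibre, where \<open>T z\<close> preserves
  holomorphy.\<close>

lemma flat_frame_hcurve:
  assumes b: "hcurve UNIV X b" and T: "flat_frame b A T" and D: "D \<subseteq> A"
    and f: "hcurve D E f" "\<And>w. w \<in> D \<Longrightarrow> \<pi> (f w) = b w"
  shows "hcurve D Y (\<lambda>w. T w (f w))"
proof (rule hcurveI_local)
  fix z assume z: "z \<in> D"
  have "b z \<in> topspace (cm_top X)" using hcurve_in_topspace[OF b] by simp
  then obtain U \<theta> \<theta>i where U: "b z \<in> U" "trivialization U \<theta> \<theta>i"
    using trivialization_exists by metis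
  have zA: "z \<in> A" using z D by blast
  obtain N where N: "open N" "z \<in> N" "b ` N \<subseteq> U"
    "\<And>w y. w \<in> N \<Longrightarrow> w \<in> A \<Longrightarrow> y \<in> topspace (cm_top Y) \<Longrightarrow> T w (\<theta>i (b w, y)) = T z (\<theta>i (b z, y))"
    using flat_frame_local[OF T zA U(2,1)] by blast
  have op: "open (N \<inter> D)" using N(1) hcurve_open[OF f(1)] by (rule open_Int)
  have fN: "f w \<in> fibre (b w)" "b w \<in> U" if "w \<in> N \<inter> D" for w
    using that f(2) hcurve_in_topspace[OF f(1)] N(3) by (auto simp: fibre_def)
  have y: "hcurve (N \<inter> D) Y (\<lambda>w. snd (\<theta> (f w)))"
    by (rule hcurve_trivialization[OF U(2) hcurve_subset[OF f(1) _ op]]) (use fN in \<open>auto simp: fibre_def\<close>)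
  have "hcurve (N \<inter> D) X (\<lambda>_. b z)"
    using hcurve_const[OF hcurve_in_topspace[OF b] op] by simp
  then have "hcurve (N \<inter> D) E (\<lambda>w. \<theta>i (b z, snd (\<theta> (f w))))"
    by (rule hcurve_trivialization_inverse[OF U(2) _ _ y]) (use U in simp)
  then have "hcurve (N \<inter> D) Y (\<lambda>w. T z (\<theta>i (b z, snd (\<theta> (f w)))))"
    by (rule flat_frame_curve[OF T zA])
       (use trivialization_fibre[OF U(2,1)] hcurve_in_topspace[OF y] in auto)
  then have "hcurve (N \<inter> D) Y (\<lambda>w. T w (f w))"
  proof (rule hcurve_cong)
    fix w assume w: "w \<in> N \<inter> D"
    have "T w (\<theta>i (b w, snd (\<theta> (f w)))) = T z (\<theta>i (b z, snd (\<theta> (f w))))"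
      using N(4) w D hcurve_in_topspace[OF y w] by blast
    then show "T z (\<theta>i (b z, snd (\<theta> (f w)))) = T w (f w)"
      using trivialization_inverse[OF U(2) fN(2)[OF w] fN(1)[OF w]] by simp
  qed
  then show "\<exists>B. z \<in> B \<and> B \<subseteq> D \<and> hcurve B Y (\<lambda>w. T w (f w))"
    using z N(2) by (intro exI[of _ "N \<inter> D"]) auto
qed

text \<open>The trivialization is compared with the frame along the whole closed unit disc:
  agreement over 0 is carried to 1 through a connected set lying over \<open>U\<close>.\<close>

lemma entire_curve_vertically_constant:
  assumes U: "trivialization U \<theta> \<theta>i" and f: "hcurve UNIV E f"
    and disc: "\<And>z. z \<in> cball 0 1 \<Longrightarrow> \<pi> (f z) \<in> U"
  shows "snd (\<theta> (f 0)) = snd (\<theta> (f 1))"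
proof (rule ccontr)
  assume neq: "snd (\<theta> (f 0)) \<noteq> snd (\<theta> (f 1))"
  define b where "b z = \<pi> (f z)" for z
  have b: "hcurve UNIV X b"
    unfolding b_def using hcurve_compose[OF E_charted X_charted projection f] .
  have f_fibre: "f z \<in> fibre (b z)" for z
    using hcurve_in_topspace[OF f] by (simp add: fibre_def b_def)
  have bU: "b z \<in> U" if "z \<in> cball 0 1" for z using disc[OF that] by (simp add: b_def)
  have 01: "(0::complex) \<in> cball 0 1" "(1::complex) \<in> cball 0 1" by auto
  obtain R where R: "R > 1"
    "\<And>h. hcurve (ball 0 R) Y h \<Longrightarrow> h 0 = snd (\<theta> (f 0)) \<Longrightarrow> h 1 \<noteq> snd (\<theta> (f 1))"
    using hyperbolic_large_discs[OF Y_charted hyperbolic _ _ neq]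
      trivialization_fibre_snd[OF U bU[OF 01(1)] f_fibre] trivialization_fibre_snd[OF U bU[OF 01(2)] f_fibre]
    by metis
  have ball: "ball 0 R \<subseteq> rect (-R) R (-R) R"
  proof
    fix z :: complex assume "z \<in> ball 0 R"
    then show "z \<in> rect (-R) R (-R) R"
      using abs_Re_le_cmod[of z] abs_Im_le_cmod[of z] by (auto simp: rect_def abs_le_iff)
  qed
  have "\<exists>T. flat_frame b (rect (-R) R (-R) R) T" using R by (intro flat_frame_rect[OF b]) auto
  then obtain T0 where "flat_frame b (ball 0 R) T0" using flat_frame_subset[OF _ ball] by blast
  moreover have "flat_frame b (cball 0 1) (\<lambda>z e. snd (\<theta> e))"
    using bU by (intro flat_frame_trivialization[OF b U]) auto
  then have \<theta>: "flat_frame b (cball 0 1) (\<lambda>z e. snd (\<theta> e))" "flat_frame b {0} (\<lambda>z e. snd (\<theta> e))"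
    using flat_frame_subset 01 by auto
  moreover have "(0::complex) \<in> ball 0 R" using R(1) by simp
  \<comment> \<open>Once normalised by \<open>\<theta>\<close> at 0, the frame agrees with
    \<open>\<theta>\<close> over the unit disc, so the curve in \<open>Y\<close> takes the
    prescribed values at 0 and 1.\<close>
  ultimately obtain T where T: "flat_frame b (ball 0 R) T" "\<And>e. e \<in> fibre (b 0) \<Longrightarrow> T 0 e = snd (\<theta> e)"
    by (rule_tac flat_frame_change[OF b _ _ \<theta>(2)]) auto
  have "cball 0 1 \<subseteq> ball (0::complex) R" using R by auto
  then have eq: "T z e = snd (\<theta> e)" if "z \<in> cball 0 1" "e \<in> fibre (b z)" for z e
    using flat_frame_unique[OF b flat_frame_subset[OF T(1)] \<theta>(1) _ 01(1) T(2) that] by simp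
  have "hcurve (ball 0 R) Y (\<lambda>w. T w (f w))"
    by (rule flat_frame_hcurve[OF b T(1) _ hcurve_subset[OF f]]) (auto simp: b_def)
  from R(2)[OF this] show False using eq[OF 01(1) f_fibre] eq[OF 01(2) f_fibre] by simp
qed

end

section \<open>Metrizability of manifolds\<close>

text \<open>Urysohn's embedding into a countable power of the reals, with one coordinate for each pair of
  basic open sets that can be separated.\<close>

lemma completely_regular_second_countable_imp_metrizable:
  assumes X: "completely_regular_space X" "Hausdorff_space X" "second_countable X"
  shows "metrizable_space X"
proof -
  obtain \<B> where \<B>: "countable \<B>" "\<And>V. V \<in> \<B> \<Longrightarrow> openin X V"
    "\<And>U x. openin X U \<Longrightarrow> x \<in> U \<Longrightarrow> \<exists>V\<in>\<B>. x \<in> V \<and> V \<subseteq> U"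
    using X(3) unfolding second_countable_def by metis
  \<comment> \<open>For a pair \<open>(W, V)\<close>: below 1/2 on \<open>W\<close> and equal to 1
    off \<open>V\<close>. A coordinate below 1/2 thus forces a point of the space into
    \<open>V\<close>.\<close>
  define sep where "sep i f \<longleftrightarrow> continuous_map X euclideanreal f \<and> (\<forall>x\<in>fst i. f x < 1/2) \<and>
      (\<forall>x\<in>topspace X - snd i. f x = 1)" for i and f :: "'a \<Rightarrow> real"
  define I where "I = {i \<in> \<B> \<times> \<B>. \<exists>f. sep i f}"
  define F where "F i = (SOME f. sep i f)" for i
  have F: "sep i (F i)" if "i \<in> I" for i
    unfolding F_def using that someI_ex[of "sep i"] by (auto simp: I_def)
  have I: "\<exists>i\<in>I. x \<in> fst i \<and> snd i \<subseteq> U" if U: "openin X U" "x \<in> U" for U x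
  proof -
    obtain V where V: "V \<in> \<B>" "x \<in> V" "V \<subseteq> U" using \<B>(3)[OF U] by blast
    obtain f where f: "continuous_map X euclideanreal f" "f x = 0" "f ` (topspace X - V) \<subseteq> {1}"
      using X(1) \<B>(2)[OF V(1)] V(2) unfolding completely_regular_space_alt' by blast
    have "openin X {z \<in> topspace X. f z \<in> {..<1/2}}"
      by (rule openin_continuous_map_preimage[OF f(1)]) simp
    moreover have "x \<in> {z \<in> topspace X. f z \<in> {..<1/2}}" using f(2) U openin_subset by fastforce
    ultimately obtain W where W: "W \<in> \<B>" "x \<in> W" "W \<subseteq> {z \<in> topspace X. f z \<in> {..<1/2}}"
      using \<B>(3) by blast
    have "sep (W, V) f" using f W(3) by (auto simp: sep_def)
    then show ?thesis using V W by (intro bexI[of _ "(W, V)"]) (auto simp: I_def)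
  qed
  let ?P = "product_topology (\<lambda>i. euclideanreal) I"
  define e where "e x = (\<lambda>i\<in>I. F i x)" for x
  have "countable I" unfolding I_def using \<B>(1) by (intro countable_subset[OF _ countable_SIGMA]) auto
  then have "countable {i \<in> I. \<not> (\<exists>a. topspace euclideanreal \<subseteq> {a})}"
    by (rule countable_subset[rotated]) auto
  then have "metrizable_space ?P"
    unfolding metrizable_space_product_topology using metrizable_space_euclidean by blast
  then have sub: "metrizable_space (subtopology ?P (e ` topspace X))" by (rule metrizable_space_subtopology)
  have "homeomorphic_map X (subtopology ?P (e ` topspace X)) e"
  proof (rule bijective_open_imp_homeomorphic_map)
    show "continuous_map X (subtopology ?P (e ` topspace X)) e"
      using F by (auto simp: continuous_map_in_subtopology continuous_map_componentwise e_def sep_def)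
    show "open_map X (subtopology ?P (e ` topspace X)) e"
      unfolding open_map_def
    proof (intro allI impI)
      fix U assume U: "openin X U"
      define W where "W = (\<Union>i\<in>{i \<in> I. snd i \<subseteq> U}. {g \<in> topspace ?P. g i \<in> {..<1/2}})"
      have "openin ?P {g \<in> topspace ?P. g i \<in> {..<1/2}}" if "i \<in> I" for i
        by (rule openin_continuous_map_preimage[OF continuous_map_product_projection[OF that]]) simp
      then have "openin ?P W" unfolding W_def by (intro openin_Union) blast
      moreover have "e ` U = W \<inter> e ` topspace X"
      proof (intro equalityI subsetI)
        fix g assume "g \<in> e ` U"
        then obtain x where x: "x \<in> U" "g = e x" by blast
        obtain i where i: "i \<in> I" "x \<in> fst i" "snd i \<subseteq> U" using I[OF U x(1)] by blast
        then have "g \<in> {g \<in> topspace ?P. g i \<in> {..<1/2}}"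
          using F[OF i(1)] x by (auto simp: e_def sep_def)
        then have "g \<in> W" unfolding W_def using i by blast
        then show "g \<in> W \<inter> e ` topspace X" using x openin_subset[OF U] by blast
      next
        fix g assume "g \<in> W \<inter> e ` topspace X"
        then obtain x i where "x \<in> topspace X" "g = e x" "i \<in> I" "snd i \<subseteq> U" "e x i < 1/2"
          by (auto simp: W_def)
        then show "g \<in> e ` U" using F[of i] by (force simp: e_def sep_def)
      qed
      ultimately show "openin (subtopology ?P (e ` topspace X)) (e ` U)"
        unfolding openin_subtopology by blast
    qed
    show "e ` topspace X = topspace (subtopology ?P (e ` topspace X))"
      by (auto simp: e_def)
    show "inj_on e (topspace X)"
    proof (rule inj_onI, rule ccontr)
      fix x y assume xy: "x \<in> topspace X" "y \<in> topspace X" "e x = e y" "x \<noteq> y"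
      have "openin X (topspace X - {y})"
        using xy(2) closedin_Hausdorff_singleton[OF X(2)] by blast
      then obtain i where i: "i \<in> I" "x \<in> fst i" "snd i \<subseteq> topspace X - {y}" using I[of _ x] xy by blast
      then have "F i x < 1/2" "F i y = 1" using F[OF i(1)] xy by (auto simp: sep_def)
      moreover have "F i x = F i y" using fun_cong[OF xy(3), of i] i(1) by (simp add: e_def)
      ultimately show False by simp
    qed
  qed
  then have "X homeomorphic_space subtopology ?P (e ` topspace X)"
    by (rule homeomorphic_map_imp_homeomorphic_space)
  then show ?thesis using sub homeomorphic_metrizable_space by blast
qed

lemma complex_manifold_locally_compact:
  assumes M: "complex_manifold M"
  shows "locally_compact_space (cm_top M)"
  unfolding locally_compact_space_def
proof
  fix p assume "p \<in> topspace (cm_top M)"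
  note Mc = complex_manifold_charted[OF M]
  obtain V \<psi> where V: "(V, \<psi>) \<in> cm_charts M" "p \<in> V"
    using charted_cover[OF Mc \<open>p \<in> topspace (cm_top M)\<close>] .
  note ch = charted_chart[OF Mc V(1)]
  let ?n = "cm_dim M"
  obtain \<rho> where \<rho>: "\<rho> > 0" "\<And>w. w \<in> affine_space ?n \<Longrightarrow> adist ?n w (\<psi> p) \<le> \<rho> \<Longrightarrow> w \<in> \<psi> ` V"
    using adist_cball_subset[OF chart_homeomorphic(1)[OF M V(1)], of "\<psi> p"] V by blast
  let ?B = "{w \<in> affine_space ?n. adist ?n w (\<psi> p) \<le> \<rho>}"
  have "compactin (cm_top M) (inv_into V \<psi> ` ?B)"
    using \<rho>(2) by (intro chart_inverse_compactin[OF M V(1) compact_adist_cball]) auto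
  moreover have "{q \<in> V. adist ?n (\<psi> q) (\<psi> p) < \<rho>} \<subseteq> inv_into V \<psi> ` ?B"
  proof
    fix q assume q: "q \<in> {q \<in> V. adist ?n (\<psi> q) (\<psi> p) < \<rho>}"
    then have "\<psi> q \<in> ?B" using ch(3) by auto
    then have "inv_into V \<psi> (\<psi> q) \<in> inv_into V \<psi> ` ?B" by (rule imageI)
    moreover have "inv_into V \<psi> (\<psi> q) = q" using q inv_into_f_f[OF ch(2)] by blast
    ultimately show "q \<in> inv_into V \<psi> ` ?B" by simp
  qed
  moreover have "p \<in> {q \<in> V. adist ?n (\<psi> q) (\<psi> p) < \<rho>}" using V \<rho>(1) by simp
  ultimately show "\<exists>U K. openin (cm_top M) U \<and> compactin (cm_top M) K \<and> p \<in> U \<and> U \<subseteq> K"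
    using openin_chart_ball[OF M V(1)] by blast
qed

text \<open>The Oka property speaks of metrics inducing the topology, so one has to be produced
  before it can be applied. Local compactness gives regularity, and the countable base then gives
  normality through the Lindelof property.\<close>

lemma complex_manifold_metrizable:
  assumes M: "complex_manifold M"
  obtains d where "Metric_space (topspace (cm_top M)) d"
    "Metric_space.mtopology (topspace (cm_top M)) d = cm_top M"
proof -
  have H: "Hausdorff_space (cm_top M)" "second_countable (cm_top M)"
    using M by (auto simp: complex_manifold_def)
  then have "regular_space (cm_top M)"
    using locally_compact_Hausdorff_imp_regular_space complex_manifold_locally_compact[OF M] by blast
  then have "normal_space (cm_top M)"
    using H regular_Lindelof_imp_normal_space second_countable_imp_Lindelof_space by blast
  then have "completely_regular_space (cm_top M)"
    using H normal_imp_completely_regular_space by blast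
  then have "metrizable_space (cm_top M)"
    using H completely_regular_second_countable_imp_metrizable by blast
  then obtain S d where "Metric_space S d" "cm_top M = Metric_space.mtopology S d"
    unfolding metrizable_space_def by blast
  moreover from this have "topspace (cm_top M) = S" by (metis Metric_space.topspace_mtopology)
  ultimately show thesis using that by metis
qed

section \<open>The complex line as a Stein manifold\<close>

text \<open>The complex line, realised in the type over which the Stein manifolds in
  \<open>oka_manifold\<close> range.\<close>

definition line_space :: "(nat \<Rightarrow> complex) cmanifold" where
  "line_space = \<lparr>cm_top = top_of_set (affine_space 1), cm_dim = 1, cm_charts = {(affine_space 1, \<lambda>z. z)}\<rparr>"

lemma line_space_simps:
  "cm_top line_space = top_of_set (affine_space (Suc 0))" "cm_dim line_space = Suc 0"
  "cm_charts line_space = {(affine_space (Suc 0), \<lambda>z. z)}"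
  by (simp_all add: line_space_def)

lemma range_line_embed: "range line_embed = affine_space (Suc 0)"
proof (intro equalityI subsetI)
  fix w assume "w \<in> affine_space (Suc 0)"
  then show "w \<in> range line_embed" by (intro image_eqI[of _ _ "w 0"]) simp_all
qed auto

lemma continuous_line_embed: "continuous_on S line_embed"
  unfolding line_embed_def
proof (rule continuous_on_coordinatewise_then_product)
  show "continuous_on S (\<lambda>z. if i = 0 then z else 0 :: complex)" for i :: nat
    by (cases "i = 0") simp_all
qed

lemma holomorphic_map_line_space:
  assumes c: "hcurve B N c" and N: "charted N"
  shows "holomorphic_map (open_submanifold line_space (line_embed ` B)) N (\<lambda>w. c (w 0))"
proof -
  have sub: "line_embed ` B \<subseteq> affine_space (Suc 0)" by auto
  have "continuous_on (line_embed ` B) (\<lambda>w. w 0 :: complex)" by (rule continuous_coordinate)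
  then have "continuous_map (top_of_set (line_embed ` B)) (top_of_set B) (\<lambda>w. w 0)"
    by (auto simp: image_subset_iff_funcset[symmetric])
  from continuous_map_compose[OF this, of "cm_top N" c] c
  have cont: "continuous_map (top_of_set (line_embed ` B)) (cm_top N) (\<lambda>w. c (w 0))"
    by (simp add: hcurve_def o_def)
  have "holomorphic_in 1 (affine_space (Suc 0) \<inter> line_embed ` B \<inter> (\<lambda>w. c (w 0)) -` V)
     (\<lambda>z. \<psi> (c (inv_into (affine_space (Suc 0) \<inter> line_embed ` B) (\<lambda>z. z) z 0)) j)"
    if V: "(V, \<psi>) \<in> cm_charts N" "j < cm_dim N" for V \<psi> j
  proof -
    have "open (B \<inter> c -` V)" using charted_chart[OF N V(1)] hcurve_open_preimage[OF c] by blast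
    moreover have "affine_space (Suc 0) \<inter> line_embed ` B \<inter> (\<lambda>w. c (w 0)) -` V = line_embed ` (B \<inter> c -` V)"
      by auto
    moreover have "inv_into (affine_space (Suc 0) \<inter> line_embed ` B) (\<lambda>z. z) (line_embed z) 0 = z"
      if "z \<in> B" for z
      using that inv_into_f_f[of "\<lambda>z. z" "affine_space (Suc 0) \<inter> line_embed ` B" "line_embed z"] by simp
    ultimately show ?thesis
      using holomorphic_in_line[OF hcurve_chart_holomorphic[OF c V]] by simp
  qed
  then show ?thesis
    using cont sub
    by (auto simp: holomorphic_map_def open_submanifold_def line_space_simps subtopology_subtopology Int_absorb1)
qed

lemma open_submanifold_line_space [simp]: "open_submanifold line_space (affine_space (Suc 0)) = line_space"
  by (simp add: open_submanifold_def line_space_def subtopology_subtopology)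

lemma second_countable_euclidean: "second_countable (euclidean :: 'a::second_countable_topology topology)"
proof -
  obtain \<B> :: "'a set set" where \<B>: "countable \<B>" "\<And>C. C \<in> \<B> \<Longrightarrow> open C"
    "\<And>S. open S \<Longrightarrow> \<exists>U. U \<subseteq> \<B> \<and> S = \<Union>U"
    using univ_second_countable by blast
  have "\<exists>V\<in>\<B>. x \<in> V \<and> V \<subseteq> U" if "open U" "x \<in> U" for U x
    using \<B>(3)[OF that(1)] that(2) by blast
  then show ?thesis unfolding second_countable_def using \<B>(1,2) by (intro exI[of _ \<B>]) auto
qed

lemma complex_manifold_line_space: "complex_manifold line_space"
proof -
  have "holomorphic_in (Suc 0) (affine_space (Suc 0)) (\<lambda>z. inv_into (affine_space (Suc 0)) (\<lambda>z. z) z 0)"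
    using holomorphic_in_line[of "\<lambda>z. z" UNIV "\<lambda>z. inv_into (affine_space (Suc 0)) (\<lambda>z. z) z 0"]
      inv_into_f_f[of "\<lambda>z. z" "affine_space (Suc 0)"]
    by (auto simp: range_line_embed intro!: holomorphic_intros)
  moreover have "affine_space (Suc 0) \<noteq> {}" using line_embed_in_affine by blast
  moreover have "homeomorphic_map (top_of_set (affine_space (Suc 0))) (top_of_set (affine_space (Suc 0))) (\<lambda>z. z)"
    using homeomorphic_map_id[of "top_of_set (affine_space (Suc 0))" "top_of_set (affine_space (Suc 0))"]
    by (simp add: id_def)
  ultimately show ?thesis
    unfolding complex_manifold_def line_space_simps
    using second_countable_subtopology[OF second_countable_euclidean]
    by (auto simp: Hausdorff_space_subtopology subtopology_subtopology)
qed

lemma hcurve_line_embed: "hcurve UNIV line_space line_embed"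
  using continuous_line_embed[of UNIV]
  by (auto simp: hcurve_def line_space_simps continuous_map_in_subtopology)

lemma charted_complex_line: "charted complex_line"
  by (auto simp: charted_def complex_line_def inj_on_def affine_space_def dest: fun_cong[of _ _ 0])

lemma hcurve_complex_line: "f holomorphic_on UNIV \<Longrightarrow> hcurve UNIV complex_line f"
  by (auto simp: hcurve_def complex_line_def holomorphic_on_imp_continuous_on)

lemma holomorphic_map_line_complex_line:
  "f holomorphic_on UNIV \<Longrightarrow> holomorphic_map line_space complex_line (\<lambda>w. f (w 0))"
  using holomorphic_map_line_space[OF hcurve_complex_line charted_complex_line]
  by (simp add: range_line_embed)

text \<open>The coordinate \<open>w 0\<close> does all the work: it separates points, has derivative
  1 and bounds the hulls of compact sets.\<close>

lemma stein_line_space: "stein_manifold line_space"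
  unfolding stein_manifold_def
proof (intro conjI ballI allI impI)
  show "complex_manifold line_space" by (rule complex_manifold_line_space)
  have coord: "holomorphic_map line_space complex_line (\<lambda>w. w 0)"
    using holomorphic_map_line_complex_line[of "\<lambda>z. z"] by (simp add: holomorphic_intros)
  show "\<exists>f. holomorphic_map line_space complex_line f \<and> f p \<noteq> f q"
    if "p \<in> topspace (cm_top line_space)" "q \<in> topspace (cm_top line_space)" "p \<noteq> q" for p q
  proof -
    have "line_embed (p 0) = p" "line_embed (q 0) = q" using that by (auto simp: line_space_simps)
    then have "p 0 \<noteq> q 0" using that by metis
    then show ?thesis using coord by blast
  qed
  show "\<exists>F. (\<forall>i<cm_dim line_space. holomorphic_map line_space complex_line (F i)) \<and>
        (\<forall>(U, \<phi>)\<in>cm_charts line_space. p \<in> U \<longrightarrow> (\<forall>c :: nat \<Rightarrow> complex.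
             (\<forall>j<cm_dim line_space.
               (\<Sum>i<cm_dim line_space. c i * partial_deriv j (\<lambda>z. F i (inv_into U \<phi> z)) (\<phi> p)) = 0) \<longrightarrow>
             (\<forall>i<cm_dim line_space. c i = 0)))"
    if p: "p \<in> topspace (cm_top line_space)" for p
  proof -
    have "p(0 := t) \<in> affine_space (Suc 0)" for t using p by (auto simp: line_space_simps affine_space_def)
    then have "inv_into (affine_space (Suc 0)) (\<lambda>z. z) (p(0 := t)) 0 = t" for t
      using inv_into_f_f[of "\<lambda>z. z" "affine_space (Suc 0)" "p(0 := t)"] by simp
    then have "partial_deriv 0 (\<lambda>z. inv_into (affine_space (Suc 0)) (\<lambda>z. z) z 0) p = 1"
      by (simp add: partial_deriv_def)
    then show ?thesis using coord by (intro exI[of _ "\<lambda>i w. w 0"]) (simp add: line_space_simps)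
  qed
  show "compactin (cm_top line_space) (holomorphic_hull line_space K)" if K: "compactin (cm_top line_space) K" for K
  proof -
    let ?A = "affine_space (Suc 0)" and ?H = "holomorphic_hull line_space K"
    have K': "compact K" using K by (simp add: line_space_simps compactin_subtopology)
    have "continuous_on K (\<lambda>w. w 0 :: complex)" by (rule continuous_coordinate)
    then have "bounded ((\<lambda>w. w 0) ` K)" using K' compact_continuous_image compact_imp_bounded by blast
    then obtain C where C: "\<And>q. q \<in> K \<Longrightarrow> cmod (q 0) \<le> C" unfolding bounded_iff by blast
    have sub: "?H \<subseteq> {w \<in> ?A. adist (Suc 0) w (\<lambda>_. 0) \<le> C}"
      using coord C by (auto simp: holomorphic_hull_def line_space_simps adist_def)
    \<comment> \<open>The hull is an intersection of closed sublevel sets, hence closed; lying in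
      the compact ball of radius \<open>C\<close>, it is compact.\<close>
    define \<F> where "\<F> = {{p \<in> ?A. f p \<in> cball 0 c} | f c.
      holomorphic_map line_space complex_line f \<and> (\<forall>q\<in>K. cmod (f q) \<le> c)}"
    have "?H = \<Inter>(insert ?A \<F>)"
    proof (intro equalityI subsetI)
      fix p assume "p \<in> ?H" then show "p \<in> \<Inter>(insert ?A \<F>)"
        by (auto simp: \<F>_def holomorphic_hull_def line_space_simps)
    next
      fix p assume p: "p \<in> \<Inter>(insert ?A \<F>)"
      have "cmod (f p) \<le> c" if "holomorphic_map line_space complex_line f" "\<forall>q\<in>K. cmod (f q) \<le> c" for f c
      proof -
        have "{p \<in> ?A. f p \<in> cball 0 c} \<in> \<F>" using that unfolding \<F>_def by blast
        then show ?thesis using p by auto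
      qed
      then show "p \<in> ?H" using p by (auto simp: holomorphic_hull_def line_space_simps)
    qed
    moreover have "closedin (top_of_set ?A) (\<Inter>(insert ?A \<F>))"
    proof (rule closedin_Inter)
      fix S assume "S \<in> insert ?A \<F>"
      then consider "S = ?A" | f c where "S = {p \<in> ?A. f p \<in> cball 0 c}" "holomorphic_map line_space complex_line f"
        by (auto simp: \<F>_def)
      then show "closedin (top_of_set ?A) S"
      proof cases
        case 2
        then have "continuous_map (top_of_set ?A) euclidean f"
          by (simp add: holomorphic_map_def line_space_simps complex_line_def)
        from closedin_continuous_map_preimage[OF this, of "cball 0 c"] 2(1) show ?thesis by simp
      qed simp
    qed simp
    ultimately have "closed ?H" using closed_affine_space closedin_closed_trans by metis
    then have "compact ({w \<in> ?A. adist (Suc 0) w (\<lambda>_. 0) \<le> C} \<inter> ?H)"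
      by (rule compact_Int_closed[OF compact_adist_cball])
    moreover have "{w \<in> ?A. adist (Suc 0) w (\<lambda>_. 0) \<le> C} \<inter> ?H = ?H" using sub by blast
    ultimately show ?thesis using sub by (auto simp: line_space_simps compactin_subtopology)
  qed
qed

text \<open>The coordinate alone confines the hull to the disc.\<close>

lemma closed_disc_holomorphically_convex:
  "compact_holomorphically_convex line_space (line_embed ` cball 0 1)"
proof -
  have coord: "holomorphic_map line_space complex_line (\<lambda>w. w 0)"
    using holomorphic_map_line_complex_line[of "\<lambda>z. z"] by (simp add: holomorphic_intros)
  have "compact (line_embed ` cball 0 1)"
    by (intro compact_continuous_image continuous_line_embed) simp
  moreover have "p \<in> line_embed ` cball 0 1" if "p \<in> holomorphic_hull line_space (line_embed ` cball 0 1)" for p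
  proof -
    have p: "p \<in> affine_space (Suc 0)" using that by (simp add: holomorphic_hull_def line_space_simps)
    have "cmod (p 0) \<le> 1" using that coord by (fastforce simp: holomorphic_hull_def)
    then show ?thesis using line_embed_of_affine[OF p] by (intro image_eqI[of _ _ "p 0"]) auto
  qed
  ultimately show ?thesis
    unfolding compact_holomorphically_convex_def
    by (auto simp: line_space_simps compactin_subtopology holomorphic_hull_def)
qed

text \<open>The set on which interpolation will be prescribed, as the zero set of the constant
  1.\<close>

lemma closed_subvariety_empty: "closed_subvariety line_space {}"
proof -
  have "holomorphic_map line_space complex_line (\<lambda>w. 1)"
    using holomorphic_map_line_complex_line[of "\<lambda>z. 1"] by (simp add: holomorphic_intros)
  then show ?thesis
    unfolding closed_subvariety_def line_space_simps
    by (intro conjI ballI exI[of _ "affine_space (Suc 0)"] exI[of _ "{\<lambda>w. 1}"]) auto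
qed


section \<open>Entire curves approximating a disc in a fibre\<close>

context hyperbolic_bundle
begin

text \<open>Closeness on the closed unit disc keeps the approximating entire curve over
  \<open>U\<close> there and puts its fibre coordinates at 0 and 1 into disjoint open sets, whereas
  \<open>entire_curve_vertically_constant\<close> makes them equal.\<close>

lemma not_oka:
  assumes dim: "cm_dim Y > 0"
  shows "\<not> oka_manifold E"
proof
  assume oka: "oka_manifold E"
  have "topspace (cm_top E) \<noteq> {}" using manifolds(1) by (simp add: complex_manifold_def)
  then obtain e0 where e0: "e0 \<in> topspace (cm_top E)" by blast
  define x0 where "x0 = \<pi> e0"
  have x0: "x0 \<in> topspace (cm_top X)" unfolding x0_def using holomorphic_map_in_topspace[OF projection e0] .
  obtain U \<theta> \<theta>i where U: "x0 \<in> U" "trivialization U \<theta> \<theta>i" using trivialization_exists[OF x0] .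
  define y0 where "y0 = snd (\<theta> e0)"
  have "e0 \<in> fibre x0" using e0 by (simp add: fibre_def x0_def)
  then have y0: "y0 \<in> topspace (cm_top Y)"
    unfolding y0_def using trivialization_fibre_snd[OF U(2,1)] by blast
  obtain V \<psi> where V: "(V, \<psi>) \<in> cm_charts Y" "y0 \<in> V" using charted_cover[OF Y_charted y0] .
  let ?n = "cm_dim Y"
  note ch = charted_chart[OF Y_charted V(1)]
  obtain \<rho> where \<rho>: "\<rho> > 0" "\<And>w. w \<in> affine_space ?n \<Longrightarrow> adist ?n w (\<psi> y0) \<le> \<rho> \<Longrightarrow> w \<in> \<psi> ` V"
    using adist_cball_subset[OF chart_homeomorphic(1)[OF manifolds(3) V(1)], of "\<psi> y0"] V by blast
  \<comment> \<open>A linear disc in the first coordinate direction, available because the dimension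
    is positive. The parameter is allowed modulus up to 2, which leaves a neighbourhood of the
    closed unit disc; the factor \<open>\<rho> / 2\<close> then keeps the disc in the chart.\<close>
  define g :: "complex \<Rightarrow> nat \<Rightarrow> complex" where "g t = (\<psi> y0)(0 := \<psi> y0 0 + of_real (\<rho> / 2) * t)" for t
  \<comment> \<open>Radial retraction onto the disc of radius 2; it extends the disc \<open>g\<close> continuously to the line.\<close>
  define r :: "complex \<Rightarrow> complex" where "r t = t / of_real (max 1 (cmod t / 2))" for t
  have r_le: "cmod (r t) \<le> 2" for t
    by (auto simp: r_def norm_divide max_def field_simps)
  have r_id: "r t = t" if "cmod t \<le> 2" for t using that by (simp add: r_def max_def)
  have r_cont: "continuous_on UNIV r"
    unfolding r_def by (intro continuous_intros) (auto simp: max_def)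
  have g_image: "g t \<in> \<psi> ` V" if "cmod t \<le> 2" for t
  proof (rule \<rho>(2))
    have "\<psi> y0 \<in> affine_space ?n" using ch(3) V(2) by blast
    then show "g t \<in> affine_space ?n" using dim by (auto simp: g_def affine_space_def)
    have "adist ?n (g t) (\<psi> y0) = (\<Sum>i<?n. if i = 0 then cmod (of_real (\<rho> / 2) * t) else 0)"
      unfolding adist_def by (rule sum.cong) (auto simp: g_def)
    also have "\<dots> = \<rho> / 2 * cmod t" using dim \<rho>(1) by (simp add: norm_mult)
    also have "\<dots> \<le> \<rho>" using that \<rho>(1) by (simp add: field_simps)
    finally show "adist ?n (g t) (\<psi> y0) \<le> \<rho>" .
  qed
  define \<gamma> where "\<gamma> t = inv_into V \<psi> (g (r t))" for t
  have \<gamma>V: "\<gamma> t \<in> V" "\<psi> (\<gamma> t) = g (r t)" for t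
    using g_image[OF r_le, of t] by (auto simp: \<gamma>_def intro: inv_into_into f_inv_into_f)
  have \<gamma>Y: "\<gamma> t \<in> topspace (cm_top Y)" for t using \<gamma>V(1) openin_subset[OF ch(1)] by blast
  have "continuous_on UNIV (\<lambda>t. g (r t))"
  proof (rule continuous_on_coordinatewise_then_product)
    show "continuous_on UNIV (\<lambda>t. g (r t) i)" for i
      by (cases "i = 0") (auto simp: g_def intro!: continuous_intros r_cont)
  qed
  then have "continuous_map euclidean (top_of_set (\<psi> ` V)) (\<lambda>t. g (r t))"
    using g_image[OF r_le] by (auto simp: continuous_map_in_subtopology)
  from continuous_map_compose[OF this chart_inverse_continuous[OF manifolds(3) V(1)]]
  have \<gamma>_cont: "continuous_map euclidean (cm_top Y) \<gamma>" by (simp add: o_def \<gamma>_def[abs_def])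
  have "hcurve (ball 0 2) Y (\<lambda>t. inv_into V \<psi> (g t))"
  proof (rule hcurve_chart_inverse[OF manifolds(3) V(1)])
    show "(\<lambda>t. g t i) holomorphic_on ball 0 2" for i
      by (cases "i = 0") (auto simp: g_def intro!: holomorphic_intros)
  qed (use g_image in auto)
  then have \<gamma>_hol: "hcurve (ball 0 2) Y \<gamma>"
    by (rule hcurve_cong) (simp add: \<gamma>_def r_id)
  \<comment> \<open>The map stays in the single fibre over \<open>x0\<close>; only its fibre
    coordinate moves.\<close>
  define f0 where "f0 w = \<theta>i (x0, \<gamma> (w 0))" for w :: "nat \<Rightarrow> complex"
  have f0_fibre: "f0 w \<in> fibre x0" for w unfolding f0_def using trivialization_fibre[OF U(2,1) \<gamma>Y] .
  have f0_snd: "snd (\<theta> (f0 w)) = \<gamma> (w 0)" for w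
    unfolding f0_def using trivialization_snd_inverse[OF U(2,1) \<gamma>Y] .
  have cont: "continuous_map (cm_top line_space) (cm_top E) f0"
  proof -
    have "continuous_on (affine_space (Suc 0)) (\<lambda>w. w 0 :: complex)" by (rule continuous_coordinate)
    then have "continuous_map (cm_top line_space) euclidean (\<lambda>w. w 0)" by (simp add: line_space_simps)
    from continuous_map_compose[OF this \<gamma>_cont]
    have "continuous_map (cm_top line_space) (cm_top Y) (\<lambda>w. \<gamma> (w 0))" by (simp add: o_def)
    moreover have "continuous_map (cm_top line_space) (subtopology (cm_top X) U) (\<lambda>w. x0)"
      using x0 U(1) by simp
    ultimately have "continuous_map (cm_top line_space) (prod_topology (subtopology (cm_top X) U) (cm_top Y))
        (\<lambda>w. (x0, \<gamma> (w 0)))"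
      by (rule continuous_map_pairedI[rotated])
    moreover have "continuous_map (prod_topology (subtopology (cm_top X) U) (cm_top Y)) (cm_top E) \<theta>i"
      using U(2) unfolding trivialization_def holomorphic_map_def product_manifold_def open_submanifold_def
      by (auto simp: continuous_map_in_subtopology)
    ultimately show ?thesis using continuous_map_compose by (fastforce simp: f0_def[abs_def] o_def)
  qed
  let ?K = "line_embed ` cball 0 1"
  have near: "holomorphic_near line_space E ?K f0"
    unfolding holomorphic_near_def
  proof (intro exI conjI)
    have "continuous_on (affine_space (Suc 0)) (\<lambda>w. w 0 :: complex)" by (rule continuous_coordinate)
    then have "openin (top_of_set (affine_space (Suc 0))) {w \<in> affine_space (Suc 0). w 0 \<in> ball 0 2}"
      using openin_continuous_map_preimage[of "top_of_set (affine_space (Suc 0))" euclidean "\<lambda>w. w 0 :: complex" "ball 0 2"]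
      by simp
    moreover have "{w \<in> affine_space (Suc 0). w 0 \<in> ball 0 2} = line_embed ` ball 0 2"
    proof (intro equalityI subsetI)
      fix w assume "w \<in> {w \<in> affine_space (Suc 0). w 0 \<in> ball 0 2}"
      then show "w \<in> line_embed ` ball 0 2" by (intro image_eqI[of _ _ "w 0"]) auto
    qed auto
    ultimately show "openin (cm_top line_space) (line_embed ` ball 0 2)" by (simp add: line_space_simps)
    show "?K \<subseteq> line_embed ` ball 0 2" by (intro image_mono) auto
    have "hcurve (ball 0 2) E (\<lambda>t. \<theta>i (x0, \<gamma> t))"
      by (rule hcurve_trivialization_inverse[OF U(2) hcurve_const[OF x0] _ \<gamma>_hol]) (use U in auto)
    from holomorphic_map_line_space[OF this E_charted]
    show "holomorphic_map (open_submanifold line_space (line_embed ` ball 0 2)) E f0"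
      by (simp add: f0_def[abs_def])
  qed
  have y01: "\<gamma> 0 \<noteq> \<gamma> 1"
  proof
    assume "\<gamma> 0 = \<gamma> 1"
    then have "g (r 0) 0 = g (r 1) 0" using \<gamma>V(2) by metis
    then show False using \<rho>(1) by (simp add: g_def r_id)
  qed
  have "Hausdorff_space (cm_top Y)" using manifolds(3) by (simp add: complex_manifold_def)
  then obtain O0 O1 where O: "openin (cm_top Y) O0" "openin (cm_top Y) O1" "\<gamma> 0 \<in> O0" "\<gamma> 1 \<in> O1" "disjnt O0 O1"
    using y01 \<gamma>Y unfolding Hausdorff_space_def by metis
  define N where "N Q = {e \<in> tube U. snd (\<theta> e) \<in> Q}" for Q
  have N_open: "openin (cm_top E) (N Q)" if "openin (cm_top Y) Q" for Q
  proof -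
    have tube: "openin (cm_top E) (tube U)" using openin_tube[OF trivialization_open[OF U(2)]] .
    have "continuous_map (subtopology (cm_top E) (tube U)) (prod_topology (subtopology (cm_top X) U) (cm_top Y)) \<theta>"
      using U(2) unfolding trivialization_def holomorphic_map_def product_manifold_def open_submanifold_def
      by simp
    from continuous_map_compose[OF this continuous_map_snd]
    have "openin (subtopology (cm_top E) (tube U)) {e \<in> topspace (subtopology (cm_top E) (tube U)). (snd \<circ> \<theta>) e \<in> Q}"
      using that by (rule openin_continuous_map_preimage)
    moreover have "{e \<in> topspace (subtopology (cm_top E) (tube U)). (snd \<circ> \<theta>) e \<in> Q} = N Q"
      using openin_subset[OF tube] by (auto simp: N_def)
    ultimately show ?thesis using openin_trans_full[OF _ tube] by simp
  qed
  obtain d where d: "Metric_space (topspace (cm_top E)) d"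
    "Metric_space.mtopology (topspace (cm_top E)) d = cm_top E"
    using complex_manifold_metrizable[OF manifolds(1)] .
  interpret d: Metric_space "topspace (cm_top E)" d by (rule d(1))
  have f0_tube: "f0 w \<in> tube U" for w using f0_fibre[of w] U(1) by (auto simp: fibre_def tube_def)
  have K: "compactin (cm_top line_space) ?K"
    using closed_disc_holomorphically_convex by (simp add: compact_holomorphically_convex_def)
  \<comment> \<open>A Lebesgue number of a one-element cover gives one \<delta> for all points of
    the compact image.\<close>
  have "\<exists>\<delta>>0. \<forall>e\<in>f0 ` ?K. \<exists>W\<in>{tube U}. d.mball e \<delta> \<subseteq> W"
  proof (rule d.lebesgue_number)
    show "compactin d.mtopology (f0 ` ?K)" using image_compactin[OF K cont] d(2) by simp
  qed (use f0_tube d(2) openin_tube[OF trivialization_open[OF U(2)]] in auto)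
  then obtain \<delta> where \<delta>: "\<delta> > 0" "\<And>w. w \<in> ?K \<Longrightarrow> d.mball (f0 w) \<delta> \<subseteq> tube U" by auto
  have "\<exists>\<delta>>0. d.mball (f0 w) \<delta> \<subseteq> N Q" if "openin (cm_top Y) Q" "\<gamma> (w 0) \<in> Q" for w Q
    using N_open[OF that(1)] f0_tube f0_snd[of w] that(2) d(2) d.openin_mtopology[of "N Q"]
    by (auto simp: N_def)
  from this[OF O(1), of "line_embed 0"] this[OF O(2), of "line_embed 1"] O(3,4)
  obtain \<delta>0 \<delta>1 where \<delta>01: "\<delta>0 > 0" "d.mball (f0 (line_embed 0)) \<delta>0 \<subseteq> N O0"
    "\<delta>1 > 0" "d.mball (f0 (line_embed 1)) \<delta>1 \<subseteq> N O1"
    by auto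
  \<comment> \<open>\<open>\<delta>\<close> keeps the curve over \<open>U\<close> on the unit disc;
    \<open>\<delta>0\<close> and \<open>\<delta>1\<close> separate its fibre coordinates at 0 and
    1.\<close>
  define \<epsilon> where "\<epsilon> = min \<delta> (min \<delta>0 \<delta>1)"
  have \<epsilon>: "\<epsilon> > 0" using \<delta>(1) \<delta>01(1,3) by (simp add: \<epsilon>_def)
  obtain f1 where f1: "homotopic_with
      (\<lambda>f. holomorphic_near line_space E ?K f \<and> (\<forall>p\<in>?K. d (f p) (f0 p) < \<epsilon>) \<and> (\<forall>p\<in>{}. f p = f0 p))
      (cm_top line_space) (cm_top E) f0 f1" "holomorphic_map line_space E f1"
  proof -
    have sub: "holomorphic_on_subvariety line_space E {} f0" by (simp add: holomorphic_on_subvariety_def)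
    have "\<forall>(S :: (nat \<Rightarrow> complex) cmanifold) K S' f0 d (\<epsilon> :: real).
        stein_manifold S \<and> compact_holomorphically_convex S K \<and> closed_subvariety S S' \<and>
        continuous_map (cm_top S) (cm_top E) f0 \<and>
        holomorphic_near S E K f0 \<and> holomorphic_on_subvariety S E S' f0 \<and>
        Metric_space (topspace (cm_top E)) d \<and>
        Metric_space.mtopology (topspace (cm_top E)) d = cm_top E \<and> \<epsilon> > 0 \<longrightarrow>
        (\<exists>f1. homotopic_with
                (\<lambda>f. holomorphic_near S E K f \<and> (\<forall>p\<in>K. d (f p) (f0 p) < \<epsilon>) \<and> (\<forall>p\<in>S'. f p = f0 p))
                (cm_top S) (cm_top E) f0 f1 \<and>
              holomorphic_map S E f1)"
      using oka unfolding oka_manifold_def by (rule conjunct2)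
    from this[rule_format, OF conjI[OF stein_line_space conjI[OF closed_disc_holomorphically_convex
          conjI[OF closed_subvariety_empty conjI[OF cont conjI[OF near conjI[OF sub conjI[OF d(1) conjI[OF d(2) \<epsilon>]]]]]]]]]
    show thesis using that by blast
  qed
  define f where "f z = f1 (line_embed z)" for z
  have f: "hcurve UNIV E f"
    unfolding f_def
    by (rule hcurve_compose[OF complex_manifold_charted[OF complex_manifold_line_space] E_charted f1(2) hcurve_line_embed])
  \<comment> \<open>The closeness condition holds along the whole homotopy, in particular at its end
    \<open>f1\<close>.\<close>
  have f_close: "f z \<in> d.mball (f0 (line_embed z)) \<epsilon>" if "z \<in> cball 0 1" for z
  proof -
    have "d (f1 (line_embed z)) (f0 (line_embed z)) < \<epsilon>"
      using homotopic_with_imp_property[OF f1(1)] that by blast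
    then show ?thesis
      using hcurve_in_topspace[OF f, of z] f0_fibre[of "line_embed z"] d.commute
      by (auto simp: f_def fibre_def d.in_mball)
  qed
  have mono: "f z \<in> d.mball (f0 (line_embed z)) \<eta>" if "z \<in> cball 0 1" "\<epsilon> \<le> \<eta>" for z \<eta>
    using f_close[OF that(1)] d.mball_subset_concentric[OF that(2)] by blast
  have "snd (\<theta> (f 0)) = snd (\<theta> (f 1))"
  proof (rule entire_curve_vertically_constant[OF U(2) f])
    show "\<pi> (f z) \<in> U" if "z \<in> cball 0 1" for z
      using mono[OF that, of \<delta>] \<delta>(2)[of "line_embed z"] that by (auto simp: \<epsilon>_def tube_def)
  qed
  moreover have "f 0 \<in> N O0" using mono[of 0 \<delta>0] \<delta>01(2) by (auto simp: \<epsilon>_def)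
  moreover have "f 1 \<in> N O1" using mono[of 1 \<delta>1] \<delta>01(4) by (auto simp: \<epsilon>_def)
  ultimately show False using O(5) by (auto simp: N_def disjnt_iff)
qed

end

theorem proposition1p2:
  fixes E :: "'e cmanifold" and X :: "'x cmanifold" and Y :: "'y cmanifold"
    and \<pi> :: "'e \<Rightarrow> 'x"
  assumes "complex_manifold X" and "connected_space (cm_top X)"
    and "holomorphic_fibre_bundle E X Y \<pi>"
    and "kobayashi_hyperbolic Y" and "cm_dim Y > 0"
  shows "\<not> oka_manifold E"
proof -
  interpret hyperbolic_bundle E X Y \<pi>
    using assms(3,4) by unfold_locales
  show ?thesis using assms(5) by (rule not_oka)
qed

end
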